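(* The $Z$-polynomials $Z_{F_n}(t)$ (for $n\ge1$), $Z_{W_n}(t)$ (for $n\ge3$) and $Z_{W^n}(t)$ (for $n\ge 3$) have only real zeros.
   Context: For a matroid $M$ let $L(M)$ be its lattice of flats, $\mathrm{rk}\, M$ its rank, $\chi_M(t)$ its characteristic polynomial; for a flat $F$, $M_F$ is the localization (restriction to $F$) and $M^F$ the contraction at $F$. The Kazhdan–Lusztig polynomial is the unique assignment of $P_M(t)\in\mathbb{Z}[t]$ to each loopless matroid $M$ with: $P_M=1$ if $\mathrm{rk}\, M=0$; $\deg P_M<\frac12\mathrm{rk}\, M$ if $\mathrm{rk}\, M>0$; $t^{\mathrm{rk}\, M}P_M(t^{-1})=\sum_{F\in L(M)}\chi_{M_F}(t)P_{M^F}(t)$. The $Z$-polynomial is $Z_M(t)=\sum_{F\in L(M)}t^{\mathrm{rk}\, M_F}P_{M^F}(t)$; for a graph $G$, $Z_G=Z_{M(G)}$. The fan graph $F_n$ has vertices $0,1,\dots,n$, edges $\{i,i+1\}$ ($1\le i<n$) and $\{0,i\}$ ($1\le i\le n$). The wheel $W_n$ ($n\ge3$) has vertices $0,\dots,n$, the edges of the cycle $1,2,\dots,n,1$ (edge set $O_n$) and edges $\{0,i\}$. The whirl matroid $W^n$ is the matroid on $E(W_n)$ whose independent sets are the edge sets of forests of $W_n$ together with $O_n$. *)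

theory Defs
  imports "HOL-Computational_Algebra.Polynomial"
begin

section \<open>Matroids\<close>

record 'a set_system =
  ground :: "'a set"
  indeps :: "'a set set"

locale matroid =
  fixes M :: "'a set_system"
  assumes finite_ground: "finite (ground M)"
    and indeps_subset: "indeps M \<subseteq> Pow (ground M)"
    and indeps_empty: "{} \<in> indeps M"
    and indeps_down: "J \<in> indeps M \<Longrightarrow> I \<subseteq> J \<Longrightarrow> I \<in> indeps M"
    and indeps_exchange: "I \<in> indeps M \<Longrightarrow> J \<in> indeps M \<Longrightarrow> card I < card J
      \<Longrightarrow> \<exists>x \<in> J - I. insert x I \<in> indeps M"

definition loopless :: "'a set_system \<Rightarrow> bool" where
  "loopless M \<longleftrightarrow> (\<forall>e \<in> ground M. {e} \<in> indeps M)"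

definition rank_of :: "'a set_system \<Rightarrow> 'a set \<Rightarrow> nat" where
  "rank_of M A = Max (card ` {I \<in> indeps M. I \<subseteq> A})"

definition rk :: "'a set_system \<Rightarrow> nat" where
  "rk M = rank_of M (ground M)"

definition closure_of :: "'a set_system \<Rightarrow> 'a set \<Rightarrow> 'a set" where
  "closure_of M A = {x \<in> ground M. rank_of M (insert x A) = rank_of M A}"

definition flats :: "'a set_system \<Rightarrow> 'a set set" where
  "flats M = {F. F \<subseteq> ground M \<and> closure_of M F = F}"

definition localization :: "'a set_system \<Rightarrow> 'a set \<Rightarrow> 'a set_system" where
  "localization M F = \<lparr>ground = F, indeps = {I \<in> indeps M. I \<subseteq> F}\<rparr>"

definition basis_of :: "'a set_system \<Rightarrow> 'a set \<Rightarrow> 'a set \<Rightarrow> bool" where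
  "basis_of M A B \<longleftrightarrow> B \<in> indeps M \<and> B \<subseteq> A
     \<and> (\<forall>I \<in> indeps M. B \<subseteq> I \<and> I \<subseteq> A \<longrightarrow> I = B)"

definition contraction :: "'a set_system \<Rightarrow> 'a set \<Rightarrow> 'a set_system" where
  "contraction M F = \<lparr>ground = ground M - F,
     indeps = {I. I \<subseteq> ground M - F \<and> (\<exists>B. basis_of M F B \<and> I \<union> B \<in> indeps M)}\<rparr>"

text \<open>The Moebius function of a family \<open>L\<close> of finite sets ordered by inclusion; the
  finiteness test only serves termination.\<close>

function moebius :: "'a set set \<Rightarrow> 'a set \<Rightarrow> 'a set \<Rightarrow> int" where
  "moebius L X Y =
     (if X = Y then 1
      else if X \<subset> Y \<and> finite Y
        then - (\<Sum>W \<in> {W \<in> L. X \<subseteq> W \<and> W \<subset> Y}. moebius L X W)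
      else 0)"
  by pat_completeness auto
termination
  by (relation "measure (\<lambda>(L, X, Y). card Y)") (auto intro: psubset_card_mono)

declare moebius.simps [simp del]

text \<open>\<open>closure_of M {}\<close> is the bottom of the lattice of flats; it is empty when \<open>M\<close> is
  loopless, the only case used below.\<close>

definition charpoly_matroid :: "'a set_system \<Rightarrow> int poly" where
  "charpoly_matroid M = (\<Sum>F \<in> flats M. monom (moebius (flats M) (closure_of M {}) F) (rk M - rank_of M F))"

section \<open>Kazhdan--Lusztig polynomials and \<open>Z\<close>-polynomials\<close>

text \<open>For \<open>degree p \<le> r\<close> this is the polynomial $t^r p(t^{-1})$.\<close>

definition reverse_at :: "nat \<Rightarrow> int poly \<Rightarrow> int poly" where
  "reverse_at r p = (\<Sum>i \<le> r. monom (coeff p i) (r - i))"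

text \<open>The ground sets range over the finite subsets of a fixed type; this class of matroids is
  closed under localization and contraction, so the recursion stays inside it. The last clause
  is a convention that fixes the value at the remaining set systems, making the assignment
  unique as a total function.\<close>

definition KL_assignment :: "('a set_system \<Rightarrow> int poly) \<Rightarrow> bool" where
  "KL_assignment P \<longleftrightarrow>
     (\<forall>M. matroid M \<and> loopless M \<longrightarrow>
        (rk M = 0 \<longrightarrow> P M = 1) \<and>
        (rk M > 0 \<longrightarrow> 2 * degree (P M) < rk M) \<and>
        reverse_at (rk M) (P M)
          = (\<Sum>F \<in> flats M. charpoly_matroid (localization M F) * P (contraction M F))) \<and>
     (\<forall>M. \<not> (matroid M \<and> loopless M) \<longrightarrow> P M = 0)"

definition KL_poly :: "'a set_system \<Rightarrow> int poly" where
  "KL_poly = (THE P. KL_assignment P)"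

definition Z_poly :: "'a set_system \<Rightarrow> int poly" where
  "Z_poly M = (\<Sum>F \<in> flats M. monom 1 (rk (localization M F)) * KL_poly (contraction M F))"

section \<open>Graphs\<close>

text \<open>Finite simple graphs, with edges as two-element vertex sets.\<close>

record 'v graph =
  verts :: "'v set"
  edges :: "'v set set"

text \<open>A cycle is listed as its cyclic sequence of pairwise distinct vertices.\<close>

definition is_cycle :: "'v set set \<Rightarrow> 'v list \<Rightarrow> bool" where
  "is_cycle X vs \<longleftrightarrow> length vs \<ge> 3 \<and> distinct vs
     \<and> (\<forall>i < length vs. {vs ! i, vs ! (Suc i mod length vs)} \<in> X)"

definition forest :: "'v set set \<Rightarrow> bool" where
  "forest X \<longleftrightarrow> (\<nexists>vs. is_cycle X vs)"

definition graphic_matroid :: "'v graph \<Rightarrow> 'v set set_system" where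
  "graphic_matroid G = \<lparr>ground = edges G, indeps = {X. X \<subseteq> edges G \<and> forest X}\<rparr>"

definition Z_graph :: "'v graph \<Rightarrow> int poly" where
  "Z_graph G = Z_poly (graphic_matroid G)"

definition fan_graph :: "nat \<Rightarrow> nat graph" where
  "fan_graph n = \<lparr>verts = {0..n},
     edges = {{i, i + 1} | i. 1 \<le> i \<and> i < n} \<union> {{0, i} | i. 1 \<le> i \<and> i \<le> n}\<rparr>"

definition rim :: "nat \<Rightarrow> nat set set" where
  "rim n = {{i, i + 1} | i. 1 \<le> i \<and> i < n} \<union> {{n, 1}}"

definition wheel_graph :: "nat \<Rightarrow> nat graph" where
  "wheel_graph n = \<lparr>verts = {0..n},
     edges = rim n \<union> {{0, i} | i. 1 \<le> i \<and> i \<le> n}\<rparr>"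

definition whirl_matroid :: "nat \<Rightarrow> nat set set_system" where
  "whirl_matroid n = \<lparr>ground = edges (wheel_graph n),
     indeps = {X. X \<subseteq> edges (wheel_graph n) \<and> forest X} \<union> {rim n}\<rparr>"

section \<open>Real-rootedness\<close>

definition only_real_zeros :: "int poly \<Rightarrow> bool" where
  "only_real_zeros p \<longleftrightarrow> (\<forall>z::complex. poly (map_poly of_int p) z = 0 \<longrightarrow> z \<in> \<real>)"

end

(*
  Existence and uniqueness of Kazhdan--Lusztig polynomials: P_M is the unique polynomial of degree
  less than rk M / 2 that makes Z_M palindromic, given the P of the proper contractions; Moebius
  inversion turns palindromicity into the defining recursion. Hence a function on the flats with
  these two properties gives the polynomials P of all contractions.

  A flat of a wheel or whirl is a cyclic word recording which vertices are joined to the hub and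
  which to their predecessor. Vertices joined to the hub cut the word into runs that behave like
  fans, and the sums over upper intervals become identities of generating functions. With
  q = x (1 + q) (1 + t q) one finds that Z of the fan, the whirl and the wheel on n rim vertices is
  the coefficient of x^(n+1) in q (Narayana polynomials), that of x^n in x q' / q (type B), and that
  of x^n in x q' / q - t q^2, respectively.

  By Lagrange inversion and the substitution t = (x - 1) / (x + 1), the first two are derivatives of
  (x^2 - 1)^n, which have only real zeros. The third becomes a A + b x A' with a, b > 0 and A
  the Legendre polynomial, and cannot vanish at a nonreal x because Im (A' / A) has the sign opposite
  to Im x.
*)

theory Submission
  imports Defs
    "HOL-Computational_Algebra.Formal_Power_Series"
    "HOL-Computational_Algebra.Fundamental_Theorem_Algebra"
begin

section \<open>Localization and contraction of matroids\<close>

text \<open>The Kazhdan--Lusztig polynomials that have to be guessed come from h = x (1 + h + t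
  h^2): they are the coefficients of 1 + h for fans, of x h' / (1 + h) for whirls, and of the latter
  minus (t h^2 + x) / (1 + t x) for wheels. Series in one variable suffice because the sum over an
  upper interval depends only on the numbers of blocks in the runs of a word, apart from the rim;
  composing h with x / (1 - t x) gives q. Wheel and whirl are treated together since their flats and
  guessed values differ only at words without hub vertex. There the rim, a basis of the whirl but a
  hyperplane of the wheel, makes the difference and produces the correction term. The obstacle is
  that the assignment lives on concrete set systems and that contractions of wheels have parallel
  elements. So everything stays in the lattice of flats of one fixed matroid, fans being
  restrictions of whirls to a flat. The exchange axiom, awkward for forests and more so for whirls,
  is obtained from a vector representation of both matroids.\<close>

context matroid begin

section \<open>Rank, bases and flats\<close>

lemma finite_indep: "I \<in> indeps M \<Longrightarrow> finite I"
  using indeps_subset finite_ground by (meson PowD finite_subset subsetD)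

lemma indep_ground: "I \<in> indeps M \<Longrightarrow> I \<subseteq> ground M"
  using indeps_subset by auto

lemma finite_indeps: "finite (indeps M)"
  using indeps_subset finite_ground by (meson finite_Pow_iff finite_subset)

lemma card_le_rank: "I \<in> indeps M \<Longrightarrow> I \<subseteq> A \<Longrightarrow> card I \<le> rank_of M A"
  unfolding rank_of_def by (rule Max_ge) (auto simp: finite_indeps)

lemma rank_le_iff: "rank_of M A \<le> n \<longleftrightarrow> (\<forall>I \<in> indeps M. I \<subseteq> A \<longrightarrow> card I \<le> n)"
proof -
  have "{I \<in> indeps M. I \<subseteq> A} \<noteq> {}" using indeps_empty by auto
  then show ?thesis unfolding rank_of_def
    by (subst Max_le_iff) (auto simp: finite_indeps)
qed

lemma rank_mono: "A \<subseteq> B \<Longrightarrow> rank_of M A \<le> rank_of M B"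
  by (meson card_le_rank order_trans rank_le_iff)

lemma rank_le_card: "finite A \<Longrightarrow> rank_of M A \<le> card A"
  by (simp add: card_mono rank_le_iff)

lemma rank_indep: "I \<in> indeps M \<Longrightarrow> rank_of M I = card I"
  by (simp add: card_le_rank finite_indep le_antisym rank_le_card)

lemma basis_of_card_eq:
  assumes "B \<in> indeps M" "B \<subseteq> A" "card B = rank_of M A"
  shows "basis_of M A B"
  unfolding basis_of_def using assms
  by (metis card_le_rank card_seteq finite_indep)

lemma card_basis: "basis_of M A B \<Longrightarrow> card B = rank_of M A"
proof (rule antisym)
  assume B: "basis_of M A B"
  then show "card B \<le> rank_of M A" by (auto simp: basis_of_def card_le_rank)
  show "rank_of M A \<le> card B"
    unfolding rank_le_iff
  proof (intro ballI impI, rule ccontr)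
    fix I assume I: "I \<in> indeps M" "I \<subseteq> A" "\<not> card I \<le> card B"
    then obtain x where "x \<in> I - B" "insert x B \<in> indeps M"
      using indeps_exchange[of B I] B by (auto simp: basis_of_def)
    then show False using B I unfolding basis_of_def by blast
  qed
qed

lemma basis_exists:
  assumes "I \<in> indeps M" "I \<subseteq> A"
  obtains B where "basis_of M A B" "I \<subseteq> B"
proof -
  let ?S = "{J \<in> indeps M. I \<subseteq> J \<and> J \<subseteq> A}"
  have "finite ?S" "?S \<noteq> {}" using finite_indeps assms by auto
  then have "\<exists>B \<in> ?S. \<forall>b \<in> ?S. B \<subseteq> b \<longrightarrow> B = b" by (rule finite_has_maximal)
  then obtain B where B: "B \<in> ?S" and max: "\<forall>b \<in> ?S. B \<subseteq> b \<longrightarrow> B = b"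
    by (elim bexE)
  have "basis_of M A B" unfolding basis_of_def
  proof (intro conjI ballI impI)
    fix J assume "J \<in> indeps M" "B \<subseteq> J \<and> J \<subseteq> A"
    then have "J \<in> ?S" "B \<subseteq> J" using B by auto
    then show "J = B" using max by (metis (no_types, lifting))
  qed (use B in auto)
  then show ?thesis using that B by blast
qed

lemma basis_Int:
  assumes "basis_of M F B" "C \<in> indeps M" "B \<subseteq> C"
  shows "C \<inter> F = B"
proof -
  have "C \<inter> F \<in> indeps M" using indeps_down[OF assms(2), of "C \<inter> F"] by simp
  moreover have "B \<subseteq> C \<inter> F" using assms by (auto simp: basis_of_def)
  ultimately show ?thesis using assms(1) unfolding basis_of_def by (metis Int_lower2)
qed

lemma basis_of_maximal:
  assumes "B \<in> indeps M" "B \<subseteq> A" "\<And>x. x \<in> A - B \<Longrightarrow> insert x B \<notin> indeps M"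
  shows "basis_of M A B"
  unfolding basis_of_def
proof (intro conjI ballI impI)
  fix I assume I: "I \<in> indeps M" "B \<subseteq> I \<and> I \<subseteq> A"
  show "I = B"
  proof (rule ccontr)
    assume "I \<noteq> B"
    then obtain x where "x \<in> I - B" using I by auto
    then show False using assms(3)[of x] indeps_down[OF I(1), of "insert x B"] I by auto
  qed
qed (use assms in auto)

text \<open>A single basis decides whether adding \<open>x\<close> raises the rank: if
  \<open>x\<close> does not extend \<open>B\<close>, then \<open>B\<close> is still maximal inside
  \<open>insert x A\<close>.\<close>

lemma insert_basis_indep_iff:
  assumes "basis_of M A B" "x \<notin> B" "x \<in> ground M"
  shows "insert x B \<in> indeps M \<longleftrightarrow> rank_of M (insert x A) \<noteq> rank_of M A"
proof
  assume i: "insert x B \<in> indeps M"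
  have "Suc (card B) \<le> rank_of M (insert x A)"
    using card_le_rank[OF i, of "insert x A"] assms finite_indep[of B]
    by (auto simp: basis_of_def)
  then show "rank_of M (insert x A) \<noteq> rank_of M A" using card_basis[OF assms(1)] by simp
next
  assume r: "rank_of M (insert x A) \<noteq> rank_of M A"
  show "insert x B \<in> indeps M"
  proof (rule ccontr)
    assume n: "insert x B \<notin> indeps M"
    have "basis_of M (insert x A) B"
      using assms n by (intro basis_of_maximal) (auto simp: basis_of_def)
    then show False using card_basis assms(1) r by metis
  qed
qed

text \<open>Recognises a flat and its rank from one independent set, without computing closures. For
  wheels and whirls it is applied to \<open>basis_word\<close> and to the rim minus an edge.\<close>

lemma flatI:
  assumes "B \<in> indeps M" "B \<subseteq> F" "F \<subseteq> ground M"
    "\<And>x. x \<in> F - B \<Longrightarrow> insert x B \<notin> indeps M"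
    "\<And>x. x \<in> ground M - F \<Longrightarrow> insert x B \<in> indeps M"
  shows "F \<in> flats M" "rank_of M F = card B"
proof -
  have b: "basis_of M F B" using assms by (intro basis_of_maximal) auto
  show "rank_of M F = card B" using card_basis[OF b] by simp
  have "x \<in> F" if "x \<in> ground M" "rank_of M (insert x F) = rank_of M F" for x
    using insert_basis_indep_iff[OF b, of x] that assms(2,5) by blast
  then show "F \<in> flats M" unfolding flats_def closure_of_def using assms(3)
    by (auto simp: insert_absorb)
qed

text \<open>Extending \<open>I\<close> to a basis of \<open>F\<close> keeps
  \<open>insert x I\<close> dependent, so \<open>x\<close> cannot raise the rank. This is how a flat
  is shown to contain the last edge of a circuit.\<close>

lemma flat_closed:
  assumes "F \<in> flats M" "I \<in> indeps M" "I \<subseteq> F" "insert x I \<notin> indeps M" "x \<in> ground M"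
  shows "x \<in> F"
proof (rule ccontr)
  assume x: "x \<notin> F"
  obtain B where B: "basis_of M F B" "I \<subseteq> B" using basis_exists assms by blast
  have "insert x B \<notin> indeps M" using assms(4) B(2) indeps_down by blast
  moreover have "x \<notin> B" using x B by (auto simp: basis_of_def)
  ultimately have "rank_of M (insert x F) = rank_of M F"
    using insert_basis_indep_iff[OF B(1)] assms(5) by blast
  then have "x \<in> closure_of M F" using assms(5) by (simp add: closure_of_def)
  then show False using x assms(1) by (simp add: flats_def)
qed

lemma flat_ground: "F \<in> flats M \<Longrightarrow> F \<subseteq> ground M" by (simp add: flats_def)
lemma finite_flat: "F \<in> flats M \<Longrightarrow> finite F" using flat_ground finite_ground finite_subset by blast
lemma finite_flats: "finite (flats M)"
  by (rule finite_subset[of _ "Pow (ground M)"]) (auto simp: flats_def finite_ground)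

lemma flat_iff: "F \<in> flats M \<longleftrightarrow> F \<subseteq> ground M \<and>
    (\<forall>x \<in> ground M - F. rank_of M (insert x F) \<noteq> rank_of M F)"
  unfolding flats_def closure_of_def by (auto simp: insert_absorb)

lemma rank_empty [simp]: "rank_of M {} = 0"
  using rank_indep[OF indeps_empty] by simp

lemma flat_rank_less: "F \<in> flats M \<Longrightarrow> G \<subseteq> ground M \<Longrightarrow> F \<subset> G \<Longrightarrow> rank_of M F < rank_of M G"
proof -
  assume F: "F \<in> flats M" "G \<subseteq> ground M" "F \<subset> G"
  then obtain x where "x \<in> G" "x \<notin> F" by auto
  then have "rank_of M (insert x F) \<noteq> rank_of M F" "rank_of M (insert x F) \<le> rank_of M G"
    using F by (auto simp: flat_iff intro!: rank_mono)
  moreover have "rank_of M F \<le> rank_of M (insert x F)" by (auto intro: rank_mono)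
  ultimately show ?thesis by simp
qed

lemma empty_flat: "loopless M \<Longrightarrow> {} \<in> flats M"
  unfolding flat_iff loopless_def using rank_indep by fastforce

section \<open>Localization and contraction\<close>

lemma ground_localization [simp]: "ground (localization M F) = F"
  by (simp add: localization_def)

lemma matroid_localization: "F \<subseteq> ground M \<Longrightarrow> matroid (localization M F)"
proof
  fix I J
  assume F: "F \<subseteq> ground M" and I: "I \<in> indeps (localization M F)" "J \<in> indeps (localization M F)" "card I < card J"
  then obtain x where "x \<in> J - I" "insert x I \<in> indeps M"
    using indeps_exchange[of I J] by (auto simp: localization_def)
  then show "\<exists>x\<in>J - I. insert x I \<in> indeps (localization M F)"
    using I by (intro bexI[of _ x]) (auto simp: localization_def)
qed (use finite_ground indeps_empty indeps_down in \<open>auto simp: localization_def intro: finite_subset\<close>)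

lemma rank_localization: "A \<subseteq> F \<Longrightarrow> rank_of (localization M F) A = rank_of M A"
proof -
  assume "A \<subseteq> F"
  then have "{I \<in> indeps (localization M F). I \<subseteq> A} = {I \<in> indeps M. I \<subseteq> A}"
    by (auto simp: localization_def)
  then show ?thesis by (simp add: rank_of_def)
qed

lemma rk_localization: "rk (localization M F) = rank_of M F"
  by (simp add: rk_def rank_localization)

lemma loopless_localization: "loopless M \<Longrightarrow> F \<subseteq> ground M \<Longrightarrow> loopless (localization M F)"
  by (auto simp: loopless_def localization_def)

lemma flats_localization:
  assumes "F \<in> flats M"
  shows "flats (localization M F) = {G \<in> flats M. G \<subseteq> F}"
proof -
  interpret L: matroid "localization M F" using assms flat_ground matroid_localization by auto
  have "G \<in> flats (localization M F) \<longleftrightarrow> G \<in> flats M" if G: "G \<subseteq> F" for G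
  proof
    assume "G \<in> flats M"
    then show "G \<in> flats (localization M F)" using G assms
      by (auto simp: L.flat_iff flat_iff rank_localization)
  next
    assume GL: "G \<in> flats (localization M F)"
    show "G \<in> flats M" unfolding flat_iff
    proof (intro conjI ballI)
      show gm: "G \<subseteq> ground M" using G assms flat_ground by blast
      fix x assume x: "x \<in> ground M - G"
      show "rank_of M (insert x G) \<noteq> rank_of M G"
      proof (cases "x \<in> F")
        case True
        then show ?thesis using GL x G unfolding L.flat_iff by (auto simp: rank_localization)
      next
        case False
        \<comment> \<open>Outside \<open>F\<close> the rank rises because \<open>F\<close> is
          closed: a basis of \<open>G\<close> lies in \<open>F\<close>, so an \<open>x\<close> that
          failed to extend it would belong to \<open>F\<close>.\<close>
        obtain B where B: "basis_of M G B" using basis_exists[OF indeps_empty] by blast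
        show ?thesis
        proof
          assume "rank_of M (insert x G) = rank_of M G"
          then have "insert x B \<notin> indeps M"
            using insert_basis_indep_iff[OF B, of x] x B by (auto simp: basis_of_def)
          then have "x \<in> F" using flat_closed[OF assms, of B x] B G x by (auto simp: basis_of_def)
          then show False using False by simp
        qed
      qed
    qed
  qed
  moreover have "G \<subseteq> F" if "G \<in> flats (localization M F)" for G
    using L.flat_ground[OF that] by (simp add: localization_def)
  ultimately show ?thesis by auto
qed

text \<open>\<open>contraction\<close> accepts any basis of \<open>F\<close> as a witness; one fixed
  basis suffices. Extend \<open>B\<close> to a basis \<open>C\<close> of
  \<open>I \<union> F\<close>. It meets \<open>F\<close> in \<open>B\<close>, so
  \<open>C \<subseteq> I \<union> B\<close>, and the other witness \<open>B'\<close> makes the rank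
  large enough to force equality.\<close>

lemma indep_contraction_iff:
  assumes "basis_of M F B" "F \<subseteq> ground M"
  shows "I \<in> indeps (contraction M F) \<longleftrightarrow> I \<subseteq> ground M - F \<and> I \<union> B \<in> indeps M"
proof
  assume "I \<in> indeps (contraction M F)"
  then obtain B' where I: "I \<subseteq> ground M - F" and B': "basis_of M F B'" "I \<union> B' \<in> indeps M"
    by (auto simp: contraction_def)
  obtain C where C: "basis_of M (I \<union> F) C" "B \<subseteq> C"
    using basis_exists[of B "I \<union> F"] assms by (auto simp: basis_of_def)
  have fin: "finite I" "finite B" "finite B'" "finite C"
    using B'(2) finite_indep assms(1) C(1) by (auto simp: basis_of_def)
  have "card (I \<union> B') = card I + card B'"
    using fin I B'(1) by (intro card_Un_disjoint) (auto simp: basis_of_def)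
  then have le: "card I + card B \<le> card C"
    using card_le_rank[OF B'(2), of "I \<union> F"] B'(1) card_basis[OF C(1)] card_basis[OF assms(1)]
      card_basis[OF B'(1)] by (auto simp: basis_of_def)
  have "C \<inter> F = B"
    using assms(1) C by (intro basis_Int) (auto simp: basis_of_def)
  then have "C \<subseteq> I \<union> B" using C(1) by (auto simp: basis_of_def)
  moreover have "card (I \<union> B) = card I + card B"
    using fin I assms(1) by (intro card_Un_disjoint) (auto simp: basis_of_def)
  ultimately have "C = I \<union> B" using le fin by (intro card_seteq) auto
  then show "I \<subseteq> ground M - F \<and> I \<union> B \<in> indeps M" using C(1) I by (auto simp: basis_of_def)
next
  assume "I \<subseteq> ground M - F \<and> I \<union> B \<in> indeps M"
  then show "I \<in> indeps (contraction M F)" using assms by (auto simp: contraction_def)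
qed

lemma ground_contraction [simp]: "ground (contraction M F) = ground M - F"
  by (simp add: contraction_def)

lemma matroid_contraction:
  assumes "F \<subseteq> ground M" shows "matroid (contraction M F)"
proof -
  obtain B where B: "basis_of M F B" using basis_exists[OF indeps_empty] by blast
  note iff = indep_contraction_iff[OF B assms]
  have BF: "B \<subseteq> F" "B \<in> indeps M" using B by (auto simp: basis_of_def)
  have card: "card (I \<union> B) = card I + card B" if "I \<in> indeps (contraction M F)" for I
    using that BF finite_indep unfolding iff by (intro card_Un_disjoint) auto
  show ?thesis
  proof
    fix J I assume J: "J \<in> indeps (contraction M F)" "I \<subseteq> J"
    then have "I \<union> B \<subseteq> J \<union> B" by auto
    then show "I \<in> indeps (contraction M F)" using J indeps_down[of "J \<union> B" "I \<union> B"] unfolding iff by auto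
  next
    fix I J assume I: "I \<in> indeps (contraction M F)" "J \<in> indeps (contraction M F)" "card I < card J"
    then have "card (I \<union> B) < card (J \<union> B)" using card by simp
    then obtain x where "x \<in> J \<union> B - (I \<union> B)" "insert x (I \<union> B) \<in> indeps M"
      using I iff indeps_exchange by blast
    then show "\<exists>x\<in>J - I. insert x I \<in> indeps (contraction M F)"
      using I unfolding iff by (intro bexI[of _ x]) auto
  qed (use finite_ground BF in \<open>auto simp: iff\<close>)
qed

lemma rank_contraction:
  assumes "F \<subseteq> ground M" "A \<subseteq> ground M - F"
  shows "rank_of (contraction M F) A = rank_of M (A \<union> F) - rank_of M F"
proof -
  interpret C: matroid "contraction M F" by (rule matroid_contraction[OF assms(1)])
  obtain B where B: "basis_of M F B" using basis_exists[OF indeps_empty] by blast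
  note iff = indep_contraction_iff[OF B assms(1)]
  have BF: "B \<subseteq> F" "B \<in> indeps M" using B by (auto simp: basis_of_def)
  obtain D where D: "basis_of M (A \<union> F) D" "B \<subseteq> D" using basis_exists[of B "A \<union> F"] BF by blast
  have DF: "D \<inter> F = B"
    using B D by (intro basis_Int) (auto simp: basis_of_def)
  have D': "D \<in> indeps M" "D \<subseteq> A \<union> F" using D by (auto simp: basis_of_def)
  have eq: "D - F \<union> B = D" using DF by auto
  have "basis_of (contraction M F) A (D - F)"
  proof (rule C.basis_of_maximal)
    show "D - F \<in> indeps (contraction M F)" unfolding iff using D' eq assms indep_ground by auto
    show "D - F \<subseteq> A" using D' by auto
    fix x assume x: "x \<in> A - (D - F)"
    then have xF: "x \<notin> F" using assms by auto
    then have "x \<notin> D" using x by auto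
    then have "insert x D \<notin> indeps M" using D x unfolding basis_of_def by blast
    moreover have "insert x (D - F) \<union> B = insert x D" using eq by auto
    ultimately show "insert x (D - F) \<notin> indeps (contraction M F)" unfolding iff by simp
  qed
  then have "rank_of (contraction M F) A = card (D - F)" using C.card_basis by simp
  also have "D - F = D - B" using DF by auto
  also have "card (D - B) = card D - card B" using D finite_indep BF by (intro card_Diff_subset) auto
  finally show ?thesis using card_basis[OF D(1)] card_basis[OF B] by simp
qed

lemma rk_contraction: "F \<subseteq> ground M \<Longrightarrow> rk (contraction M F) = rk M - rank_of M F"
  unfolding rk_def by (simp add: rank_contraction) (metis Un_absorb2)

lemma flats_contraction_iff:
  assumes "F \<subseteq> ground M" "A \<subseteq> ground M - F"
  shows "A \<in> flats (contraction M F) \<longleftrightarrow> A \<union> F \<in> flats M"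
proof -
  interpret C: matroid "contraction M F" by (rule matroid_contraction[OF assms(1)])
  have "rank_of (contraction M F) (insert x A) = rank_of (contraction M F) A \<longleftrightarrow>
      rank_of M (insert x (A \<union> F)) = rank_of M (A \<union> F)" if "x \<in> ground M - F" for x
  proof -
    have "rank_of M F \<le> rank_of M (insert x (A \<union> F))" "rank_of M F \<le> rank_of M (A \<union> F)"
      by (auto intro: rank_mono)
    then show ?thesis using that assms by (simp add: rank_contraction) linarith
  qed
  then show ?thesis unfolding C.flat_iff flat_iff using assms by auto
qed

lemma flats_contraction:
  assumes "F \<subseteq> ground M"
  shows "flats (contraction M F) = (\<lambda>G. G - F) ` {G \<in> flats M. F \<subseteq> G}"
proof -
  interpret C: matroid "contraction M F" by (rule matroid_contraction[OF assms(1)])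
  show ?thesis
  proof (intro set_eqI iffI)
    fix A assume A: "A \<in> flats (contraction M F)"
    then have s: "A \<subseteq> ground M - F" using C.flat_ground by simp
    then have "A \<union> F \<in> flats M" "A = (A \<union> F) - F" using flats_contraction_iff[OF assms s] A by auto
    then show "A \<in> (\<lambda>G. G - F) ` {G \<in> flats M. F \<subseteq> G}" by blast
  next
    fix A assume "A \<in> (\<lambda>G. G - F) ` {G \<in> flats M. F \<subseteq> G}"
    then obtain G where G: "G \<in> flats M" "F \<subseteq> G" "A = G - F" by auto
    then have "A \<union> F = G" by auto
    then show "A \<in> flats (contraction M F)"
      using flats_contraction_iff[OF assms, of A] G flat_ground by auto
  qed
qed

lemma loopless_contraction: "F \<in> flats M \<Longrightarrow> loopless (contraction M F)"
proof -
  assume F: "F \<in> flats M"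
  then have Fg: "F \<subseteq> ground M" by (rule flat_ground)
  obtain B where B: "basis_of M F B" using basis_exists[OF indeps_empty] by blast
  show ?thesis unfolding loopless_def
  proof
    fix e assume "e \<in> ground (contraction M F)"
    then have e: "e \<in> ground M" "e \<notin> F" by auto
    then show "{e} \<in> indeps (contraction M F)"
      using F B insert_basis_indep_iff[OF B, of e] unfolding indep_contraction_iff[OF B Fg] flat_iff
      by (auto simp: basis_of_def)
  qed
qed

text \<open>Literal equality rather than isomorphism: the Kazhdan--Lusztig assignment is a function
  on set systems, so upper intervals can be handled inside \<open>M\<close> only in this form. A
  basis of \<open>F\<close> together with one of the second contraction is a basis of
  \<open>G\<close>.\<close>

lemma contraction_contraction:
  assumes "F \<subseteq> G" "G \<subseteq> ground M"
  shows "contraction (contraction M F) (G - F) = contraction M G"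
proof -
  have Fg: "F \<subseteq> ground M" using assms by simp
  interpret C: matroid "contraction M F" by (rule matroid_contraction[OF Fg])
  obtain B where B: "basis_of M F B" using basis_exists[OF indeps_empty] by blast
  have B': "B \<subseteq> F" "B \<in> indeps M" using B by (auto simp: basis_of_def)
  obtain D where D: "basis_of (contraction M F) (G - F) D" using C.basis_exists[OF C.indeps_empty] by blast
  then have D': "D \<subseteq> G - F" "D \<union> B \<in> indeps M"
    unfolding basis_of_def indep_contraction_iff[OF B Fg] by auto
  have "card (D \<union> B) = card D + card B"
    using D' B' finite_indep by (intro card_Un_disjoint) auto
  also have "\<dots> = rank_of M G"
  proof -
    have "G - F \<union> F = G" using assms by auto
    moreover have "G - F \<subseteq> ground M - F" using assms by auto
    ultimately show ?thesis
      using C.card_basis[OF D] card_basis[OF B] rank_contraction[OF Fg, of "G - F"]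
        rank_mono[OF assms(1)] by simp
  qed
  finally have DB: "basis_of M G (D \<union> B)" using D' B' assms by (intro basis_of_card_eq) auto
  have GF: "G - F \<subseteq> ground (contraction M F)" using assms by auto
  have "I \<in> indeps (contraction (contraction M F) (G - F)) \<longleftrightarrow> I \<in> indeps (contraction M G)" for I
  proof -
    have "I \<in> indeps (contraction (contraction M F) (G - F)) \<longleftrightarrow>
        I \<subseteq> ground M - F - (G - F) \<and> I \<union> D \<subseteq> ground M - F \<and> I \<union> D \<union> B \<in> indeps M"
      unfolding C.indep_contraction_iff[OF D GF] indep_contraction_iff[OF B Fg] by simp
    moreover have "I \<in> indeps (contraction M G) \<longleftrightarrow> I \<subseteq> ground M - G \<and> I \<union> (D \<union> B) \<in> indeps M"
      by (rule indep_contraction_iff[OF DB assms(2)])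
    ultimately show ?thesis using assms D'(1) by (auto simp: Un_assoc)
  qed
  moreover have "ground M - F - (G - F) = ground M - G" using assms by auto
  ultimately show ?thesis
    by (intro set_system.equality) (auto)
qed

lemma contraction_empty: "contraction M {} = M"
proof -
  have "basis_of M {} {}" using indeps_empty by (auto simp: basis_of_def)
  from indep_contraction_iff[OF this] have "indeps (contraction M {}) = indeps M"
    using indeps_subset by auto
  then show ?thesis by (intro set_system.equality) auto
qed

end

section \<open>Kazhdan--Lusztig polynomials from palindromicity\<close>

lemma coeff_reverse_at: "coeff (reverse_at r p) j = (if j \<le> r then coeff p (r - j) else 0)"
proof -
  have "coeff (reverse_at r p) j = (\<Sum>i\<le>r. if r - i = j then coeff p i else 0)"
    unfolding reverse_at_def by (simp add: coeff_sum)
  also have "\<dots> = (\<Sum>i\<le>r. if i = r - j then (if j \<le> r then coeff p (r - j) else 0) else 0)"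
    by (rule sum.cong) auto
  finally show ?thesis by simp
qed

lemma reverse_at_add: "reverse_at r (p + q) = reverse_at r p + reverse_at r q"
  by (rule poly_eqI) (simp add: coeff_reverse_at)

lemma reverse_at_diff: "reverse_at r (p - q) = reverse_at r p - reverse_at r q"
  by (rule poly_eqI) (simp add: coeff_reverse_at)

lemma reverse_at_0 [simp]: "reverse_at r 0 = 0"
  by (rule poly_eqI) (simp add: coeff_reverse_at)

lemma reverse_at_sum: "reverse_at r (\<Sum>x\<in>A. f x) = (\<Sum>x\<in>A. reverse_at r (f x))"
  by (induction A rule: infinite_finite_induct) (auto simp: reverse_at_add)

lemma reverse_at_monom_mult:
  assumes "k + degree p \<le> r"
  shows "reverse_at r (monom 1 k * p) = reverse_at (r - k) p"
  using assms by (intro poly_eqI) (auto simp: coeff_reverse_at coeff_monom_mult coeff_eq_0 add.commute)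

lemma reverse_at_monom: "k \<le> r \<Longrightarrow> reverse_at r (monom a k) = monom a (r - k)"
  by (intro poly_eqI) (auto simp: coeff_reverse_at)

lemma reverse_at_mult:
  assumes "degree p \<le> r" "degree q \<le> s"
  shows "reverse_at (r + s) (p * q) = reverse_at r p * reverse_at s q"
proof -
  have p: "p = (\<Sum>i\<le>r. monom (coeff p i) i)" and q: "q = (\<Sum>i\<le>s. monom (coeff q i) i)"
    using assms by (simp_all add: poly_as_sum_of_monoms')
  have "reverse_at (r + s) (p * q) = (\<Sum>i\<le>r. \<Sum>j\<le>s. reverse_at (r + s) (monom (coeff p i * coeff q j) (i + j)))"
    by (subst p, subst q) (simp add: sum_product mult_monom reverse_at_sum)
  also have "\<dots> = (\<Sum>i\<le>r. \<Sum>j\<le>s. monom (coeff p i) (r - i) * monom (coeff q j) (s - j))"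
    by (intro sum.cong refl) (auto simp: reverse_at_monom mult_monom)
  finally show ?thesis by (simp add: reverse_at_def sum_product)
qed

lemma smult_sum_right: "smult c (\<Sum>x\<in>A. f x) = (\<Sum>x\<in>A. smult c (f x))"
  by (induction A rule: infinite_finite_induct) (auto simp: smult_add_right)

text \<open>The parameter \<open>r\<close> is explicit because the degree does not determine it:
  zero is palindromic for every \<open>r\<close>, and t for \<open>r = 2\<close>.\<close>

definition palindromic :: "nat \<Rightarrow> int poly \<Rightarrow> bool" where
  "palindromic r p \<longleftrightarrow> reverse_at r p = p"

lemma palindromic_degree: "palindromic r p \<Longrightarrow> degree p \<le> r"
proof -
  assume "palindromic r p"
  then have "coeff p j = 0" if "j > r" for j
    using coeff_reverse_at[of r p j] that by (simp add: palindromic_def)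
  then show ?thesis by (simp add: degree_le)
qed

lemma palindromic_add: "palindromic r p \<Longrightarrow> palindromic r q \<Longrightarrow> palindromic r (p + q)"
  by (simp add: palindromic_def reverse_at_add)

lemma palindromic_diff: "palindromic r p \<Longrightarrow> palindromic r q \<Longrightarrow> palindromic r (p - q)"
  by (simp add: palindromic_def reverse_at_diff)

lemma palindromic_sum: "(\<And>x. x \<in> A \<Longrightarrow> palindromic r (f x)) \<Longrightarrow> palindromic r (\<Sum>x\<in>A. f x)"
  by (simp add: palindromic_def reverse_at_sum)

lemma palindromic_0 [simp]: "palindromic r 0"
  by (simp add: palindromic_def)

lemma palindromic_mult: "palindromic r p \<Longrightarrow> palindromic s q \<Longrightarrow> palindromic (r + s) (p * q)"
  using reverse_at_mult[of p r q s] palindromic_degree by (simp add: palindromic_def)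

text \<open>Of the indices \<open>i\<close> and \<open>r - i\<close> at least one exceeds the
  degree, and palindromicity copies its zero coefficient to the other. Every uniqueness argument
  below rests on this.\<close>

lemma palindromic_small_degree:
  assumes "palindromic r p" "2 * degree p < r"
  shows "p = 0"
proof (rule poly_eqI)
  fix i
  have "coeff p i = coeff (reverse_at r p) i" using assms(1) by (simp add: palindromic_def)
  also have "\<dots> = (if i \<le> r then coeff p (r - i) else 0)" by (rule coeff_reverse_at)
  finally have eq: "coeff p i = (if i \<le> r then coeff p (r - i) else 0)" .
  show "coeff p i = coeff 0 i"
  proof (cases "degree p < i")
    case True then show ?thesis by (simp add: coeff_eq_0)
  next
    case False
    then have "degree p < r - i" using assms(2) by simp
    then show ?thesis using eq by (simp add: coeff_eq_0)
  qed
qed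

text \<open>The coefficients below degree \<open>rk M / 2\<close> are the unique ones that make the \<open>Z\<close>-polynomial
  palindromic; \<open>Q\<close> is the part of it contributed by the nonempty flats.\<close>

function KL_rec :: "'a set_system \<Rightarrow> int poly" where
  "KL_rec M = (if matroid M \<and> loopless M then
     (if rk M = 0 then 1
      else (let Q = (\<Sum>F \<in> flats M - {{}}. monom 1 (rank_of M F) * KL_rec (contraction M F))
            in (\<Sum>i | 2 * i < rk M. monom (coeff Q (rk M - i) - coeff Q i) i)))
     else 0)"
  by pat_completeness auto
termination
proof (relation "measure (\<lambda>M. card (ground M))")
  fix M :: "'a set_system" and F
  assume M: "matroid M \<and> loopless M" and F: "F \<in> flats M - {{}}"
  then have "F \<subseteq> ground M" "finite (ground M)" "F \<noteq> {}"
    by (auto simp: matroid.finite_ground matroid.flat_ground)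
  then have "ground M - F \<subset> ground M" "finite (ground M)" by auto
  then show "(contraction M F, M) \<in> measure (\<lambda>M. card (ground M))"
    by (simp add: contraction_def psubset_card_mono)
qed auto

declare KL_rec.simps [simp del]

lemma KL_rec_rk_0: "matroid M \<Longrightarrow> loopless M \<Longrightarrow> rk M = 0 \<Longrightarrow> KL_rec M = 1"
  by (simp add: KL_rec.simps)

lemma finite_double_less: "finite {i::nat. 2 * i < r}"
  by (rule finite_subset[of _ "{..r}"]) auto

lemma coeff_sum_monom_double:
  "coeff (\<Sum>i | 2 * i < r. monom (f i) i) j = (if 2 * j < r then f j else (0::int))"
proof -
  have "coeff (\<Sum>i | 2 * i < r. monom (f i) i) j = (\<Sum>i | 2 * i < r. if i = j then f j else 0)"
    by (simp add: coeff_sum) (rule sum.cong, auto)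
  then show ?thesis using finite_double_less[of r] by simp
qed

lemma KL_rec_degree:
  assumes "matroid M" "loopless M" "rk M > 0" shows "2 * degree (KL_rec M) < rk M"
proof -
  let ?r = "rk M"
  obtain f where f: "KL_rec M = (\<Sum>i | 2 * i < ?r. monom (f i) i)"
    using assms by (subst (asm) KL_rec.simps) (auto simp: Let_def)
  have "degree (KL_rec M) \<le> (?r - 1) div 2"
    using assms(3) by (intro degree_le) (auto simp: f coeff_sum_monom_double)
  then show ?thesis using assms(3) by linarith
qed

lemma KL_rec_degree_le:
  assumes "matroid M" "loopless M" shows "2 * degree (KL_rec M) \<le> rk M"
  using KL_rec_degree[OF assms] KL_rec_rk_0[OF assms] by (cases "rk M = 0") auto

text \<open>The Z-polynomial built from \<open>KL_rec\<close>, so that palindromicity is available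
  before \<open>KL_rec\<close> is known to satisfy the defining recursion.\<close>

definition Z_rec :: "'a set_system \<Rightarrow> int poly" where
  "Z_rec M = (\<Sum>F \<in> flats M. monom 1 (rank_of M F) * KL_rec (contraction M F))"

context matroid begin

lemma rank_flat_le: "F \<in> flats M \<Longrightarrow> rank_of M F \<le> rk M"
  unfolding rk_def by (intro rank_mono flat_ground)

lemma Z_term_degree:
  assumes "F \<in> flats M"
  shows "rank_of M F + degree (KL_rec (contraction M F)) \<le> rk M"
  using KL_rec_degree_le[OF matroid_contraction loopless_contraction, OF flat_ground, OF assms assms]
    rank_flat_le[OF assms] by (simp add: rk_contraction[OF flat_ground[OF assms]])

lemma palindromic_Z_rec:
  assumes "loopless M" shows "palindromic (rk M) (Z_rec M)"
proof (cases "rk M = 0")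
  case True
  have "{} = F" if "F \<in> flats M" for F
    using flat_rank_less[OF empty_flat[OF assms] flat_ground[OF that]] True
      rank_flat_le[OF that] by force
  then have "flats M = {{}}" using empty_flat[OF assms] by auto
  then have "Z_rec M = 1" using KL_rec_rk_0[OF _ assms True] matroid_axioms
    by (simp add: Z_rec_def contraction_empty)
  then show ?thesis using True by (auto simp: palindromic_def intro!: poly_eqI simp: coeff_reverse_at)
next
  case False
  define r where "r = rk M"
  define Q where "Q = (\<Sum>F \<in> flats M - {{}}. monom 1 (rank_of M F) * KL_rec (contraction M F))"
  have K: "KL_rec M = (\<Sum>i | 2 * i < r. monom (coeff Q (r - i) - coeff Q i) i)"
    using False assms matroid_axioms by (subst KL_rec.simps) (simp add: Q_def r_def Let_def)
  have Z: "Z_rec M = KL_rec M + Q"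
    unfolding Z_rec_def Q_def
    by (subst sum.remove[OF finite_flats empty_flat[OF assms]]) (simp add: contraction_empty)
  have "degree Q \<le> r" unfolding Q_def
  proof (intro degree_sum_le)
    show "finite (flats M - {{}})" using finite_flats by simp
    fix F assume "F \<in> flats M - {{}}"
    then have "rank_of M F + degree (KL_rec (contraction M F)) \<le> rk M" using Z_term_degree by blast
    then show "degree (monom 1 (rank_of M F) * KL_rec (contraction M F)) \<le> r"
      using degree_mult_le[of "monom 1 (rank_of M F)" "KL_rec (contraction M F)"]
      by (simp add: r_def degree_monom_eq)
  qed
  then have Q0: "coeff Q j = 0" if "j > r" for j using that by (simp add: coeff_eq_0)
  \<comment> \<open>Below the middle, adding \<open>KL_rec M\<close> replaces the coefficient of
    \<open>Q\<close> by its mirror image; from the middle on it contributes nothing.\<close>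
  have Zj: "coeff (Z_rec M) j = (if 2 * j < r then coeff Q (r - j) else coeff Q j)" for j
    by (simp add: Z K coeff_sum_monom_double)
  have "coeff (reverse_at r (Z_rec M)) j = coeff (Z_rec M) j" for j
  proof -
    consider "j > r" | "2 * j < r" | "2 * j = r" | "2 * j > r" "j \<le> r" by linarith
    then show ?thesis
    proof cases
      case 3
      then have "r - j = j" "j \<le> r" by auto
      then show ?thesis by (simp add: coeff_reverse_at)
    qed (auto simp: coeff_reverse_at Zj Q0)
  qed
  then have "reverse_at r (Z_rec M) = Z_rec M" by (rule poly_eqI)
  then show ?thesis by (simp add: palindromic_def r_def)
qed

lemma sum_flats_contraction:
  assumes "F \<subseteq> ground M"
  shows "(\<Sum>A\<in>flats (contraction M F). f A) = (\<Sum>G | G \<in> flats M \<and> F \<subseteq> G. f (G - F))"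
  unfolding flats_contraction[OF assms]
  by (subst sum.reindex) (auto simp: inj_on_def)

lemma Z_rec_contraction:
  assumes "F \<in> flats M"
  shows "Z_rec (contraction M F) =
    (\<Sum>G | G \<in> flats M \<and> F \<subseteq> G. monom 1 (rank_of M G - rank_of M F) * KL_rec (contraction M G))"
  unfolding Z_rec_def sum_flats_contraction[OF flat_ground[OF assms]]
proof (rule sum.cong)
  fix G assume "G \<in> {G. G \<in> flats M \<and> F \<subseteq> G}"
  then have G: "G \<in> flats M" "F \<subseteq> G" by auto
  then have "G - F \<subseteq> ground M - F" "G - F \<union> F = G" using flat_ground by auto
  then show "monom 1 (rank_of (contraction M F) (G - F)) * KL_rec (contraction (contraction M F) (G - F)) =
      monom 1 (rank_of M G - rank_of M F) * KL_rec (contraction M G)"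
    using G flat_ground assms by (simp add: rank_contraction contraction_contraction)
qed simp

text \<open>Lets the Moebius function of a localization be computed in the full lattice of
  flats.\<close>

lemma moebius_cong:
  assumes "\<And>W. W \<subseteq> Y \<Longrightarrow> W \<in> L \<longleftrightarrow> W \<in> L'"
  shows "moebius L X Y = moebius L' X Y"
  using assms
proof (induction L X Y rule: moebius.induct)
  case (1 L X Y)
  have "{W \<in> L. X \<subseteq> W \<and> W \<subset> Y} = {W \<in> L'. X \<subseteq> W \<and> W \<subset> Y}" using 1(2) by blast
  moreover have "moebius L X W = moebius L' X W"
    if "\<not> X = Y" "X \<subset> Y \<and> finite Y" "W \<in> {W \<in> L. X \<subseteq> W \<and> W \<subset> Y}" for W
  proof (rule 1(1)[OF that])
    fix V assume "V \<subseteq> W"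
    then have "V \<subseteq> Y" using that(3) by auto
    then show "V \<in> L \<longleftrightarrow> V \<in> L'" by (rule 1(2))
  qed
  ultimately show ?case
    unfolding moebius.simps[of L X Y] moebius.simps[of L' X Y]
    by (auto intro!: sum.cong)
qed

lemma sum_moebius:
  assumes "loopless M" "G \<in> flats M"
  shows "(\<Sum>F | F \<in> flats M \<and> F \<subseteq> G. moebius (flats M) {} F) = (if G = {} then 1 else 0)"
proof (cases "G = {}")
  case True
  then have "{F. F \<in> flats M \<and> F \<subseteq> G} = {{}}" using assms by auto
  then show ?thesis using True by (simp add: moebius.simps)
next
  case False
  have eq: "{F. F \<in> flats M \<and> F \<subseteq> G} = insert G {W \<in> flats M. {} \<subseteq> W \<and> W \<subset> G}" using assms by auto
  have "finite {W \<in> flats M. {} \<subseteq> W \<and> W \<subset> G}" using finite_flats by simp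
  then have "(\<Sum>F | F \<in> flats M \<and> F \<subseteq> G. moebius (flats M) {} F) =
      moebius (flats M) {} G + (\<Sum>F\<in>{W \<in> flats M. {} \<subseteq> W \<and> W \<subset> G}. moebius (flats M) {} F)"
    unfolding eq by (subst sum.insert) auto
  also have "moebius (flats M) {} G = - (\<Sum>F\<in>{W \<in> flats M. {} \<subseteq> W \<and> W \<subset> G}. moebius (flats M) {} F)"
    using False finite_flat[OF assms(2)] by (subst moebius.simps) auto
  finally show ?thesis using False by simp
qed

lemma charpoly_localization:
  assumes "loopless M" "G \<in> flats M"
  shows "charpoly_matroid (localization M G) =
    (\<Sum>F | F \<in> flats M \<and> F \<subseteq> G. monom (moebius (flats M) {} F) (rank_of M G - rank_of M F))"
proof -
  have Gg: "G \<subseteq> ground M" using assms flat_ground by simp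
  interpret L: matroid "localization M G" by (rule matroid_localization[OF Gg])
  have "{} \<in> flats (localization M G)"
    using L.empty_flat loopless_localization[OF assms(1) Gg] by simp
  then have c: "closure_of (localization M G) {} = {}" by (simp add: flats_def)
  have fl: "flats (localization M G) = {F. F \<in> flats M \<and> F \<subseteq> G}"
    using flats_localization[OF assms(2)] by simp
  show ?thesis unfolding charpoly_matroid_def c fl rk_localization
  proof (rule sum.cong)
    fix F assume F: "F \<in> {F. F \<in> flats M \<and> F \<subseteq> G}"
    have "moebius {F. F \<in> flats M \<and> F \<subseteq> G} {} F = moebius (flats M) {} F"
      using F by (intro moebius_cong) auto
    then show "monom (moebius {F. F \<in> flats M \<and> F \<subseteq> G} {} F) (rank_of M G - rank_of (localization M G) F) =
         monom (moebius (flats M) {} F) (rank_of M G - rank_of M F)"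
      using F by (simp add: rank_localization)
  qed simp
qed

text \<open>Reversing the palindromic \<open>Z_rec\<close> of each contraction writes it as a sum of
  the reversed polynomials \<open>R G\<close> over the flats above. Expanding the characteristic
  polynomials turns the right-hand side into the Moebius sum of these \<open>Z_rec\<close>, and
  Moebius inversion leaves only \<open>R {}\<close>.\<close>

lemma KL_rec_recursion:
  assumes "loopless M"
  shows "reverse_at (rk M) (KL_rec M) =
    (\<Sum>F \<in> flats M. charpoly_matroid (localization M F) * KL_rec (contraction M F))"
proof -
  define R where "R G = reverse_at (rk M - rank_of M G) (KL_rec (contraction M G))" for G
  define \<mu> where "\<mu> = moebius (flats M) {}"
  have R: "Z_rec (contraction M F) = (\<Sum>G | G \<in> flats M \<and> F \<subseteq> G. R G)" if F: "F \<in> flats M" for F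
  proof -
    have Fg: "F \<subseteq> ground M" using F flat_ground by simp
    have "Z_rec (contraction M F) = reverse_at (rk M - rank_of M F) (Z_rec (contraction M F))"
      using matroid.palindromic_Z_rec[OF matroid_contraction[OF Fg] loopless_contraction[OF F]]
      by (simp add: palindromic_def rk_contraction[OF Fg])
    also have "\<dots> = (\<Sum>G | G \<in> flats M \<and> F \<subseteq> G. R G)"
      unfolding Z_rec_contraction[OF F] reverse_at_sum
    proof (rule sum.cong)
      fix G assume "G \<in> {G. G \<in> flats M \<and> F \<subseteq> G}"
      then have G: "G \<in> flats M" "F \<subseteq> G" by auto
      have "rank_of M F \<le> rank_of M G" using G rank_mono by blast
      then show "reverse_at (rk M - rank_of M F) (monom 1 (rank_of M G - rank_of M F) * KL_rec (contraction M G)) = R G"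
        using Z_term_degree[OF G(1)] by (subst reverse_at_monom_mult) (auto simp: R_def)
    qed simp
    finally show ?thesis .
  qed
  have swap: "(\<Sum>G\<in>flats M. \<Sum>F | F \<in> flats M \<and> F \<subseteq> G. h F G) = (\<Sum>F\<in>flats M. \<Sum>G | G \<in> flats M \<and> F \<subseteq> G. h F G)"
    for h :: "'a set \<Rightarrow> 'a set \<Rightarrow> int poly"
    using sum.swap_restrict[OF finite_flats finite_flats, of "\<lambda>G F. h F G" "\<lambda>G F. F \<subseteq> G"] by simp
  have "(\<Sum>G \<in> flats M. charpoly_matroid (localization M G) * KL_rec (contraction M G)) =
      (\<Sum>G\<in>flats M. \<Sum>F | F \<in> flats M \<and> F \<subseteq> G. monom (\<mu> F) (rank_of M G - rank_of M F) * KL_rec (contraction M G))"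
    by (rule sum.cong) (simp_all add: charpoly_localization[OF assms] sum_distrib_right \<mu>_def)
  also have "\<dots> = (\<Sum>F\<in>flats M. \<Sum>G | G \<in> flats M \<and> F \<subseteq> G. monom (\<mu> F) (rank_of M G - rank_of M F) * KL_rec (contraction M G))"
    by (rule swap)
  also have "\<dots> = (\<Sum>F\<in>flats M. smult (\<mu> F) (Z_rec (contraction M F)))"
    by (intro sum.cong refl) (simp add: Z_rec_contraction smult_sum_right smult_monom flip: mult_smult_left)
  also have "\<dots> = (\<Sum>F\<in>flats M. \<Sum>G | G \<in> flats M \<and> F \<subseteq> G. smult (\<mu> F) (R G))"
    by (intro sum.cong refl) (simp add: R smult_sum_right)
  also have "\<dots> = (\<Sum>G\<in>flats M. \<Sum>F | F \<in> flats M \<and> F \<subseteq> G. smult (\<mu> F) (R G))"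
    by (rule swap[symmetric])
  also have "\<dots> = (\<Sum>G\<in>flats M. smult (if G = {} then 1 else 0) (R G))"
    using sum_moebius[OF assms] by (intro sum.cong refl) (simp add: \<mu>_def flip: smult_sum)
  also have "\<dots> = (\<Sum>G\<in>flats M. if G = {} then R {} else 0)"
    by (intro sum.cong) auto
  also have "\<dots> = R {}" using empty_flat[OF assms] finite_flats by simp
  finally show ?thesis by (simp add: R_def contraction_empty)
qed

end

section \<open>Existence and uniqueness of the assignment\<close>

lemma KL_assignment_KL_rec: "KL_assignment KL_rec"
  unfolding KL_assignment_def
  by (auto simp: KL_rec_rk_0 KL_rec_degree matroid.KL_rec_recursion) (auto simp: KL_rec.simps)

text \<open>The empty flat contributes the unknown polynomial itself, with factor 1, and all other
  terms agree by induction on the ground set. Hence the difference of two candidates is palindromic,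
  but of too small a degree.\<close>

lemma KL_assignment_unique:
  assumes P: "KL_assignment P" and P': "KL_assignment P'"
  shows "P = P'"
proof
  fix M show "P M = P' M"
  proof (induction "card (ground M)" arbitrary: M rule: less_induct)
    case less
    show ?case
    proof (cases "matroid M \<and> loopless M \<and> rk M > 0")
      case False
      then show ?thesis using P P' unfolding KL_assignment_def by (metis gr0I)
    next
      case True
      then have M: "matroid M" "loopless M" "rk M > 0" by auto
      interpret matroid M by (rule M(1))
      define r where "r = rk M"
      define s where "s P = (\<Sum>F \<in> flats M - {{}}. charpoly_matroid (localization M F) * P (contraction M F))" for P
      define c where "c = charpoly_matroid (localization M {})"
      have s: "s P = s P'" unfolding s_def
      proof (intro sum.cong refl arg_cong2[of _ _ _ _ times])
        fix F assume "F \<in> flats M - {{}}"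
        then have "ground M - F \<subset> ground M" using flat_ground by auto
        then have "card (ground (contraction M F)) < card (ground M)"
          by (simp add: psubset_card_mono finite_ground)
        then show "P (contraction M F) = P' (contraction M F)" by (rule less)
      qed
      have rec: "2 * degree P < r \<and> reverse_at r P = c * P + s PP"
        if "KL_assignment PP" "P = PP M" for P PP
        using that M unfolding KL_assignment_def r_def s_def c_def
        using sum.remove[OF finite_flats empty_flat[OF M(2)], of "\<lambda>F. charpoly_matroid (localization M F) * PP (contraction M F)"]
        by (simp add: contraction_empty)
      have c1: "c = 1" unfolding c_def charpoly_localization[OF M(2) empty_flat[OF M(2)]]
      proof -
        have "{F. F \<in> flats M \<and> F \<subseteq> {}} = {{}}" using empty_flat[OF M(2)] by auto
        then show "(\<Sum>F | F \<in> flats M \<and> F \<subseteq> {}. monom (moebius (flats M) {} F) (rank_of M {} - rank_of M F)) = 1"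
          by (simp add: moebius.simps)
      qed
      have d: "2 * degree (P M) < r" "2 * degree (P' M) < r" and
        "reverse_at r (P M) = P M + s P" "reverse_at r (P' M) = P' M + s P'"
        using rec[OF P refl] rec[OF P' refl] c1 by auto
      then have "palindromic r (P M - P' M)"
        using s by (simp add: palindromic_def reverse_at_diff)
      moreover have "2 * degree (P M - P' M) < r"
        using d degree_diff_le_max[of "P M" "P' M"] by simp
      ultimately show ?thesis using palindromic_small_degree by fastforce
    qed
  qed
qed

lemma KL_poly_eq: "KL_poly = KL_rec"
  unfolding KL_poly_def using KL_assignment_KL_rec KL_assignment_unique by blast

text \<open>With this, Kazhdan--Lusztig polynomials can be guessed on an encoding of the flats; no contraction
  has to be identified up to isomorphism or simplification.\<close>

lemma (in matroid) Z_poly_characterization: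
  assumes ll: "loopless M" and bij: "bij_betw \<Phi> I (flats M)"
    and one: "\<And>x. x \<in> I \<Longrightarrow> rank_of M (\<Phi> x) = rk M \<Longrightarrow> f x = 1"
    and deg: "\<And>x. x \<in> I \<Longrightarrow> rank_of M (\<Phi> x) < rk M \<Longrightarrow> 2 * degree (f x) < rk M - rank_of M (\<Phi> x)"
    and pal: "\<And>x. x \<in> I \<Longrightarrow> palindromic (rk M - rank_of M (\<Phi> x))
      (\<Sum>y | y \<in> I \<and> \<Phi> x \<subseteq> \<Phi> y. monom 1 (rank_of M (\<Phi> y) - rank_of M (\<Phi> x)) * f y)"
  shows "Z_poly M = (\<Sum>y\<in>I. monom 1 (rank_of M (\<Phi> y)) * f y)"
proof -
  have fl: "\<Phi> x \<in> flats M" if "x \<in> I" for x using bij that by (auto simp: bij_betw_def)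
  have fin: "finite I" using bij finite_flats by (simp add: bij_betw_finite)
  have reindex: "(\<Sum>G | G \<in> flats M \<and> F \<subseteq> G. h G) = (\<Sum>y | y \<in> I \<and> F \<subseteq> \<Phi> y. h (\<Phi> y))"
    for h :: "_ \<Rightarrow> int poly" and F
  proof (rule sum.reindex_bij_betw[symmetric], rule bij_betw_subset[OF bij])
    show "\<Phi> ` {y \<in> I. F \<subseteq> \<Phi> y} = {G \<in> flats M. F \<subseteq> G}"
      unfolding bij_betw_imp_surj_on[OF bij, symmetric] by auto
  qed auto
  have main: "KL_rec (contraction M (\<Phi> x)) = f x" if "x \<in> I" for x
    using that
  \<comment> \<open>Descends from the largest flats, so that the values strictly above
    \<open>x\<close> are already known.\<close>
  proof (induction "card (ground M) - card (\<Phi> x)" arbitrary: x rule: less_induct)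
    case less
    let ?F = "\<Phi> x"
    have F: "?F \<in> flats M" "?F \<subseteq> ground M" using fl less flat_ground by auto
    note mc = matroid_contraction[OF F(2)] loopless_contraction[OF F(1)]
    show ?case
    proof (cases "rank_of M ?F < rk M")
      case False
      then have e: "rank_of M ?F = rk M" using rank_flat_le[OF F(1)] by simp
      then show ?thesis using one[OF less.prems] KL_rec_rk_0[OF mc] by (simp add: rk_contraction[OF F(2)])
    next
      case True
      let ?r = "rk M - rank_of M ?F"
      have set: "{y. y \<in> I \<and> ?F \<subseteq> \<Phi> y} = insert x {y. y \<in> I \<and> ?F \<subset> \<Phi> y}"
        using less.prems bij by (auto simp: bij_betw_def inj_on_def)
      have fin': "finite {y. y \<in> I \<and> ?F \<subset> \<Phi> y}" using fin by simp
      have IH: "KL_rec (contraction M (\<Phi> y)) = f y" if "y \<in> I" "?F \<subset> \<Phi> y" for y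
      proof (rule less.hyps)
        show "y \<in> I" by fact
        have "card ?F < card (\<Phi> y)" using that fl finite_flat psubset_card_mono by blast
        moreover have "card (\<Phi> y) \<le> card (ground M)"
          using fl[OF that(1)] flat_ground finite_ground card_mono by blast
        ultimately show "card (ground M) - card (\<Phi> y) < card (ground M) - card ?F" by simp
      qed
      have split: "(\<Sum>y | y \<in> I \<and> ?F \<subseteq> \<Phi> y. monom 1 (rank_of M (\<Phi> y) - rank_of M ?F) * h y) =
          h x + (\<Sum>y | y \<in> I \<and> ?F \<subset> \<Phi> y. monom 1 (rank_of M (\<Phi> y) - rank_of M ?F) * h y)" for h :: "_ \<Rightarrow> int poly"
        unfolding set using fin' by (subst sum.insert) auto
      \<comment> \<open>Both upper sums are palindromic and, by induction, agree except in the
        bottom term; so the difference of the bottom terms is palindromic and too small in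
        degree.\<close>
      have "palindromic ?r (Z_rec (contraction M ?F))"
        using matroid.palindromic_Z_rec[OF mc] by (simp add: rk_contraction[OF F(2)])
      then have "palindromic ?r ((KL_rec (contraction M ?F) +
          (\<Sum>y | y \<in> I \<and> ?F \<subset> \<Phi> y. monom 1 (rank_of M (\<Phi> y) - rank_of M ?F) * KL_rec (contraction M (\<Phi> y)))) -
        (f x + (\<Sum>y | y \<in> I \<and> ?F \<subset> \<Phi> y. monom 1 (rank_of M (\<Phi> y) - rank_of M ?F) * f y)))"
        using pal[OF less.prems] unfolding Z_rec_contraction[OF F(1)] reindex split
        by (rule palindromic_diff)
      also have "(\<Sum>y | y \<in> I \<and> ?F \<subset> \<Phi> y. monom 1 (rank_of M (\<Phi> y) - rank_of M ?F) * KL_rec (contraction M (\<Phi> y))) =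
          (\<Sum>y | y \<in> I \<and> ?F \<subset> \<Phi> y. monom 1 (rank_of M (\<Phi> y) - rank_of M ?F) * f y)"
        by (rule sum.cong) (auto simp: IH)
      finally have "palindromic ?r (KL_rec (contraction M ?F) - f x)" by simp
      moreover have "2 * degree (KL_rec (contraction M ?F) - f x) < ?r"
        using deg[OF less.prems True] KL_rec_degree[OF mc] True
          degree_diff_le_max[of "KL_rec (contraction M ?F)" "f x"] by (simp add: rk_contraction[OF F(2)])
      ultimately show ?thesis using palindromic_small_degree by fastforce
    qed
  qed
  have "Z_poly M = (\<Sum>G | G \<in> flats M \<and> {} \<subseteq> G. monom 1 (rank_of M G) * KL_rec (contraction M G))"
    unfolding Z_poly_def KL_poly_eq rk_localization by simp
  also have "\<dots> = (\<Sum>y\<in>I. monom 1 (rank_of M (\<Phi> y)) * f y)"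
    unfolding reindex by (rule sum.cong) (auto simp: main)
  finally show ?thesis .
qed

section \<open>The matroids of wheels and whirls\<close>

lemma add_mod_inj:
  fixes a i j n :: nat
  assumes "(a + i) mod n = (a + j) mod n" "i < n" "j < n"
  shows "i = j"
  using assms
proof (induction i j rule: linorder_wlog)
  case (le i j)
  then have "n dvd (a + j) - (a + i)" using mod_eq_dvd_iff_nat[of "a + i" "a + j" n] by simp
  then have "n dvd j - i" by simp
  then show ?case using le by (metis diff_is_0_eq diff_le_self le_antisym le_less_trans nat_dvd_not_less not_gr0)
qed simp

lemma add_mod_surj:
  fixes a k n :: nat
  assumes "n > 0"
  obtains j where "j < n" "(a + j) mod n = k mod n"
proof (rule that)
  have "(a + (k + (n - a mod n)) mod n) mod n = (a + (k + (n - a mod n))) mod n"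
    by (simp add: mod_add_right_eq)
  also have "a + (k + (n - a mod n)) = k + n * Suc (a div n)"
    using mult_div_mod_eq[of n a] mod_less_divisor[OF assms, of a] by (simp only: mult_Suc_right)
  finally show "(a + (k + (n - a mod n)) mod n) mod n = k mod n" by (simp only: mod_mult_self2)
qed (use assms in simp)

text \<open>Spokes and rim edges are indexed by all natural numbers, periodically modulo \<open>n\<close>.\<close>

definition spoke :: "nat \<Rightarrow> nat \<Rightarrow> nat set" where
  "spoke n i = {0, Suc (i mod n)}"

definition rimedge :: "nat \<Rightarrow> nat \<Rightarrow> nat set" where
  "rimedge n i = {Suc (i mod n), Suc (Suc i mod n)}"

text \<open>Arcs are the circuits of the whirl; the one with \<open>l = n\<close> is a spoke together with the whole
  rim.\<close>

definition has_arc :: "nat \<Rightarrow> nat set set \<Rightarrow> bool" where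
  "has_arc n X \<longleftrightarrow> (\<exists>a l. 1 \<le> l \<and> l \<le> n \<and> spoke n a \<in> X \<and> spoke n (a + l) \<in> X
     \<and> (\<forall>j<l. rimedge n (a + j) \<in> X))"

lemma has_arc_mono: "has_arc n X \<Longrightarrow> X \<subseteq> Y \<Longrightarrow> has_arc n Y"
  unfolding has_arc_def by blast

lemma spoke_eq_iff [simp]: "spoke n i = spoke n j \<longleftrightarrow> i mod n = j mod n"
  by (auto simp: spoke_def doubleton_eq_iff)

lemma spoke_neq_rimedge [simp]: "spoke n i \<noteq> rimedge n j" "rimedge n j \<noteq> spoke n i"
  by (auto simp: spoke_def rimedge_def doubleton_eq_iff)

lemma Suc_in_spoke: "Suc k \<in> spoke n i \<longleftrightarrow> k = i mod n"
  by (auto simp: spoke_def)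

lemma Suc_in_rimedge: "Suc k \<in> rimedge n i \<longleftrightarrow> k = i mod n \<or> k = Suc i mod n"
  by (auto simp: rimedge_def)

lemma Suc_mod_neq: "n \<ge> 2 \<Longrightarrow> Suc i mod n \<noteq> i mod n"
  by (simp add: mod_Suc)

lemma Suc_mod_eq_iff: "n \<ge> 1 \<Longrightarrow> Suc i mod n = Suc j mod n \<longleftrightarrow> i mod n = j mod n"
proof -
  assume n: "n \<ge> 1"
  then have "i mod n < n" "j mod n < n" by auto
  then show ?thesis by (auto simp: mod_Suc)
qed

locale wheel =
  fixes n :: nat
  assumes n3: "n \<ge> 3"
begin

abbreviation "sp \<equiv> spoke n"
abbreviation "rm \<equiv> rimedge n"
abbreviation "E \<equiv> edges (wheel_graph n)"

text \<open>Three rim vertices matter here: with two, both rim edges would be the same set.\<close>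

lemma rm_eq_iff [simp]: "rm i = rm j \<longleftrightarrow> i mod n = j mod n"
proof -
  have "i mod n < n" "j mod n < n" using n3 by auto
  then show ?thesis using n3
    unfolding rimedge_def doubleton_eq_iff by (auto simp: mod_Suc split: if_splits)
qed

lemma rm_mod [simp]: "rm (i mod n) = rm i"
  by (simp add: rimedge_def mod_Suc_eq)

lemma sp_mod [simp]: "sp (i mod n) = sp i"
  by (simp add: spoke_def)

lemma rim_eq: "rim n = range rm"
proof -
  have "rim n = rm ` {..<n}"
  proof (intro set_eqI iffI)
    fix x assume "x \<in> rim n"
    then consider i where "x = {i, i + 1}" "1 \<le> i" "i < n" | "x = {n, 1}"
      unfolding rim_def by auto
    then show "x \<in> rm ` {..<n}"
    proof cases
      case 1
      then have "x = rm (i - 1)" by (simp add: rimedge_def)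
      then show ?thesis using 1 by auto
    next
      case 2
      then have "x = rm (n - 1)" using n3 by (simp add: rimedge_def)
      then show ?thesis using n3 by auto
    qed
  next
    fix x assume "x \<in> rm ` {..<n}"
    then obtain i where i: "i < n" "x = rm i" by auto
    show "x \<in> rim n"
    proof (cases "Suc i = n")
      case True
      then have "x = {n, 1}" using i by (simp add: rimedge_def)
      then show ?thesis by (simp add: rim_def)
    next
      case False
      then have "x = {Suc i, Suc i + 1}" "Suc i < n" using i by (auto simp: rimedge_def)
      then show ?thesis unfolding rim_def by auto
    qed
  qed
  also have "\<dots> = range rm"
  proof -
    have "rm i \<in> rm ` {..<n}" for i using n3 by (intro image_eqI[of _ _ "i mod n"]) auto
    then show ?thesis by auto
  qed
  finally show ?thesis .
qed

lemma E_eq: "E = range sp \<union> range rm"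
proof -
  have "{{0, i} | i. 1 \<le> i \<and> i \<le> n} = range sp"
  proof (intro set_eqI iffI)
    fix x assume "x \<in> {{0, i} | i. 1 \<le> i \<and> i \<le> n}"
    then obtain i where "x = {0, i}" "1 \<le> i" "i \<le> n" by auto
    then have "x = sp (i - 1)" by (simp add: spoke_def)
    then show "x \<in> range sp" by auto
  next
    fix x assume "x \<in> range sp"
    then obtain i where "x = sp i" by auto
    moreover have "Suc (i mod n) \<le> n" using n3 by (simp add: Suc_leI)
    ultimately show "x \<in> {{0, i} | i. 1 \<le> i \<and> i \<le> n}" by (auto simp: spoke_def)
  qed
  then show ?thesis by (auto simp: wheel_graph_def rim_eq)
qed

lemma E_cases:
  assumes "x \<in> E"
  obtains i where "i < n" "x = sp i" | i where "i < n" "x = rm i"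
proof -
  have "i mod n < n" for i using n3 by simp
  then show ?thesis using assms that unfolding E_eq by (metis UnE imageE sp_mod rm_mod)
qed

lemma sp_E [simp]: "sp i \<in> E" and rm_E [simp]: "rm i \<in> E"
  by (auto simp: E_eq)

lemma finite_E: "finite E"
proof -
  have "E \<subseteq> sp ` {..<n} \<union> rm ` {..<n}" using E_cases by blast
  then show ?thesis by (rule finite_subset) auto
qed

lemma rim_subsetI:
  assumes "\<And>j. j < n \<Longrightarrow> rm (a + j) \<in> X" shows "rim n \<subseteq> X"
proof -
  have "rm k \<in> X" for k
  proof -
    obtain j where "j < n" "(a + j) mod n = k mod n" using add_mod_surj[of n a k] n3 by auto
    then show ?thesis using assms by (metis rm_eq_iff)
  qed
  then show ?thesis by (auto simp: rim_eq)
qed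

text \<open>If every rim vertex met by \<open>X\<close> had two edges of \<open>X\<close>, one could
  walk along the rim: from a spoke up to the next spoke, which gives an arc, or all the way around.
  The vertex with a single edge serves twice, to exclude cycles and to peel off vectors one at a
  time.\<close>

lemma leaf_exists:
  assumes X: "X \<subseteq> E" "X \<noteq> {}" "\<not> has_arc n X" "\<not> rim n \<subseteq> X"
  shows "\<exists>x \<in> X. \<exists>i. Suc (i mod n) \<in> x \<and> (\<forall>y \<in> X. Suc (i mod n) \<in> y \<longrightarrow> y = x)"
proof (rule ccontr)
  assume no: "\<not> ?thesis"
  then have two: "\<exists>y \<in> X. y \<noteq> x \<and> Suc (i mod n) \<in> y" if "x \<in> X" "Suc (i mod n) \<in> x" for i x
    using that no by metis
  have other: "sp (Suc i) \<in> X \<and> x \<noteq> sp (Suc i) \<or> rm (Suc i) \<in> X \<and> x \<noteq> rm (Suc i) \<or> rm i \<in> X \<and> x \<noteq> rm i"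
    if x: "x \<in> X" "Suc (Suc i mod n) \<in> x" for x i
  proof -
    obtain y where y: "y \<in> X" "y \<noteq> x" "Suc (Suc i mod n) \<in> y" using two x by blast
    have "y \<in> E" using y X by auto
    then show ?thesis
    proof (cases rule: E_cases)
      case (1 j)
      then have "y = sp (Suc i)" using y by (simp add: Suc_in_spoke)
      then show ?thesis using y by auto
    next
      case (2 j)
      then have "Suc i mod n = j mod n \<or> i mod n = j mod n" 
        using y n3 by (auto simp: Suc_in_rimedge Suc_mod_eq_iff)
      then have "y = rm (Suc i) \<or> y = rm i" using 2 by auto
      then show ?thesis using y by auto
    qed
  qed
  have right: "sp (Suc i) \<in> X \<or> rm (Suc i) \<in> X" if "rm i \<in> X" for i
    using other[of "rm i" i] that by (auto simp: Suc_in_rimedge)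
  have left: "sp (Suc i) \<in> X \<or> rm i \<in> X" if "rm (Suc i) \<in> X" for i
    using other[of "rm (Suc i)" i] that by (auto simp: Suc_in_rimedge)
  have spk: "rm (Suc i) \<in> X \<or> rm i \<in> X" if "sp (Suc i) \<in> X" for i
    using other[of "sp (Suc i)" i] that by (auto simp: Suc_in_spoke)
  show False
  proof (cases "\<exists>i. sp i \<in> X")
    case False
    then obtain i where "rm i \<in> X" using X(1,2) unfolding E_eq by blast
    then have "rm (i + j) \<in> X" for j by (induction j) (use right False in auto)
    then show False using rim_subsetI X(4) by blast
  next
    case True
    then obtain k where "sp k \<in> X" by blast
    \<comment> \<open>A full turn is added to make the index a successor, so that the rim edge
      before it can be named.\<close>
    then have "sp (Suc (k + n - 1)) \<in> X" using n3 by (metis Suc_diff_1 add_gr_0 mod_add_self2 not_gr0 not_numeral_le_zero sp_mod)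
    then obtain i where i: "sp (Suc i) \<in> X" by blast
    show False
    proof (cases "rm (Suc i) \<in> X")
      case True
      have "l \<le> n \<Longrightarrow> \<forall>j<l. rm (Suc i + j) \<in> X" for l
      proof (induction l)
        case (Suc l)
        then have IH: "\<forall>j<l. rm (Suc i + j) \<in> X" by simp
        have "rm (Suc i + l) \<in> X"
        proof (cases l)
          case (Suc l')
          then have "sp (Suc (Suc i + l')) \<in> X \<or> rm (Suc (Suc i + l')) \<in> X" using IH right by blast
          moreover have "\<not> sp (Suc i + l) \<in> X"
          proof
            assume "sp (Suc i + l) \<in> X"
            then have "has_arc n X" unfolding has_arc_def
              using i IH \<open>Suc l \<le> n\<close> Suc by (intro exI[of _ "Suc i"] exI[of _ l]) auto
            then show False using X(3) by simp
          qed
          ultimately show ?thesis using Suc by simp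
        qed (use True in simp)
        then show ?case using IH by (auto simp: less_Suc_eq)
      qed simp
      then show False using rim_subsetI X(4) by blast
    next
      case False
      \<comment> \<open>The added \<open>n\<close> leaves room for \<open>n\<close> steps backwards
        in natural-number subtraction.\<close>
      define b where "b = i + n"
      have b: "rm b \<in> X" "sp (Suc b) \<in> X" 
      proof -
        have "rm b = rm i" by (simp add: b_def)
        then show "rm b \<in> X" using spk[OF i] False by metis
        have "Suc i + n = Suc b" by (simp add: b_def)
        then have "sp (Suc b) = sp (Suc i)" by (metis mod_add_self2 spoke_eq_iff)
        then show "sp (Suc b) \<in> X" using i by metis
      qed
      have "l \<le> n \<Longrightarrow> \<forall>j<l. rm (b - j) \<in> X" for l
      proof (induction l)
        case (Suc l)
        then have IH: "\<forall>j<l. rm (b - j) \<in> X" by simp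
        have "rm (b - l) \<in> X"
        proof (cases l)
          case (Suc l')
          have lb: "l \<le> b" using \<open>Suc l \<le> n\<close> by (simp add: b_def)
          then have e: "b - l' = Suc (b - l)" using Suc by simp
          have "rm (Suc (b - l)) \<in> X" using IH Suc e by (metis lessI)
          then have "sp (Suc (b - l)) \<in> X \<or> rm (b - l) \<in> X" by (rule left)
          moreover have "sp (Suc (b - l)) \<notin> X"
          proof
            assume s: "sp (Suc (b - l)) \<in> X"
            have "rm (Suc (b - l) + j) \<in> X" if "j < l" for j
            proof -
              have "Suc (b - l) + j = b - (l - 1 - j)" using that lb by simp
              moreover have "l - 1 - j < l" using that by simp
              then have "rm (b - (l - 1 - j)) \<in> X" using IH by blast
              ultimately show ?thesis by metis
            qed
            moreover have "Suc (b - l) + l = Suc b" using lb by simp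
            ultimately have "has_arc n X" unfolding has_arc_def
              using s b \<open>Suc l \<le> n\<close> Suc by (intro exI[of _ "Suc (b - l)"] exI[of _ l]) auto
            then show False using X(3) by simp
          qed
          ultimately show ?thesis by simp
        qed (use b in simp)
        then show ?case using IH by (auto simp: less_Suc_eq)
      qed simp
      from this[OF order_refl] have A: "\<forall>j<n. rm (b - j) \<in> X" .
      have "rm (Suc i + j) \<in> X" if "j < n" for j
      proof -
        have "Suc i + j = b - (n - 1 - j)" using that by (simp add: b_def)
        moreover have "n - 1 - j < n" using that by simp
        then have "rm (b - (n - 1 - j)) \<in> X" using A by blast
        ultimately show ?thesis by metis
      qed
      then show False using rim_subsetI X(4) by blast
    qed
  qed
qed

text \<open>Every vertex of a cycle lies on two of its edges, which contradicts
  \<open>leaf_exists\<close> for the edge set of the cycle alone.\<close>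

lemma forestI:
  assumes "X \<subseteq> E" "\<not> has_arc n X" "\<not> rim n \<subseteq> X"
  shows "forest X"
  unfolding forest_def
proof
  assume "\<exists>vs. is_cycle X vs"
  then obtain vs where vs: "length vs \<ge> 3" "distinct vs"
    "\<forall>i < length vs. {vs ! i, vs ! (Suc i mod length vs)} \<in> X" by (auto simp: is_cycle_def)
  define L where "L = length vs"
  define e where "e i = {vs ! i, vs ! (Suc i mod L)}" for i
  define Y where "Y = e ` {..<L}"
  have L3: "L \<ge> 3" using vs by (simp add: L_def)
  have YX: "Y \<subseteq> X" using vs by (auto simp: Y_def e_def L_def)
  have "Y \<subseteq> E" "\<not> has_arc n Y" "\<not> rim n \<subseteq> Y" using YX assms has_arc_mono by auto
  moreover have "Y \<noteq> {}" using L3 by (auto simp: Y_def lessThan_empty_iff)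
  ultimately have "\<exists>x \<in> Y. \<exists>i. Suc (i mod n) \<in> x \<and> (\<forall>y \<in> Y. Suc (i mod n) \<in> y \<longrightarrow> y = x)"
    by (intro leaf_exists)
  then obtain x i where x: "x \<in> Y" "Suc (i mod n) \<in> x" "\<forall>y \<in> Y. Suc (i mod n) \<in> y \<longrightarrow> y = x"
    by blast
  obtain m where m: "m < L" "vs ! m = Suc (i mod n)"
  proof -
    obtain k where k: "k < L" "x = e k" using x(1) by (auto simp: Y_def)
    then have "Suc k mod L < L" using L3 by simp
    have "Suc (i mod n) = vs ! k \<or> Suc (i mod n) = vs ! (Suc k mod L)"
      using x(2) k by (simp add: e_def)
    then show ?thesis using that[of k] that[of "Suc k mod L"] k \<open>Suc k mod L < L\<close> by metis
  qed
  \<comment> \<open>The position before \<open>m\<close>: \<open>e m'\<close> and \<open>e m\<close>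
    are the two cycle edges at the leaf, and they differ because the length is at least 3.\<close>
  define m' where "m' = (if m = 0 then L - 1 else m - 1)"
  have m': "m' < L" "Suc m' mod L = m" using m L3 by (auto simp: m'_def)
  have "e m = e m'" 
  proof -
    have "e m \<in> Y" "e m' \<in> Y" using m m' by (auto simp: Y_def)
    moreover have "Suc (i mod n) \<in> e m" "Suc (i mod n) \<in> e m'" using m m' by (auto simp: e_def)
    ultimately show ?thesis using x(3) by metis
  qed
  then have "vs ! (Suc m mod L) = vs ! m' \<or> vs ! m = vs ! m'"
    unfolding e_def m' doubleton_eq_iff by auto
  moreover have "Suc m mod L < L" using L3 by simp
  ultimately have "Suc m mod L = m' \<or> m = m'"
    using nth_eq_iff_index_eq[OF vs(2)] m(1) m'(1) unfolding L_def by metis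
  then show False using m L3 by (auto simp: m'_def mod_Suc split: if_splits)
qed

lemma not_forest_rim: "rim n \<subseteq> X \<Longrightarrow> \<not> forest X"
proof -
  assume r: "rim n \<subseteq> X"
  have "{map Suc [0..<n] ! i, map Suc [0..<n] ! (Suc i mod n)} \<in> X" if "i < n" for i
  proof -
    have "{map Suc [0..<n] ! i, map Suc [0..<n] ! (Suc i mod n)} = rm i"
      using that by (simp add: rimedge_def)
    moreover have "rm i \<in> X" using r unfolding rim_eq by blast
    ultimately show ?thesis by metis
  qed
  then have "is_cycle X (map Suc [0..<n])"
    using n3 unfolding is_cycle_def by (simp add: distinct_map)
  then show ?thesis by (auto simp: forest_def)
qed

text \<open>The hub closes the arc to a cycle, except for \<open>l = n\<close>: then the two spokes
  coincide, but the rim itself is a cycle.\<close>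

lemma not_forest_arc:
  assumes "has_arc n X" shows "\<not> forest X"
proof -
  from assms obtain a l where al: "1 \<le> l" "l \<le> n" "sp a \<in> X" "sp (a + l) \<in> X"
     "\<forall>j<l. rm (a + j) \<in> X" by (auto simp: has_arc_def)
  show ?thesis
  proof (cases "l = n")
    case True
    then have "rim n \<subseteq> X" using al(5) by (intro rim_subsetI[of a]) blast
    then show ?thesis by (rule not_forest_rim)
  next
    case False
    define f where "f j = Suc ((a + j) mod n)" for j
    define vs where "vs = 0 # map f [0..<Suc l]"
    have len: "length vs = l + 2" by (simp add: vs_def)
    have "inj_on f {0..<Suc l}"
    proof (rule inj_onI)
      fix x y assume "x \<in> {0..<Suc l}" "y \<in> {0..<Suc l}" "f x = f y"
      then show "x = y" using al(2) False by (intro add_mod_inj[of a x n y]) (simp_all add: f_def)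
    qed
    then have "distinct vs" by (auto simp: vs_def distinct_map f_def simp del: upt_Suc)
    moreover have "{vs ! i, vs ! (Suc i mod length vs)} \<in> X" if "i < length vs" for i
    proof -
      have "i = 0 \<or> (\<exists>j. i = Suc j \<and> j < l) \<or> i = Suc l" using that len
        by (cases i) auto
      then consider "i = 0" | (2) j where "i = Suc j" "j < l" | "i = Suc l" by blast
      then show ?thesis
      proof cases
        case 1
        then have "{vs ! i, vs ! (Suc i mod length vs)} = sp a"
          using len by (simp add: vs_def f_def spoke_def nth_append del: upt_Suc)
        then show ?thesis using al by simp
      next
        case 2
        then have "{vs ! i, vs ! (Suc i mod length vs)} = rm (a + j)"
          using len by (simp add: vs_def f_def rimedge_def nth_append del: upt_Suc)
        then show ?thesis using al 2 by simp
      next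
        case 3
        then have "{vs ! i, vs ! (Suc i mod length vs)} = sp (a + l)"
          using len by (simp add: vs_def f_def spoke_def nth_append insert_commute del: upt_Suc)
        then show ?thesis using al by simp
      qed
    qed
    ultimately have "is_cycle X vs" using al len by (auto simp: is_cycle_def)
    then show ?thesis by (auto simp: forest_def)
  qed
qed

lemma forest_iff: "X \<subseteq> E \<Longrightarrow> forest X \<longleftrightarrow> \<not> has_arc n X \<and> \<not> rim n \<subseteq> X"
  using forestI not_forest_rim not_forest_arc by blast

text \<open>\<open>True\<close> stands for the whirl and \<open>False\<close> for the wheel.\<close>

definition indep :: "bool \<Rightarrow> nat set set \<Rightarrow> bool" where
  "indep g X \<longleftrightarrow> X \<subseteq> E \<and> \<not> has_arc n X \<and> (\<not> g \<longrightarrow> \<not> rim n \<subseteq> X)"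

definition W :: "bool \<Rightarrow> nat set set_system" where
  "W g = \<lparr>ground = E, indeps = {X. indep g X}\<rparr>"

lemma ground_W [simp]: "ground (W g) = E" and indeps_W [simp]: "X \<in> indeps (W g) \<longleftrightarrow> indep g X"
  by (auto simp: W_def)

lemma graphic_wheel: "graphic_matroid (wheel_graph n) = W False"
proof -
  have "{X. X \<subseteq> E \<and> forest X} = {X. indep False X}"
    using forest_iff by (intro Collect_cong) (auto simp only: indep_def simp_thms)
  then show ?thesis by (simp add: graphic_matroid_def W_def)
qed

lemma rim_E: "rim n \<subseteq> E" by (auto simp: rim_eq)

lemma no_arc_rim: "\<not> has_arc n (rim n)"
  by (auto simp: has_arc_def rim_eq)

text \<open>Any spoke together with the whole rim is an arc of length \<open>n\<close>. Hence
  avoiding arcs alone adds exactly the rim to the independent sets of the wheel.\<close>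

lemma rim_subset_no_arc:
  assumes "X \<subseteq> E" "\<not> has_arc n X" "rim n \<subseteq> X" shows "X = rim n"
proof (rule ccontr)
  assume "X \<noteq> rim n"
  then obtain i where "sp i \<in> X" using assms(1,3) unfolding E_eq rim_eq by blast
  moreover have "sp (i + n) = sp i" by simp
  then have "sp (i + n) \<in> X" using \<open>sp i \<in> X\<close> by metis
  ultimately have "1 \<le> n \<and> n \<le> n \<and> sp i \<in> X \<and> sp (i + n) \<in> X \<and> (\<forall>j<n. rm (i + j) \<in> X)"
    using assms(3) n3 unfolding rim_eq by auto
  then have "has_arc n X" unfolding has_arc_def by blast
  then show False using assms by simp
qed

lemma whirl_eq: "whirl_matroid n = W True"
proof -
  have "X \<in> {X. X \<subseteq> E \<and> forest X} \<union> {rim n} \<longleftrightarrow> indep True X" for X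
    using forest_iff[of X] rim_subset_no_arc[of X] no_arc_rim rim_E by (auto simp: indep_def)
  then show ?thesis unfolding whirl_matroid_def W_def by blast
qed


end

section \<open>A vector representation and the matroid axioms\<close>

interpretation real_poly: vector_space "smult :: real \<Rightarrow> real poly \<Rightarrow> real poly"
  by unfold_locales (auto simp: smult_add_right smult_add_left)

context wheel begin

text \<open>The product of the gains around the rim is 1 for the wheel and 2 for the whirl. The rim
  vectors are dependent exactly when it is 1, so 2 stands for any real other than 0 and 1.\<close>

definition gain :: "bool \<Rightarrow> nat \<Rightarrow> real" where
  "gain g i = (if g \<and> Suc i mod n = 0 then 2 else 1)"

text \<open>A representation as a gain graph: vertex \<open>i + 1\<close> is the basis vector \<open>x^i\<close>, the hub
  is \<open>0\<close>, and for the whirl the edge closing the rim has gain 2.\<close>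

definition vec :: "bool \<Rightarrow> nat set \<Rightarrow> real poly" where
  "vec g x = (if 0 \<in> x then monom 1 (Max x - 1)
     else if x = {1, n} then monom 1 (n - 1) - smult (if g then 2 else 1) (monom 1 0)
     else monom 1 (Min x - 1) - monom 1 (Max x - 1))"

lemma vec_sp [simp]: "vec g (sp i) = monom 1 (i mod n)"
  by (simp add: vec_def spoke_def)

lemma vec_rm: "vec g (rm i) = monom 1 (i mod n) - smult (gain g i) (monom 1 (Suc i mod n))"
proof (cases "Suc (i mod n) = n")
  case True
  then have "Suc i mod n = 0" by (simp add: mod_Suc)
  moreover have "rm i = {1, n}" using True calculation by (auto simp: rimedge_def)
  moreover have "i mod n = n - 1" using True by simp
  ultimately show ?thesis using n3 by (simp add: vec_def gain_def)
next
  case False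
  then have s: "Suc i mod n = Suc (i mod n)" by (simp add: mod_Suc)
  then have r: "rm i = {Suc (i mod n), Suc (Suc (i mod n))}" by (simp add: rimedge_def)
  have "{Suc a, Suc (Suc a)} \<noteq> {1, n}" if "Suc a \<noteq> n" for a
    using that n3 unfolding doubleton_eq_iff by linarith
  from this[OF False] have "rm i \<noteq> {1, n}" unfolding r .
  then show ?thesis using s r by (simp add: vec_def gain_def)
qed

text \<open>Independence of a family indexed by edges rather than of a set of vectors: two edges
  with the same vector have to count as dependent.\<close>

definition vindep :: "bool \<Rightarrow> nat set set \<Rightarrow> bool" where
  "vindep g X \<longleftrightarrow> (\<forall>x\<in>X. vec g x \<notin> real_poly.span (vec g ` (X - {x})))"

lemma vindep_insert:
  assumes "vindep g X" "vec g x \<notin> real_poly.span (vec g ` X)"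
  shows "vindep g (insert x X)"
  unfolding vindep_def
proof
  fix y assume y: "y \<in> insert x X"
  have "x \<notin> X" using assms(2) real_poly.span_base by blast
  show "vec g y \<notin> real_poly.span (vec g ` (insert x X - {y}))"
  proof (cases "y = x")
    case True
    then show ?thesis using assms(2) \<open>x \<notin> X\<close> by simp
  next
    case False
    then have "y \<in> X" using y by simp
    have e: "vec g ` (insert x X - {y}) = insert (vec g x) (vec g ` (X - {y}))" using False by auto
    have e': "insert (vec g y) (vec g ` (X - {y})) = vec g ` X" using \<open>y \<in> X\<close> by auto
    show ?thesis
    proof
      assume "vec g y \<in> real_poly.span (vec g ` (insert x X - {y}))"
      then have m: "vec g y \<in> real_poly.span (insert (vec g x) (vec g ` (X - {y})))" unfolding e .
      have "vec g y \<notin> real_poly.span (vec g ` (X - {y}))" using assms(1) \<open>y \<in> X\<close> unfolding vindep_def by simp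
      from real_poly.in_span_insert[OF m this]
      have "vec g x \<in> real_poly.span (insert (vec g y) (vec g ` (X - {y})))" .
      then show False using assms(2) unfolding e' by simp
    qed
  qed
qed

lemma vindep_exchange:
  assumes I: "vindep g I" "finite I" and J: "vindep g J" "finite J" and less: "card I < card J"
  shows "\<exists>x\<in>J - I. vindep g (insert x I)"
proof (rule ccontr)
  assume neg: "\<not> ?thesis"
  have "vec g x \<in> real_poly.span (vec g ` I)" if "x \<in> J" for x
  proof (cases "x \<in> I")
    case True
    then show ?thesis by (simp add: real_poly.span_base)
  next
    case False
    then show ?thesis using vindep_insert[OF I(1), of x] that neg by auto
  qed
  then have sub: "vec g ` J \<subseteq> real_poly.span (vec g ` I)" by auto
  have inj: "inj_on (vec g) J"
  proof (rule inj_onI, rule ccontr)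
    fix x y assume xy: "x \<in> J" "y \<in> J" "vec g x = vec g y" "x \<noteq> y"
    then have "vec g x \<in> vec g ` (J - {x})" by auto
    from real_poly.span_base[OF this] show False using J(1) xy(1) unfolding vindep_def by simp
  qed
  have "real_poly.independent (vec g ` J)"
    unfolding real_poly.dependent_def
  proof
    assume "\<exists>a\<in>vec g ` J. a \<in> real_poly.span (vec g ` J - {a})"
    then obtain x where x: "x \<in> J" "vec g x \<in> real_poly.span (vec g ` J - {vec g x})" by auto
    have "vec g ` J - {vec g x} \<subseteq> vec g ` (J - {x})" by auto
    from real_poly.span_mono[OF this] show False using x J(1) unfolding vindep_def by auto
  qed
  then have "card (vec g ` J) \<le> card (vec g ` I)"
    using real_poly.independent_span_bound[OF _ _ sub] I(2) by simp
  moreover have "card (vec g ` I) \<le> card I" using I(2) by (rule card_image_le)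
  ultimately show False using less card_image[OF inj] by simp
qed

text \<open>From the first spoke on, the rim edges put the vertices of the arc into the span one
  after another; the second spoke then puts the last edge there as well. Nonzero gains only rescale,
  so the argument is uniform in \<open>g\<close>.\<close>

lemma arc_not_vindep:
  assumes "has_arc n X" shows "\<not> vindep g X"
proof -
  from assms obtain a l where al: "1 \<le> l" "l \<le> n" "sp a \<in> X" "sp (a + l) \<in> X"
     "\<forall>j<l. rm (a + j) \<in> X" unfolding has_arc_def by blast
  define e where "e = rm (a + (l - 1))"
  define S where "S = real_poly.span (vec g ` (X - {e}))"
  have mem: "vec g x \<in> S" if "x \<in> X" "x \<noteq> e" for x
    unfolding S_def by (rule real_poly.span_base) (use that in auto)
  have step: "monom 1 ((a + j) mod n) \<in> S" if "j < l" for j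
    using that
  proof (induction j)
    case 0
    have "vec g (sp a) \<in> S" by (rule mem) (use al in \<open>auto simp: e_def\<close>)
    then show ?case by simp
  next
    case (Suc j)
    have "rm (a + j) \<noteq> e"
    proof
      assume "rm (a + j) = e"
      then have "j = l - 1" using add_mod_inj[of a j n "l - 1"] Suc.prems al(2) by (simp add: e_def)
      then show False using Suc.prems by simp
    qed
    then have "vec g (rm (a + j)) \<in> S" using al(5) Suc.prems by (intro mem) auto
    moreover have "monom 1 ((a + j) mod n) \<in> S" using Suc by simp
    ultimately have "monom 1 ((a + j) mod n) - vec g (rm (a + j)) \<in> S"
      unfolding S_def by (rule real_poly.span_diff[rotated])
    then have "smult (inverse (gain g (a + j))) (monom 1 ((a + j) mod n) - vec g (rm (a + j))) \<in> S"
      unfolding S_def by (rule real_poly.span_scale)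
    moreover have "gain g (a + j) \<noteq> 0" by (simp add: gain_def)
    ultimately show ?case by (simp add: vec_rm)
  qed
  have l: "Suc (a + (l - 1)) = a + l" using al(1) by simp
  have "vec g (sp (a + l)) \<in> S" by (rule mem) (use al in \<open>auto simp: e_def\<close>)
  then have "smult (gain g (a + (l - 1))) (monom 1 ((a + l) mod n)) \<in> S"
    unfolding S_def by (intro real_poly.span_scale) simp
  moreover have "monom 1 ((a + (l - 1)) mod n) \<in> S" using step[of "l - 1"] al(1) by simp
  ultimately have "vec g e \<in> S"
    unfolding e_def vec_rm l S_def by (intro real_poly.span_diff)
  moreover have "l - 1 < l" using al(1) by simp
  then have "e \<in> X" unfolding e_def using al(5) by blast
  ultimately show ?thesis unfolding vindep_def S_def by blast
qed

text \<open>With all gains equal to 1 the rim vectors telescope.\<close>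

lemma rim_not_vindep:
  assumes "rim n \<subseteq> X" shows "\<not> vindep False X"
proof -
  define e where "e = rm (n - 1)"
  define S where "S = real_poly.span (vec False ` (X - {e}))"
  have eX: "rm i \<in> X" for i using assms unfolding rim_eq by blast
  have gain: "gain False i = 1" for i by (simp add: gain_def)
  have step: "monom 1 0 - monom 1 j \<in> S" if "j < n" for j
    using that
  proof (induction j)
    case 0
    show ?case unfolding S_def by (simp add: real_poly.span_zero)
  next
    case (Suc j)
    have "rm j \<noteq> e" using Suc.prems by (simp add: e_def)
    then have "vec False (rm j) \<in> S"
      unfolding S_def using eX by (intro real_poly.span_base) auto
    moreover have "monom 1 0 - monom 1 j \<in> S" using Suc by simp
    ultimately have "(monom 1 0 - monom 1 j) + vec False (rm j) \<in> S"
      unfolding S_def by (rule real_poly.span_add[rotated])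
    then show ?case using Suc.prems by (simp add: vec_rm gain)
  qed
  have "- (monom 1 0 - monom 1 (n - 1)) \<in> S"
    using step[of "n - 1"] n3 unfolding S_def by (intro real_poly.span_neg) simp
  moreover have "vec False e = - (monom 1 0 - monom 1 (n - 1))"
    using n3 by (simp add: e_def vec_rm gain one_pCons)
  ultimately have "vec False e \<in> S" by metis
  moreover have "e \<in> X" using eX by (simp add: e_def)
  ultimately show ?thesis unfolding vindep_def S_def by blast
qed

lemma coeff_vec_0:
  assumes "x \<in> E" "k < n" "Suc k \<notin> x" shows "coeff (vec g x) k = 0"
  using assms(1)
proof (cases rule: E_cases)
  case (1 i) then show ?thesis using assms by (auto simp: Suc_in_spoke)
next
  case (2 i) then show ?thesis using assms by (auto simp: Suc_in_rimedge vec_rm)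
qed

lemma coeff_vec_nz:
  assumes "x \<in> E" "k < n" "Suc k \<in> x" shows "coeff (vec g x) k \<noteq> 0"
  using assms(1)
proof (cases rule: E_cases)
  case (1 i) then show ?thesis using assms by (auto simp: Suc_in_spoke)
next
  case (2 i)
  then show ?thesis using assms Suc_mod_neq[of n i] n3
    by (auto simp: Suc_in_rimedge vec_rm gain_def)
qed

text \<open>Induction by removing an edge on which some linear functional is nonzero while it
  vanishes on all others. At a leaf this is the coefficient of the leaf vertex; for the rim of the
  whirl it is evaluation at 1, which kills every rim vector but the one with gain 2.\<close>

lemma indep_vindep:
  assumes "indep g X" shows "vindep g X"
  using assms
proof (induction "card X" arbitrary: X rule: less_induct)
  case less
  have X: "X \<subseteq> E" "\<not> has_arc n X" "\<not> g \<longrightarrow> \<not> rim n \<subseteq> X" using less.prems by (auto simp: indep_def)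
  have fin: "finite X" using X finite_E finite_subset by blast
  have smaller: "vindep g (X - {x})" if "x \<in> X" for x
  proof (rule less.hyps)
    show "card (X - {x}) < card X" using fin that by (meson card_Diff1_less)
    show "indep g (X - {x})" using X has_arc_mono[of n "X - {x}" X] unfolding indep_def by blast
  qed
  have main: ?case if x: "x \<in> X" and f: "real_poly.subspace {p. f p = 0}" "f (vec g x) \<noteq> 0"
      "\<And>y. y \<in> X - {x} \<Longrightarrow> f (vec g y) = 0" for x and f :: "real poly \<Rightarrow> real"
  proof -
    have "real_poly.span (vec g ` (X - {x})) \<subseteq> {p. f p = 0}"
      using f by (intro real_poly.span_minimal) auto
    then have "vec g x \<notin> real_poly.span (vec g ` (X - {x}))" using f(2) by auto
    then have "vindep g (insert x (X - {x}))" using smaller[OF x] by (intro vindep_insert)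
    then show ?thesis using x by (simp add: insert_absorb)
  qed
  show ?case
  proof (cases "rim n \<subseteq> X")
    case True
    then have Xr: "X = rim n" and g using rim_subset_no_arc X by auto
    define f where "f p = poly p (1::real)" for p
    show ?thesis
    proof (rule main[of "rm (n - 1)" f])
      show "rm (n - 1) \<in> X" unfolding Xr rim_eq by blast
      show "real_poly.subspace {p. f p = 0}" by (simp add: real_poly.subspace_def f_def)
      show "f (vec g (rm (n - 1))) \<noteq> 0" using \<open>g\<close> n3 by (simp add: f_def vec_rm gain_def poly_monom)
      fix y assume y: "y \<in> X - {rm (n - 1)}"
      then have "y \<in> E" using X by auto
      then show "f (vec g y) = 0"
      proof (cases rule: E_cases)
        case (1 i) then show ?thesis using y Xr by (auto simp: rim_eq)
      next
        case (2 i)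
        then have "i \<noteq> n - 1" using y by auto
        then have "Suc i mod n \<noteq> 0" using 2 n3 by simp
        then show ?thesis using 2 by (simp add: f_def vec_rm gain_def poly_monom)
      qed
    qed
  next
    case False
    show ?thesis
    proof (cases "X = {}")
      case True then show ?thesis by (simp add: vindep_def)
    next
      case ne: False
      obtain x i where x: "x \<in> X" "Suc (i mod n) \<in> x" "\<forall>y \<in> X. Suc (i mod n) \<in> y \<longrightarrow> y = x"
        using leaf_exists[OF X(1) ne X(2) False] by blast
      have i: "i mod n < n" using n3 by simp
      show ?thesis
      proof (rule main[of x "\<lambda>p. coeff p (i mod n)"])
        show "coeff (vec g x) (i mod n) \<noteq> 0" using subsetD[OF X(1) x(1)] i x(2) by (rule coeff_vec_nz)
        show "coeff (vec g y) (i mod n) = 0" if "y \<in> X - {x}" for y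
        proof (rule coeff_vec_0[OF _ i])
          show "y \<in> E" using that X by auto
          show "Suc (i mod n) \<notin> y" using x(3) that by blast
        qed
        show "real_poly.subspace {p. coeff p (i mod n) = 0}" by (simp add: real_poly.subspace_def)
      qed (rule x(1))
    qed
  qed
qed

lemma indep_iff_vindep: "X \<subseteq> E \<Longrightarrow> indep g X \<longleftrightarrow> vindep g X"
  using indep_vindep arc_not_vindep rim_not_vindep unfolding indep_def by (cases g) auto

lemma matroid_W: "matroid (W g)"
proof
  show "finite (ground (W g))" by (simp add: finite_E)
  show "indeps (W g) \<subseteq> Pow (ground (W g))" by (auto simp: W_def indep_def)
  have "rim n \<noteq> {}" by (auto simp: rim_eq)
  then show "{} \<in> indeps (W g)" using n3 by (auto simp: indep_def has_arc_def)
  show "I \<in> indeps (W g)" if "J \<in> indeps (W g)" "I \<subseteq> J" for I J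
    using that has_arc_mono[of n I J] by (auto simp: indep_def)
  show "\<exists>x\<in>J - I. insert x I \<in> indeps (W g)"
    if IJ: "I \<in> indeps (W g)" "J \<in> indeps (W g)" "card I < card J" for I J
  proof -
    have sub: "I \<subseteq> E" "J \<subseteq> E" using IJ by (auto simp: indep_def)
    then have "finite I" "finite J" using finite_E finite_subset by blast+
    moreover have "vindep g I" "vindep g J" using IJ sub indep_iff_vindep by auto
    ultimately obtain x where x: "x \<in> J - I" "vindep g (insert x I)"
      using vindep_exchange IJ(3) by blast
    then have "insert x I \<subseteq> E" using sub by auto
    then show ?thesis using x indep_iff_vindep[of "insert x I"] by auto
  qed
qed

lemma loopless_W: "loopless (W g)"
proof -
  have "indep g {e}" if "e \<in> E" for e
  proof -
    have "\<not> has_arc n {e}"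
    proof
      assume "has_arc n {e}"
      then obtain a l where "1 \<le> l" "sp a \<in> {e}" "\<forall>j<l. rm (a + j) \<in> {e}" by (auto simp: has_arc_def)
      then have "sp a = e" "rm (a + 0) = e" by (auto simp del: add_0_right)
      then show False by (metis spoke_neq_rimedge(1))
    qed
    moreover have "\<not> rim n \<subseteq> {e}"
    proof
      assume "rim n \<subseteq> {e}"
      then have "rm 0 \<in> {e}" "rm 1 \<in> {e}" unfolding rim_eq by blast+
      then have "rm 0 = rm 1" by simp
      then show False using n3 by simp
    qed
    ultimately show ?thesis using that by (simp add: indep_def)
  qed
  then show ?thesis by (simp add: loopless_def)
qed

end

section \<open>Flats as cyclic words\<close>

text \<open>A flat of the wheel or whirl is encoded by a cyclic word: \<open>H\<close> marks a vertex joined to the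
  hub, \<open>J\<close> a vertex joined to its predecessor by a rim edge but not to the hub, and \<open>B\<close> any other
  vertex.\<close>

datatype letter = H | B | J

context wheel begin

definition ltr :: "letter list \<Rightarrow> nat \<Rightarrow> letter" where
  "ltr w i = w ! (i mod n)"

text \<open>A rim edge leaving a vertex joined to the hub connects the next vertex to the hub too,
  so in a flat that vertex is \<open>H\<close> and never \<open>J\<close>.\<close>

definition cyc_valid :: "letter list \<Rightarrow> bool" where
  "cyc_valid w \<longleftrightarrow> length w = n \<and> (\<forall>i. ltr w (Suc i) = J \<longrightarrow> ltr w i \<noteq> H)"

text \<open>A rim edge is present at a \<open>J\<close> but also between two adjacent
  \<open>H\<close>, since a flat contains the third side of a triangle. So a \<open>J\<close> may
  grow into \<open>H\<close> only if its predecessor is \<open>H\<close> in the larger word.\<close>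

definition cyc_le :: "letter list \<Rightarrow> letter list \<Rightarrow> bool" where
  "cyc_le w w' \<longleftrightarrow> (\<forall>i. (ltr w i = H \<longrightarrow> ltr w' i = H) \<and>
     (ltr w (Suc i) = J \<longrightarrow> ltr w' (Suc i) = J \<or> ltr w' (Suc i) = H \<and> ltr w' i = H))"

definition flat_of :: "letter list \<Rightarrow> nat set set" where
  "flat_of w = {sp i | i. ltr w i = H} \<union> {rm i | i. ltr w (Suc i) = J \<or> ltr w i = H \<and> ltr w (Suc i) = H}"

text \<open>Rim edges between two \<open>H\<close> are left out, since each closes a triangle with
  its spokes.\<close>

definition basis_word :: "letter list \<Rightarrow> nat set set" where
  "basis_word w = {sp i | i. ltr w i = H} \<union> {rm i | i. ltr w (Suc i) = J}"

text \<open>In the whirl the word of \<open>J\<close> alone would be the rim, a basis and hence not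
  closed. In the wheel one \<open>B\<close> without any \<open>H\<close> would be the rim minus an
  edge, whose closure is the rim.\<close>

definition flat_words :: "bool \<Rightarrow> letter list set" where
  "flat_words g = {w. cyc_valid w \<and> (if g then w \<noteq> replicate n J else H \<in> set w \<or> count_list w B \<noteq> 1)}"

lemma ltr_cong: "i mod n = j mod n \<Longrightarrow> ltr w i = ltr w j"
  by (simp add: ltr_def)

lemma ltr_Suc_cong: "i mod n = j mod n \<Longrightarrow> ltr w (Suc i) = ltr w (Suc j)"
  using Suc_mod_eq_iff[of n i j] n3 by (simp add: ltr_def)

lemma ltr_pred: "ltr w (Suc (i + n - 1)) = ltr w i"
  using n3 by (simp add: ltr_def)

lemma nth_ltr: "i < n \<Longrightarrow> w ! i = ltr w i"
  by (simp add: ltr_def)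

lemma set_word: "length w = n \<Longrightarrow> x \<in> set w \<longleftrightarrow> (\<exists>i. ltr w i = x)"
proof
  assume l: "length w = n"
  show "x \<in> set w \<Longrightarrow> \<exists>i. ltr w i = x" using l by (metis in_set_conv_nth nth_ltr)
  have "i mod n < n" for i using n3 by simp
  then show "\<exists>i. ltr w i = x \<Longrightarrow> x \<in> set w" using l by (auto simp: ltr_def)
qed

lemma sp_mem_iff:
  assumes "\<And>i j. i mod n = j mod n \<Longrightarrow> P i \<Longrightarrow> P j"
  shows "sp i \<in> {sp j | j. P j} \<union> {rm j | j. Q j} \<longleftrightarrow> P i"
  using assms[of _ i] by (simp add: spoke_neq_rimedge) metis

lemma rm_mem_iff:
  assumes "\<And>i j. i mod n = j mod n \<Longrightarrow> Q i \<Longrightarrow> Q j"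
  shows "rm i \<in> {sp j | j. P j} \<union> {rm j | j. Q j} \<longleftrightarrow> Q i"
  using assms[of _ i] by (simp add: spoke_neq_rimedge) metis

lemma sp_flat_of [simp]: "sp i \<in> flat_of w \<longleftrightarrow> ltr w i = H"
  unfolding flat_of_def by (rule sp_mem_iff) (metis ltr_cong)

lemma rm_flat_of [simp]:
  "rm i \<in> flat_of w \<longleftrightarrow> ltr w (Suc i) = J \<or> ltr w i = H \<and> ltr w (Suc i) = H"
  unfolding flat_of_def by (rule rm_mem_iff) (metis ltr_cong ltr_Suc_cong)

lemma sp_basis_word [simp]: "sp i \<in> basis_word w \<longleftrightarrow> ltr w i = H"
  unfolding basis_word_def by (rule sp_mem_iff) (metis ltr_cong)

lemma rm_basis_word [simp]: "rm i \<in> basis_word w \<longleftrightarrow> ltr w (Suc i) = J"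
  unfolding basis_word_def by (rule rm_mem_iff) (metis ltr_Suc_cong)

lemma flat_of_E: "flat_of w \<subseteq> E" and basis_word_E: "basis_word w \<subseteq> E"
  by (auto simp: flat_of_def basis_word_def)

lemma basis_word_subset: "basis_word w \<subseteq> flat_of w"
  by (auto simp: flat_of_def basis_word_def)

lemma E_subset_iff: "X \<subseteq> E \<Longrightarrow> X \<subseteq> Y \<longleftrightarrow> (\<forall>i. (sp i \<in> X \<longrightarrow> sp i \<in> Y) \<and> (rm i \<in> X \<longrightarrow> rm i \<in> Y))"
  unfolding E_eq by blast

lemma flat_of_subset_iff: "flat_of w \<subseteq> flat_of w' \<longleftrightarrow> cyc_le w w'"
proof
  assume "flat_of w \<subseteq> flat_of w'"
  then show "cyc_le w w'"
    unfolding E_subset_iff[OF flat_of_E] cyc_le_def sp_flat_of rm_flat_of by blast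
next
  assume "cyc_le w w'"
  then show "flat_of w \<subseteq> flat_of w'"
    unfolding E_subset_iff[OF flat_of_E] cyc_le_def sp_flat_of rm_flat_of by blast
qed

lemma cyc_le_antisym:
  assumes "cyc_le w w'" "cyc_le w' w" "length w = n" "length w' = n"
  shows "w = w'"
proof (rule nth_equalityI)
  fix i assume "i < length w"
  then have i: "i < n" using assms by simp
  have "ltr w j = ltr w' j" for j
  proof -
    have H: "ltr w i = H \<longleftrightarrow> ltr w' i = H" for i using assms(1,2) unfolding cyc_le_def by blast
    have "ltr w (Suc i) = J \<longleftrightarrow> ltr w' (Suc i) = J" for i
      using assms(1,2) H unfolding cyc_le_def by (metis letter.distinct)
    from this[of "j + n - 1"] have "ltr w j = J \<longleftrightarrow> ltr w' j = J" unfolding ltr_pred .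
    then show ?thesis using H by (metis letter.exhaust)
  qed
  then show "w ! i = w' ! i" using i by (simp add: nth_ltr)
qed (use assms in simp)

text \<open>Every letter other than \<open>B\<close> accounts for one element: the spoke at an
  \<open>H\<close>, the rim edge to the predecessor at a \<open>J\<close>.\<close>

lemma card_basis_word:
  assumes "length w = n" shows "card (basis_word w) = length (filter (\<lambda>x. x \<noteq> B) w)"
proof -
  define h where "h i = (if ltr w i = H then sp i else rm (i + n - 1))" for i
  have "bij_betw h {i. i < n \<and> ltr w i \<noteq> B} (basis_word w)"
  proof (rule bij_betw_imageI)
    show "inj_on h {i. i < n \<and> ltr w i \<noteq> B}"
    proof (rule inj_onI)
      fix i j assume ij: "i \<in> {i. i < n \<and> ltr w i \<noteq> B}" "j \<in> {i. i < n \<and> ltr w i \<noteq> B}" "h i = h j"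
      then have "(ltr w i = H \<and> ltr w j = H \<and> i mod n = j mod n) \<or> (i + n - 1) mod n = (j + n - 1) mod n"
        by (auto simp: h_def split: if_splits)
      moreover have "i = j" if "(i + n - 1) mod n = (j + n - 1) mod n"
      proof -
        have "Suc (i + n - 1) mod n = Suc (j + n - 1) mod n"
          using that n3 by (subst Suc_mod_eq_iff) auto
        then show ?thesis using ij n3 by simp
      qed
      ultimately show "i = j" using ij by auto
    qed
    show "h ` {i. i < n \<and> ltr w i \<noteq> B} = basis_word w"
    proof (intro set_eqI iffI)
      fix x assume "x \<in> h ` {i. i < n \<and> ltr w i \<noteq> B}"
      then obtain i where i: "ltr w i \<noteq> B" "x = h i" by auto
      show "x \<in> basis_word w"
      proof (cases "ltr w i = H")
        case True then show ?thesis using i by (simp add: h_def)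
      next
        case False
        then have "ltr w i = J" using i(1) by (cases "ltr w i") auto
        then have "rm (i + n - 1) \<in> basis_word w" unfolding rm_basis_word ltr_pred .
        then show ?thesis using i False by (simp add: h_def)
      qed
    next
      fix x assume x: "x \<in> basis_word w"
      then have "x \<in> E" using basis_word_E by blast
      then show "x \<in> h ` {i. i < n \<and> ltr w i \<noteq> B}"
      proof (cases rule: E_cases)
        case (1 i)
        then have "ltr w i = H" using x by simp
        then show ?thesis using 1 by (intro image_eqI[of _ _ i]) (auto simp: h_def)
      next
        case (2 i)
        then have J: "ltr w (Suc i) = J" using x by simp
        have J': "ltr w (Suc i mod n) = J" using J by (simp add: ltr_def)
        have "(Suc i mod n + n - 1) mod n = i mod n"
          using 2(1) by (cases "Suc i = n") auto
        then have "x = h (Suc i mod n)" using J' 2 by (simp add: h_def)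
        then show ?thesis using J' n3 by (intro image_eqI[of _ _ "Suc i mod n"]) auto
      qed
    qed
  qed
  then have "card (basis_word w) = card {i. i < n \<and> ltr w i \<noteq> B}" by (simp add: bij_betw_same_card)
  also have "{i. i < n \<and> ltr w i \<noteq> B} = {i. i < length w \<and> w ! i \<noteq> B}"
    using assms by (auto simp: nth_ltr)
  finally show ?thesis by (simp add: length_filter_conv_card)
qed

lemma arcE:
  assumes "has_arc n X"
  obtains a l where "1 \<le> l" "l \<le> n" "sp a \<in> X" "sp (a + l) \<in> X" "\<forall>j<l. rm (a + j) \<in> X"
    "rm a \<in> X" "rm (a + (l - 1)) \<in> X" "Suc (a + (l - 1)) = a + l"
proof -
  obtain a l where al: "1 \<le> l" "l \<le> n" "sp a \<in> X" "sp (a + l) \<in> X" "\<forall>j<l. rm (a + j) \<in> X"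
    using assms unfolding has_arc_def by blast
  moreover have "rm (a + 0) \<in> X" "rm (a + (l - 1)) \<in> X"
    using al(1) by (intro al(5)[rule_format]; simp)+
  ultimately show ?thesis using that by simp
qed

lemma full_turn: "1 \<le> l \<Longrightarrow> l \<le> n \<Longrightarrow> sp (a + l) = sp a \<Longrightarrow> l = n"
proof -
  assume l: "1 \<le> l" "l \<le> n" "sp (a + l) = sp a"
  then have "(a + l) mod n = (a + 0) mod n" by simp
  then show "l = n" using add_mod_inj[of a l n 0] l by (cases "l < n") auto
qed

lemma arc_one: "sp i \<in> X \<Longrightarrow> rm i \<in> X \<Longrightarrow> sp (Suc i) \<in> X \<Longrightarrow> has_arc n X"
  unfolding has_arc_def using n3 by (intro exI[of _ i] exI[of _ 1]) simp

lemma basis_word_indep: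
  assumes w: "cyc_valid w" and nJ: "\<exists>i. ltr w i \<noteq> J"
  shows "indep g (basis_word w)"
proof -
  have v: "ltr w (Suc i) = J \<Longrightarrow> ltr w i \<noteq> H" for i using w by (simp add: cyc_valid_def)
  have "\<not> has_arc n (basis_word w)"
  proof
    assume "has_arc n (basis_word w)"
    then show False by (rule arcE) (use v in simp)
  qed
  moreover have "\<not> rim n \<subseteq> basis_word w"
  proof
    assume r: "rim n \<subseteq> basis_word w"
    obtain i where "ltr w i \<noteq> J" using nJ by blast
    moreover have "rm (i + n - 1) \<in> basis_word w" using r unfolding rim_eq by blast
    ultimately show False unfolding rm_basis_word ltr_pred by simp
  qed
  ultimately show ?thesis using basis_word_E by (simp add: indep_def)
qed

text \<open>The first rim edge of an arc makes the letter after its start \<open>J\<close>, so the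
  start is not \<open>H\<close>; the last one makes the end itself \<open>J\<close>. Hence both ends
  are \<open>c\<close>, and the arc would be a full turn containing the rim.\<close>

lemma insert_sp_indep:
  assumes w: "cyc_valid w" and nJ: "\<exists>i. ltr w i \<noteq> J" and c: "ltr w c \<noteq> H"
  shows "indep g (insert (sp c) (basis_word w))"
proof -
  let ?X = "insert (sp c) (basis_word w)"
  have v: "ltr w (Suc i) = J \<Longrightarrow> ltr w i \<noteq> H" for i using w by (simp add: cyc_valid_def)
  have nr: "\<not> rim n \<subseteq> ?X"
  proof
    assume "rim n \<subseteq> ?X"
    then have "rim n \<subseteq> basis_word w" unfolding rim_eq by auto
    then show False using basis_word_indep[OF w nJ, of False] by (simp add: indep_def)
  qed
  have "\<not> has_arc n ?X"
  proof
    assume "has_arc n ?X"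
    then show False
    proof (rule arcE)
      fix a l assume al: "1 \<le> l" "l \<le> n" "sp a \<in> ?X" "sp (a + l) \<in> ?X" "\<forall>j<l. rm (a + j) \<in> ?X"
        "rm a \<in> ?X" "rm (a + (l - 1)) \<in> ?X" "Suc (a + (l - 1)) = a + l"
      have "ltr w (Suc a) = J" using al(6) by simp
      then have "sp a = sp c" using al(3) v by auto
      moreover have "ltr w (Suc (a + (l - 1))) = J" using al(7) by (simp del: One_nat_def)
      then have "ltr w (a + l) = J" unfolding al(8) .
      then have "sp (a + l) = sp c" using al(4) by auto
      ultimately have "l = n" using full_turn[OF al(1,2), of a] by metis
      then have "rim n \<subseteq> ?X" using al(5) by (intro rim_subsetI[of a]) blast
      then show False using nr by simp
    qed
  qed
  then show ?thesis using nr basis_word_E by (simp add: indep_def)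
qed

text \<open>An arc has \<open>H\<close> at both ends, so by validity neither its first nor its last
  edge belongs to the basis. Both are then \<open>rm c\<close>, an edge between two
  \<open>H\<close>, which already lies in the flat.\<close>

lemma insert_rm_indep:
  assumes w: "cyc_valid w" and c: "rm c \<notin> flat_of w"
    and nB: "\<not> g \<Longrightarrow> \<nexists>k. ltr w k = B \<and> (\<forall>i. i mod n \<noteq> k mod n \<longrightarrow> ltr w i = J)"
  shows "indep g (insert (rm c) (basis_word w))"
proof -
  let ?X = "insert (rm c) (basis_word w)"
  have v: "ltr w (Suc i) = J \<Longrightarrow> ltr w i \<noteq> H" for i using w by (simp add: cyc_valid_def)
  have "\<not> rim n \<subseteq> ?X" if "\<not> g"
  proof
    assume r: "rim n \<subseteq> ?X"
    have *: "ltr w i = J" if "i mod n \<noteq> Suc c mod n" for i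
    proof -
      have "rm (i + n - 1) \<in> ?X" using r unfolding rim_eq by blast
      moreover have "rm (i + n - 1) \<noteq> rm c"
      proof
        assume "rm (i + n - 1) = rm c"
        then have "Suc (i + n - 1) mod n = Suc c mod n" using Suc_mod_eq_iff[of n "i + n - 1" c] n3 by simp
        then show False using that n3 by simp
      qed
      ultimately have "rm (i + n - 1) \<in> basis_word w" by blast
      then show ?thesis unfolding rm_basis_word ltr_pred .
    qed
    have "ltr w (Suc (Suc c)) = J" using n3 by (intro *) (simp add: Suc_mod_neq)
    then have "ltr w (Suc c) \<noteq> H" by (rule v)
    moreover have "ltr w (Suc c) \<noteq> J" using c by simp
    ultimately have "ltr w (Suc c) = B" by (cases "ltr w (Suc c)") auto
    then show False using nB[OF that] * by blast
  qed
  moreover have "\<not> has_arc n ?X"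
  proof
    assume "has_arc n ?X"
    then show False
    proof (rule arcE)
      fix a l assume al: "1 \<le> l" "l \<le> n" "sp a \<in> ?X" "sp (a + l) \<in> ?X" 
        "rm a \<in> ?X" "rm (a + (l - 1)) \<in> ?X" "Suc (a + (l - 1)) = a + l"
      have H: "ltr w a = H" "ltr w (a + l) = H" using al(3,4) by auto
      then have "rm a \<notin> basis_word w" using v by auto
      then have 1: "a mod n = c mod n" using al(5) by auto
      have "rm (a + (l - 1)) \<notin> basis_word w" using H(2) unfolding rm_basis_word al(7) by simp
      then have 2: "(a + (l - 1)) mod n = c mod n" using al(6) by auto
      have "ltr w c = H" using ltr_cong[OF 1, of w] H by simp
      moreover have "ltr w (Suc c) = H" using ltr_Suc_cong[OF 2, of w] H unfolding al(7) by simp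
      ultimately show False using c by simp
    qed
  qed
  ultimately show ?thesis using basis_word_E by (auto simp: indep_def)
qed

lemma flat_of_flat:
  assumes w: "cyc_valid w" and nJ: "\<exists>i. ltr w i \<noteq> J"
    and nB: "\<not> g \<Longrightarrow> \<nexists>k. ltr w k = B \<and> (\<forall>i. i mod n \<noteq> k mod n \<longrightarrow> ltr w i = J)"
  shows "flat_of w \<in> flats (W g)" "rank_of (W g) (flat_of w) = length (filter (\<lambda>x. x \<noteq> B) w)"
proof -
  interpret M: matroid "W g" by (rule matroid_W)
  have i: "insert x (basis_word w) \<notin> indeps (W g)" if x: "x \<in> flat_of w - basis_word w" for x
  proof -
    have "x \<in> E" using x flat_of_E by blast
    then show ?thesis
    proof (cases rule: E_cases)
      case (1 i) then show ?thesis using x by simp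
    next
      case (2 i)
      then have "ltr w i = H" "ltr w (Suc i) = H" using x by auto
      then have "has_arc n (insert x (basis_word w))" using 2 by (intro arc_one[of i]) auto
      then show ?thesis by (simp add: indep_def)
    qed
  qed
  have o: "insert x (basis_word w) \<in> indeps (W g)" if x: "x \<in> ground (W g) - flat_of w" for x
  proof -
    have "x \<in> E" using x by simp
    then show ?thesis
    proof (cases rule: E_cases)
      case (1 i) then show ?thesis using x insert_sp_indep[OF w nJ] by simp
    next
      case (2 i) then show ?thesis using x insert_rm_indep[OF w _ nB] by simp
    qed
  qed
  have b: "basis_word w \<in> indeps (W g)" using basis_word_indep[OF w nJ] by simp
  have "flat_of w \<subseteq> ground (W g)" using flat_of_E by simp
  note fl = M.flatI[OF b basis_word_subset this i o]
  show "flat_of w \<in> flats (W g)" by (rule fl)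
  show "rank_of (W g) (flat_of w) = length (filter (\<lambda>x. x \<noteq> B) w)"
    using fl(2) card_basis_word[of w] w by (simp add: cyc_valid_def)
qed

lemma rim_minus_indep: "indep g (rim n - {rm c})"
  by (auto simp: indep_def has_arc_def rim_eq)

lemma card_rim_minus: "card (rim n - {rm c}) = n - 1"
proof -
  have "rim n = rm ` {..<n}"
  proof -
    have "rm i \<in> rm ` {..<n}" for i using n3 by (intro image_eqI[of _ _ "i mod n"]) auto
    then show ?thesis by (auto simp: rim_eq)
  qed
  moreover have "inj_on rm {..<n}" by (auto simp: inj_on_def)
  ultimately have "card (rim n) = n" by (simp add: card_image)
  moreover have "rm c \<in> rim n" by (simp add: rim_eq)
  ultimately show ?thesis by (simp add: card_Diff_singleton)
qed

text \<open>Treated apart because \<open>basis_word\<close> of the all-\<open>J\<close> word is the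
  whole rim, a circuit of the wheel; the rank is one less than the number of letters other than
  \<open>B\<close>.\<close>

lemma rim_flat: "rim n \<in> flats (W False)" "rank_of (W False) (rim n) = n - 1"
proof -
  interpret M: matroid "W False" by (rule matroid_W)
  have i: "insert x (rim n - {rm 0}) \<notin> indeps (W False)" if "x \<in> rim n - (rim n - {rm 0})" for x
    using that by (auto simp: indep_def)
  have o: "insert x (rim n - {rm 0}) \<in> indeps (W False)" if x: "x \<in> ground (W False) - rim n" for x
  proof -
    obtain c where c: "x = sp c" using x unfolding ground_W E_eq rim_eq by blast
    let ?X = "insert (sp c) (rim n - {rm 0})"
    have nr: "rm 0 \<notin> ?X" by auto
    have "\<not> has_arc n ?X"
    proof
      assume "has_arc n ?X"
      then show False
      proof (rule arcE)
        fix a l assume al: "1 \<le> l" "l \<le> n" "sp a \<in> ?X" "sp (a + l) \<in> ?X" "\<forall>j<l. rm (a + j) \<in> ?X"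
        have "sp i \<notin> rim n" for i by (auto simp: rim_eq)
        then have "sp a = sp c" "sp (a + l) = sp c" using al(3,4) by blast+
        then have "l = n" using full_turn[OF al(1,2), of a] by metis
        then have "rim n \<subseteq> ?X" using al(5) by (intro rim_subsetI[of a]) blast
        then show False using nr unfolding rim_eq by blast
      qed
    qed
    moreover have "\<not> rim n \<subseteq> ?X" using nr unfolding rim_eq by blast
    ultimately show ?thesis using c rim_E by (auto simp: indep_def)
  qed
  have b: "rim n - {rm 0} \<in> indeps (W False)" using rim_minus_indep by simp
  have "rim n - {rm 0} \<subseteq> rim n" "rim n \<subseteq> ground (W False)" using rim_E by auto
  note fl = M.flatI[OF b this i o]
  show "rim n \<in> flats (W False)" by (rule fl)
  show "rank_of (W False) (rim n) = n - 1" using fl(2) card_rim_minus by simp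
qed

lemma pair_indep:
  "indep g {sp i, rm k}" "indep g {sp i, sp j}"
proof -
  have nr: "\<not> rim n \<subseteq> {x, rm k}" if "\<And>i. x \<noteq> rm i" for x k
  proof
    assume "rim n \<subseteq> {x, rm k}"
    then have "rm 0 \<in> {x, rm k}" "rm 1 \<in> {x, rm k}" unfolding rim_eq by blast+
    then have "rm 0 = rm 1" using that by (metis empty_iff insert_iff)
    then show False using n3 by simp
  qed
  have "\<not> has_arc n {sp i, rm k}"
  proof
    assume "has_arc n {sp i, rm k}"
    then show False
    proof (rule arcE)
      fix a l assume al: "1 \<le> l" "l \<le> n" "sp a \<in> {sp i, rm k}" "sp (a + l) \<in> {sp i, rm k}"
        "\<forall>j<l. rm (a + j) \<in> {sp i, rm k}"
      then have "sp a = sp i" "sp (a + l) = sp i" by auto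
      then have "l = n" using full_turn[OF al(1,2), of a] by metis
      then have "rim n \<subseteq> {sp i, rm k}" using al(5) by (intro rim_subsetI[of a]) blast
      then show False using nr by auto
    qed
  qed
  then show "indep g {sp i, rm k}" using nr[of "sp i" k] by (simp add: indep_def)
  have "\<not> has_arc n {sp i, sp j}" by (rule notI, erule arcE) simp
  moreover have "rm 0 \<in> rim n - {sp i, sp j}" by (auto simp: rim_eq)
  then have "\<not> rim n \<subseteq> {sp i, sp j}" by blast
  ultimately show "indep g {sp i, sp j}" by (simp add: indep_def)
qed

text \<open>Triangles are the arcs of length 1, and any two of their sides are independent.\<close>

lemma flat_triangle:
  assumes F: "F \<in> flats (W g)"
  shows "sp i \<in> F \<Longrightarrow> rm i \<in> F \<Longrightarrow> sp (Suc i) \<in> F"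
    "rm i \<in> F \<Longrightarrow> sp (Suc i) \<in> F \<Longrightarrow> sp i \<in> F"
    "sp i \<in> F \<Longrightarrow> sp (Suc i) \<in> F \<Longrightarrow> rm i \<in> F"
proof -
  interpret M: matroid "W g" by (rule matroid_W)
  have cl: "x \<in> F" if "insert x I = {sp i, rm i, sp (Suc i)}" "indep g I" "I \<subseteq> F" for x I
  proof (rule M.flat_closed[OF F _ that(3)])
    have "has_arc n (insert x I)" unfolding that(1) by (rule arc_one[of i]) auto
    then show "insert x I \<notin> indeps (W g)" by (simp add: indep_def)
    show "I \<in> indeps (W g)" using that by simp
    have "x \<in> {sp i, rm i, sp (Suc i)}" unfolding that(1)[symmetric] by simp
    then show "x \<in> ground (W g)" by auto
  qed
  show "sp (Suc i) \<in> F" if "sp i \<in> F" "rm i \<in> F"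
    by (rule cl[of _ "{sp i, rm i}"]) (use that pair_indep in auto)
  show "sp i \<in> F" if "rm i \<in> F" "sp (Suc i) \<in> F"
    by (rule cl[of _ "{sp (Suc i), rm i}"]) (use that pair_indep in auto)
  show "rm i \<in> F" if "sp i \<in> F" "sp (Suc i) \<in> F"
    by (rule cl[of _ "{sp i, sp (Suc i)}"]) (use that pair_indep in auto)
qed

lemma count_list_one_iff:
  assumes "length w = n"
  shows "count_list w B = 1 \<longleftrightarrow> (\<exists>k<n. \<forall>i<n. w ! i = B \<longleftrightarrow> i = k)"
proof -
  have "count_list w B = card {i. i < n \<and> w ! i = B}"
    using assms by (simp add: count_list_eq_length_filter length_filter_conv_card eq_commute)
  also have "\<dots> = 1 \<longleftrightarrow> (\<exists>k. {i. i < n \<and> w ! i = B} = {k})" by (simp add: card_1_singleton_iff)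
  also have "\<dots> \<longleftrightarrow> (\<exists>k<n. \<forall>i<n. w ! i = B \<longleftrightarrow> i = k)" by auto
  finally show ?thesis .
qed

lemma single_B_iff:
  assumes "length w = n"
  shows "(\<exists>k. ltr w k = B \<and> (\<forall>i. i mod n \<noteq> k mod n \<longrightarrow> ltr w i = J)) \<longleftrightarrow>
    H \<notin> set w \<and> count_list w B = 1"
proof
  assume "\<exists>k. ltr w k = B \<and> (\<forall>i. i mod n \<noteq> k mod n \<longrightarrow> ltr w i = J)"
  then obtain k where k: "ltr w k = B" "\<forall>i. i mod n \<noteq> k mod n \<longrightarrow> ltr w i = J" by blast
  have 1: "ltr w i = (if i mod n = k mod n then B else J)" for i using k ltr_cong by metis
  then have "\<forall>i<n. w ! i = B \<longleftrightarrow> i = k mod n" by (auto simp: nth_ltr)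
  moreover have "k mod n < n" using n3 by simp
  ultimately have "count_list w B = 1" unfolding count_list_one_iff[OF assms] by blast
  then show "H \<notin> set w \<and> count_list w B = 1" using 1 unfolding set_word[OF assms] by auto
next
  assume "H \<notin> set w \<and> count_list w B = 1"
  then obtain k where k: "k < n" "\<forall>i<n. w ! i = B \<longleftrightarrow> i = k" and nH: "\<forall>i. ltr w i \<noteq> H"
    unfolding count_list_one_iff[OF assms] set_word[OF assms] by blast
  have "ltr w i = B \<longleftrightarrow> i mod n = k" for i using k n3 by (simp add: ltr_def)
  moreover have "ltr w i = B \<or> ltr w i = J" for i using nH by (metis letter.exhaust)
  ultimately show "\<exists>k. ltr w k = B \<and> (\<forall>i. i mod n \<noteq> k mod n \<longrightarrow> ltr w i = J)"
    using k(1) by (intro exI[of _ k]) auto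
qed

lemma all_J_iff:
  assumes "length w = n" shows "(\<forall>i. ltr w i = J) \<longleftrightarrow> w = replicate n J"
proof
  assume "\<forall>i. ltr w i = J"
  then have "w ! i = J" if "i < n" for i using that nth_ltr[of i w] by simp
  then show "w = replicate n J" using assms by (intro nth_equalityI) simp_all
qed (use n3 in \<open>auto simp: ltr_def\<close>)

lemma flat_of_replicate_J: "flat_of (replicate n J) = rim n"
proof -
  have "ltr (replicate n J) i = J" for i using n3 by (simp add: ltr_def)
  then show ?thesis unfolding flat_of_def rim_eq by auto
qed

lemma flat_of_flat_words:
  assumes "w \<in> flat_words g"
  shows "flat_of w \<in> flats (W g)"
    and "rank_of (W g) (flat_of w) = (if w = replicate n J then n - 1 else length (filter (\<lambda>x. x \<noteq> B) w))"
proof -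
  have l: "length w = n" and v: "cyc_valid w" using assms by (auto simp: flat_words_def cyc_valid_def)
  have "flat_of w \<in> flats (W g) \<and>
    rank_of (W g) (flat_of w) = (if w = replicate n J then n - 1 else length (filter (\<lambda>x. x \<noteq> B) w))"
  proof (cases "w = replicate n J")
    case True
    then have "\<not> g" using assms by (auto simp: flat_words_def)
    then show ?thesis using rim_flat True by (simp add: flat_of_replicate_J)
  next
    case False
    then have nJ: "\<exists>i. ltr w i \<noteq> J" using all_J_iff[OF l] by blast
    have nB: "\<not> g \<Longrightarrow> \<nexists>k. ltr w k = B \<and> (\<forall>i. i mod n \<noteq> k mod n \<longrightarrow> ltr w i = J)"
      using assms unfolding single_B_iff[OF l] by (auto simp: flat_words_def)
    show ?thesis using flat_of_flat[OF v nJ nB] False by simp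
  qed
  then show "flat_of w \<in> flats (W g)"
    "rank_of (W g) (flat_of w) = (if w = replicate n J then n - 1 else length (filter (\<lambda>x. x \<noteq> B) w))"
    by blast+
qed

text \<open>The triangles make the word read off from \<open>F\<close> valid. That it is not an
  excluded one is closedness again: in the whirl the rim spans every spoke, in the wheel the rim
  minus an edge spans that edge.\<close>

lemma flat_word_exists:
  assumes F: "F \<in> flats (W g)"
  shows "\<exists>w \<in> flat_words g. flat_of w = F"
proof -
  interpret M: matroid "W g" by (rule matroid_W)
  note tri = flat_triangle[OF F]
  have FE: "F \<subseteq> E" using M.flat_ground[OF F] by simp
  define c where "c i = (if sp i \<in> F then H else if rm (i + n - 1) \<in> F then J else B)" for i
  define w where "w = map c [0..<n]"
  have l: "length w = n" by (simp add: w_def)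
  have cmod: "c (i mod n) = c i" for i
  proof -
    have "(i mod n + (n - 1)) mod n = (i + (n - 1)) mod n" by (simp add: mod_add_left_eq)
    then have "rm (i mod n + n - 1) = rm (i + n - 1)" using n3 by simp
    then show ?thesis by (simp only: c_def sp_mod)
  qed
  have ltr: "ltr w i = c i" for i
  proof -
    have "i mod n < n" using n3 by simp
    then have "ltr w i = c (i mod n)" by (simp add: ltr_def w_def)
    then show ?thesis using cmod by simp
  qed
  have cS: "c (Suc i) = (if sp (Suc i) \<in> F then H else if rm i \<in> F then J else B)" for i
  proof -
    have "rm (Suc i + n - 1) = rm i" by simp
    then show ?thesis by (simp only: c_def)
  qed
  have cH: "c i = H \<longleftrightarrow> sp i \<in> F" for i by (simp add: c_def)
  have cJ: "c (Suc i) = J \<longleftrightarrow> sp (Suc i) \<notin> F \<and> rm i \<in> F" for i by (simp add: cS)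
  have v: "cyc_valid w" unfolding cyc_valid_def ltr cH cJ using l tri(1) by blast
  have F_eq: "flat_of w = F"
  proof (rule subset_antisym)
    show "flat_of w \<subseteq> F" unfolding E_subset_iff[OF flat_of_E] sp_flat_of rm_flat_of ltr cH cJ
      using tri(3) by blast
    show "F \<subseteq> flat_of w" unfolding E_subset_iff[OF FE] sp_flat_of rm_flat_of ltr cH cJ
      using tri(2) by blast
  qed
  have "w \<noteq> replicate n J" if g
  proof
    assume "w = replicate n J"
    then have Fr: "F = rim n" using F_eq flat_of_replicate_J by simp
    have "sp 0 \<in> F"
    proof (rule M.flat_closed[OF F])
      show "rim n \<in> indeps (W g)" using that no_arc_rim rim_E by (simp add: indep_def)
      have "1 \<le> n \<and> n \<le> n \<and> sp 0 \<in> insert (sp 0) (rim n) \<and> sp (0 + n) \<in> insert (sp 0) (rim n) \<and>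
          (\<forall>j<n. rm (0 + j) \<in> insert (sp 0) (rim n))" using n3 by (auto simp: rim_eq)
      then have "has_arc n (insert (sp 0) (rim n))" unfolding has_arc_def by blast
      then show "insert (sp 0) (rim n) \<notin> indeps (W g)" by (simp add: indep_def)
    qed (use Fr in auto)
    then show False using Fr by (auto simp: rim_eq)
  qed
  moreover have "H \<in> set w \<or> count_list w B \<noteq> 1" if "\<not> g"
  proof (rule ccontr)
    assume "\<not> ?thesis"
    then obtain k where k: "ltr w k = B" "\<forall>i. i mod n \<noteq> k mod n \<longrightarrow> ltr w i = J"
      using single_B_iff[OF l] by blast
    let ?e = "rm (k + n - 1)"
    have "?e \<in> F"
    proof (rule M.flat_closed[OF F])
      show "rim n - {?e} \<in> indeps (W g)" using rim_minus_indep by simp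
      show "rim n - {?e} \<subseteq> F"
      proof
        fix x assume x: "x \<in> rim n - {?e}"
        then obtain i where i: "x = rm i" by (auto simp: rim_eq)
        have "Suc i mod n \<noteq> k mod n"
        proof
          assume "Suc i mod n = k mod n"
          then have "Suc i mod n = Suc (k + n - 1) mod n" using n3 by simp
          then have "i mod n = (k + n - 1) mod n" using n3 by (subst (asm) Suc_mod_eq_iff) auto
          then show False using x i by simp
        qed
        then have "ltr w (Suc i) = J" using k by simp
        then have "rm i \<in> flat_of w" by simp
        then show "x \<in> F" using i F_eq by simp
      qed
      have "insert ?e (rim n - {?e}) = rim n" by (auto simp: rim_eq)
      then show "insert ?e (rim n - {?e}) \<notin> indeps (W g)" using that by (simp add: indep_def)
      show "?e \<in> ground (W g)" by simp
    qed
    then have "?e \<in> flat_of w" using F_eq by simp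
    then show False using k unfolding rm_flat_of ltr_pred by simp
  qed
  ultimately have "w \<in> flat_words g" using v by (simp add: flat_words_def)
  then show ?thesis using F_eq by blast
qed

lemma flat_of_bij: "bij_betw flat_of (flat_words g) (flats (W g))"
proof (rule bij_betw_imageI)
  show "inj_on flat_of (flat_words g)"
  proof (rule inj_onI)
    fix w w' assume a: "w \<in> flat_words g" "w' \<in> flat_words g" "flat_of w = flat_of w'"
    then have "length w = n" "length w' = n" by (auto simp: flat_words_def cyc_valid_def)
    then show "w = w'" using cyc_le_antisym[of w w'] flat_of_subset_iff a(3) by blast
  qed
  show "flat_of ` flat_words g = flats (W g)"
    using flat_of_flat_words(1) flat_word_exists by blast
qed

lemma rk_W: "rk (W g) = n"
proof -
  have "cyc_valid (replicate n H)" using n3 by (simp add: cyc_valid_def ltr_def)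
  then have w: "replicate n H \<in> flat_words g" using n3 by (auto simp: flat_words_def set_replicate_conv_if
    intro!: exI simp: replicate_eq_replicate)
  have "ltr (replicate n H) i = H" for i using n3 by (simp add: ltr_def)
  then have "flat_of (replicate n H) = E" unfolding flat_of_def E_eq by auto
  then show ?thesis using flat_of_flat_words(2)[OF w] n3 by (simp add: rk_def replicate_eq_replicate)
qed

end

section \<open>Generating functions\<close>

unbundle fps_syntax

abbreviation t :: "int poly" where "t \<equiv> [:0, 1:]"
abbreviation T :: "int poly fps" where "T \<equiv> fps_const t"

text \<open>Motzkin polynomials, t marking the up steps, with the index raised by one so that
  \<open>qh\<close> has no constant term.\<close>

fun motzkin :: "nat \<Rightarrow> int poly" where
  "motzkin 0 = 0"
| "motzkin (Suc n) = (if n = 0 then 1 else 0) + motzkin n + t * (\<Sum>i\<le>n. motzkin i * motzkin (n - i))"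

definition qh :: "int poly fps" where "qh = Abs_fps motzkin"

lemma fps_sq_nth: "(f * f :: 'a::comm_semiring_1 fps) $ n = (\<Sum>i\<le>n. f $ i * f $ (n - i))"
  by (simp add: fps_mult_nth atLeast0AtMost)

lemma qh_eq: "qh = fps_X * (1 + qh + T * (qh * qh))"
proof (rule fps_ext)
  fix n show "qh $ n = (fps_X * (1 + qh + T * (qh * qh))) $ n"
    by (cases n) (simp_all add: qh_def fps_sq_nth)
qed

lemma qh_0: "qh $ 0 = 0" by (simp add: qh_def)

text \<open>With \<open>c = 1\<close> this is the Kazhdan--Lusztig bound 2 deg < m. Offsets add
  under multiplication and a factor t costs 2, which reduces degree estimates to bookkeeping. Zero
  coefficients are exempt because their degree counts as 0.\<close>

definition half_degree :: "nat \<Rightarrow> int poly fps \<Rightarrow> bool" where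
  "half_degree c f \<longleftrightarrow> (\<forall>m. f $ m \<noteq> 0 \<longrightarrow> 2 * degree (f $ m) + c \<le> m)"

lemma half_degree_poly_sum:
  assumes "finite A" "\<And>x. x \<in> A \<Longrightarrow> f x \<noteq> 0 \<Longrightarrow> 2 * degree (f x) + c \<le> m" "(\<Sum>x\<in>A. f x) \<noteq> (0 :: int poly)"
  shows "2 * degree (\<Sum>x\<in>A. f x) + c \<le> m"
proof -
  obtain y where y: "y \<in> A" "f y \<noteq> 0" using assms(3) by (meson sum.neutral)
  have "degree (f x) \<le> (m - c) div 2" if "x \<in> A" for x
    using assms(2)[OF that] by (cases "f x = 0") auto
  then have "degree (\<Sum>x\<in>A. f x) \<le> (m - c) div 2" using assms(1) by (intro degree_sum_le) auto
  then show ?thesis using assms(2)[OF y] by linarith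
qed

lemma half_degree_poly_mult:
  assumes "f \<noteq> 0 \<Longrightarrow> 2 * degree f + c \<le> m" "g \<noteq> 0 \<Longrightarrow> 2 * degree g + d \<le> k" "f * g \<noteq> (0 :: int poly)"
  shows "2 * degree (f * g) + (c + d) \<le> m + k"
  using assms by (auto simp: degree_mult_eq)

lemma half_degree_add: "half_degree c f \<Longrightarrow> half_degree c g \<Longrightarrow> half_degree c (f + g)"
  unfolding half_degree_def
proof (intro allI impI)
  fix m assume a: "\<forall>m. f $ m \<noteq> 0 \<longrightarrow> 2 * degree (f $ m) + c \<le> m"
    "\<forall>m. g $ m \<noteq> 0 \<longrightarrow> 2 * degree (g $ m) + c \<le> m" "(f + g) $ m \<noteq> 0"
  have "2 * degree (\<Sum>b\<in>{True, False}. (if b then f else g) $ m) + c \<le> m"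
    using a by (intro half_degree_poly_sum) auto
  then show "2 * degree ((f + g) $ m) + c \<le> m" by simp
qed

lemma half_degree_mult:
  assumes "half_degree c f" "half_degree d g" shows "half_degree (c + d) (f * g)"
  unfolding half_degree_def
proof (intro allI impI)
  fix m assume "(f * g) $ m \<noteq> 0"
  then show "2 * degree ((f * g) $ m) + (c + d) \<le> m"
    unfolding fps_mult_nth
  proof (intro half_degree_poly_sum)
    fix i assume i: "i \<in> {0..m}" and nz: "f $ i * g $ (m - i) \<noteq> 0"
    have "2 * degree (f $ i * g $ (m - i)) + (c + d) \<le> i + (m - i)"
      using assms nz unfolding half_degree_def by (intro half_degree_poly_mult) auto
    then show "2 * degree (f $ i * g $ (m - i)) + (c + d) \<le> m" using i by simp
  qed auto
qed

lemma half_degree_T: "half_degree (c + 2) f \<Longrightarrow> half_degree c (T * f)"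
  unfolding half_degree_def by (auto simp: degree_mult_eq)

lemma half_degree_X: "half_degree 1 fps_X"
  by (auto simp: half_degree_def fps_X_def)

lemma half_degree_mono: "half_degree c f \<Longrightarrow> d \<le> c \<Longrightarrow> half_degree d f"
  by (fastforce simp: half_degree_def)

text \<open>The constant term 1 of the divisor allows solving for \<open>g\<close> coefficient by
  coefficient, and each step respects the bound.\<close>

lemma half_degree_quotient:
  assumes f: "half_degree 0 f" "f $ 0 = 1" and h: "half_degree c h" and eq: "g * f = h"
  shows "half_degree c g"
  unfolding half_degree_def
proof
  fix m show "g $ m \<noteq> 0 \<longrightarrow> 2 * degree (g $ m) + c \<le> m"
  proof (induction m rule: less_induct)
    case (less m)
    have "h $ m = (\<Sum>i=0..m. g $ i * f $ (m - i))" by (simp add: eq[symmetric] fps_mult_nth)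
    also have "{0..m} = insert m {..<m}" by auto
    finally have "g $ m = h $ m + (\<Sum>i<m. - (g $ i * f $ (m - i)))" using f(2) by (simp add: sum_negf)
    also have "\<dots> = (\<Sum>i\<in>insert m {..<m}. if i = m then h $ m else - (g $ i * f $ (m - i)))"
      by (subst sum.insert) (auto intro!: sum.cong)
    finally have gm: "g $ m = (\<Sum>i\<in>insert m {..<m}. if i = m then h $ m else - (g $ i * f $ (m - i)))" .
    show ?case unfolding gm
    proof (intro impI half_degree_poly_sum)
      fix i assume i: "i \<in> insert m {..<m}"
        and nz: "(if i = m then h $ m else - (g $ i * f $ (m - i))) \<noteq> 0"
      show "2 * degree (if i = m then h $ m else - (g $ i * f $ (m - i))) + c \<le> m"
      proof (cases "i = m")
        case True then show ?thesis using h nz by (auto simp: half_degree_def)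
      next
        case False
        then have "i < m" using i by simp
        then have "2 * degree (g $ i * f $ (m - i)) + (c + 0) \<le> i + (m - i)"
          using less[OF \<open>i < m\<close>] f(1) nz False unfolding half_degree_def
          by (intro half_degree_poly_mult) auto
        then show ?thesis using False \<open>i < m\<close> by simp
      qed
    qed auto
  qed
qed

lemma half_degree_qh: "half_degree 1 qh"
proof -
  have "motzkin m \<noteq> 0 \<longrightarrow> 2 * degree (motzkin m) + 1 \<le> m" for m
  proof (induction m rule: less_induct)
    case (less m)
    show ?case
    proof (cases m)
      case (Suc n)
      have eq: "motzkin m = (\<Sum>j\<in>{0,1,2::nat}. if j = 0 then (if n = 0 then 1 else 0) else if j = 1 then motzkin n
         else t * (\<Sum>i\<le>n. motzkin i * motzkin (n - i)))" using Suc by simp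
      show ?thesis unfolding eq
      proof (intro impI half_degree_poly_sum)
        fix j :: nat assume j: "j \<in> {0,1,2}" and nz: "(if j = 0 then (if n = 0 then 1 else 0) else if j = 1 then motzkin n
         else t * (\<Sum>i\<le>n. motzkin i * motzkin (n - i))) \<noteq> 0"
        let ?S = "\<Sum>i\<le>n. motzkin i * motzkin (n - i)"
        have S: "2 * degree ?S + (1 + 1) \<le> n" if "?S \<noteq> 0"
        proof (rule half_degree_poly_sum[OF _ _ that])
          fix i assume "i \<in> {..n}" "motzkin i * motzkin (n - i) \<noteq> 0"
          moreover from this have "2 * degree (motzkin i * motzkin (n - i)) + (1 + 1) \<le> i + (n - i)"
            using less Suc by (intro half_degree_poly_mult) auto
          ultimately show "2 * degree (motzkin i * motzkin (n - i)) + (1 + 1) \<le> n" by simp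
        qed simp
        from j consider "j = 0" | "j = 1" | "j = 2" by auto
        then show "2 * degree (if j = 0 then (if n = 0 then 1 else 0) else if j = 1 then motzkin n
         else t * ?S) + 1 \<le> m"
        proof cases
          case 1 then show ?thesis using nz Suc by (auto split: if_splits)
        next
          case 2 then show ?thesis using nz less[of n] Suc by auto
        next
          case 3
          then have "?S \<noteq> 0" using nz by auto
          then show ?thesis using S 3 Suc by (simp add: degree_mult_eq)
        qed
      qed auto
    qed simp
  qed
  then show ?thesis by (simp add: half_degree_def qh_def)
qed

lemma fps_quotient_exists:
  fixes f h :: "'a::comm_ring_1 fps"
  assumes "f $ 0 = 1" shows "\<exists>g. g * f = h"
proof -
  have "f * fps_right_inverse f 1 = 1" using assms by (intro fps_right_inverse) simp
  then have "(h * fps_right_inverse f 1) * f = h" by (metis mult.assoc mult.commute mult.right_neutral)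
  then show ?thesis by blast
qed

text \<open>The quotient x h' / (1 + h), chosen as a solution because the coefficient ring has no
  division; the constant term 1 of the divisor gives existence.\<close>

definition whirl_series :: "int poly fps" where
  "whirl_series = (SOME g. g * (1 + qh) = fps_X * fps_deriv qh)"

lemma whirl_series: "whirl_series * (1 + qh) = fps_X * fps_deriv qh"
  unfolding whirl_series_def by (rule someI_ex, rule fps_quotient_exists) (simp add: qh_0)

lemma half_degree_X_deriv: "half_degree c f \<Longrightarrow> half_degree c (fps_X * fps_deriv f)"
  unfolding half_degree_def
proof (intro allI impI)
  fix m assume a: "\<forall>m. f $ m \<noteq> 0 \<longrightarrow> 2 * degree (f $ m) + c \<le> m" "(fps_X * fps_deriv f) $ m \<noteq> 0"
  have e: "(fps_X * fps_deriv f) $ m = of_nat m * f $ m" by (cases m) auto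
  then have "f $ m \<noteq> 0" "m \<noteq> 0" using a(2) by auto
  then show "2 * degree ((fps_X * fps_deriv f) $ m) + c \<le> m"
    using a(1) unfolding e by (simp add: of_nat_poly)
qed

lemma half_degree_1_qh: "half_degree 0 (1 + qh)"
  using half_degree_qh by (intro half_degree_add half_degree_mono[OF half_degree_qh]) (auto simp: half_degree_def)

lemma half_degree_whirl: "half_degree 1 whirl_series"
  using half_degree_1_qh _ half_degree_X_deriv[OF half_degree_qh] whirl_series
  by (rule half_degree_quotient) (simp add: qh_0)

text \<open>\<open>defect_series\<close> is the difference of the whirl and wheel Kazhdan--Lusztig polynomials, written
  so that its degree bound is visible; \<open>defect_series_eq\<close> is the equation it solves.\<close>

definition defect_aux :: "int poly fps" where
  "defect_aux = (SOME g. g * (1 - T * (fps_X * qh)) = fps_X * qh)"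

lemma defect_aux: "defect_aux * (1 - T * (fps_X * qh)) = fps_X * qh"
  unfolding defect_aux_def by (rule someI_ex, rule fps_quotient_exists) simp

definition defect_series :: "int poly fps" where
  "defect_series = fps_X + T * (defect_aux * (qh + fps_X))"

lemma half_degree_defect: "half_degree 1 defect_series"
proof -
  have 2: "half_degree (1 + 1) (fps_X * qh)" using half_degree_X half_degree_qh by (rule half_degree_mult)
  have m: "half_degree 0 (- (T * (fps_X * qh)))"
    using half_degree_T[of 0 "fps_X * qh"] 2 by (simp add: half_degree_def)
  have "half_degree 0 (1 + - (T * (fps_X * qh)))" using m by (rule half_degree_add[rotated]) (simp add: half_degree_def)
  then have "half_degree 0 (1 - T * (fps_X * qh))" by simp
  from half_degree_quotient[OF this _ 2 defect_aux] have e: "half_degree (1 + 1) defect_aux" by simp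
  have "half_degree ((1 + 1) + 1) (defect_aux * (qh + fps_X))"
    using half_degree_mult[OF e half_degree_add[OF half_degree_qh half_degree_X]] .
  then have "half_degree 1 (T * (defect_aux * (qh + fps_X)))" by (intro half_degree_T) simp
  then show ?thesis unfolding defect_series_def using half_degree_X by (rule half_degree_add[rotated])
qed

text \<open>The auxiliary quotient equals (h - x) / (1 + t x), so its product with h + x is a
  difference of squares. Dividing by 1 + t x directly would hide the degree bound, which t x
  violates.\<close>

lemma defect_series_eq: "(1 + T * fps_X) * defect_series = T * (qh * qh) + fps_X"
proof -
  let ?u = "1 - T * (fps_X * qh)"
  have "?u $ 0 = 1" by simp
  then have u: "?u \<noteq> 0" by (metis fps_zero_nth zero_neq_one)
  have "?u * ((1 + T * fps_X) * defect_aux) = ?u * (qh - fps_X)"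
    using defect_aux qh_eq by algebra
  then have "(1 + T * fps_X) * defect_aux = qh - fps_X" using u by simp
  then show ?thesis unfolding defect_series_def by algebra
qed

section \<open>The substitution x / (1 - t x) and the Narayana series\<close>

definition G :: "int poly fps" where "G = Abs_fps (\<lambda>n. t ^ n)"
definition U :: "int poly fps" where "U = fps_X * G"

lemma G_eq: "(1 - T * fps_X) * G = 1"
proof (rule fps_ext)
  fix n show "((1 - T * fps_X) * G) $ n = (1 :: int poly fps) $ n"
    by (cases n) (simp_all add: G_def left_diff_distrib mult.assoc)
qed

lemma U_0 [simp]: "U $ 0 = 0" by (simp add: U_def)

lemma U_nth_Suc: "U $ Suc m = t ^ m" by (simp add: U_def G_def)

lemma U_eq: "(1 - T * fps_X) * U = fps_X" using G_eq unfolding U_def by algebra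

lemma one_TX_nz: "1 - T * fps_X \<noteq> 0" using G_eq by auto

lemma T_U: "1 + T * U = G"
proof -
  have "(1 - T * fps_X) * (1 + T * U) = 1 - T * fps_X + T * ((1 - T * fps_X) * U)" by algebra
  then have "(1 - T * fps_X) * (1 + T * U) = (1 - T * fps_X) * G" unfolding U_eq G_eq by simp
  then show ?thesis using one_TX_nz by simp
qed

text \<open>Substituting \<open>U = x / (1 - t x)\<close> accounts for merging consecutive vertices into blocks: \<open>m\<close>
  vertices form \<open>k\<close> consecutive blocks in \<open>(m - 1) choose (k - 1)\<close> ways, each of rank \<open>m - k\<close>.
  The coefficients of \<open>q\<close> are the Narayana polynomials.\<close>

definition q :: "int poly fps" where "q = qh oo U"

lemma q_U: "q = U * (1 + q + T * (q * q))"
proof -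
  have "q = (fps_X * (1 + qh + T * (qh * qh))) oo U" unfolding q_def by (subst (1) qh_eq) simp
  also have "\<dots> = U * (1 + q + T * (q * q))"
    by (simp add: fps_compose_mult_distrib fps_compose_add_distrib q_def)
  finally show ?thesis .
qed

text \<open>Clearing the denominator of \<open>U\<close> raises the middle coefficient of 1 + q + t
  q^2 to 1 + t, which makes the quadratic factor.\<close>

lemma q_eq: "q = fps_X * (1 + q) * (1 + T * q)"
  using q_U U_eq by algebra

lemma q_0 [simp]: "q $ 0 = 0" by (simp add: q_def qh_0)

lemma q_Suc: "q $ Suc n = (if n = 0 then 1 else 0) + (1 + t) * q $ n + t * (\<Sum>i\<le>n. q $ i * q $ (n - i))"
proof -
  have "q = fps_X * (1 + (1 + T) * q + T * (q * q))" using q_eq by algebra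
  then have "q $ Suc n = (fps_X * (1 + (1 + T) * q + T * (q * q))) $ Suc n" by simp
  then show ?thesis by (simp add: fps_sq_nth distrib_right add.assoc)
qed

lemma q_1 [simp]: "q $ Suc 0 = 1" by (simp add: q_Suc)

text \<open>By \<open>\<beta>_q\<close>, \<open>\<beta>\<close> is the logarithmic derivative \<open>x q' / q\<close>.\<close>

definition \<beta> :: "int poly fps" where
  "\<beta> = (SOME g. g * ((1 + q) * (1 + T * q)) = fps_deriv q)"

lemma \<beta>': "\<beta> * ((1 + q) * (1 + T * q)) = fps_deriv q"
  unfolding \<beta>_def by (rule someI_ex, rule fps_quotient_exists) simp

lemma \<beta>_q: "\<beta> * q = fps_X * fps_deriv q"
proof -
  have "\<beta> * q = fps_X * (\<beta> * ((1 + q) * (1 + T * q)))"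
    by (subst (1) q_eq) (simp add: ac_simps)
  then show ?thesis unfolding \<beta>' .
qed

section \<open>Series for the weighted counts of runs\<close>

definition shift :: "(nat \<Rightarrow> int poly) \<Rightarrow> nat \<Rightarrow> int poly fps" where
  "shift f s = Abs_fps (\<lambda>k. f (s + k))"

lemma shift_eq: "shift f s = fps_const (f s) + fps_X * shift f (Suc s)"
proof (rule fps_ext)
  fix n show "shift f s $ n = (fps_const (f s) + fps_X * shift f (Suc s)) $ n"
    by (cases n) (simp_all add: shift_def)
qed

text \<open>The weight k + 1 counts the places where a run of k further blocks can be split in two;
  such splits arise in \<open>sum_KT_series\<close>.\<close>

definition shift2 :: "(nat \<Rightarrow> int poly) \<Rightarrow> nat \<Rightarrow> int poly fps" where
  "shift2 f s = Abs_fps (\<lambda>k. of_nat (Suc k) * f (s + k))"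

lemma shift2_eq: "shift2 f s = shift f s + fps_X * shift2 f (Suc s)"
proof (rule fps_ext)
  fix n show "shift2 f s $ n = (shift f s + fps_X * shift2 f (Suc s)) $ n"
    by (cases n) (simp_all add: shift_def shift2_def algebra_simps)
qed

text \<open>The Kazhdan--Lusztig polynomials of fans are the Motzkin polynomials.\<close>

definition fan_KL :: "nat \<Rightarrow> int poly" where "fan_KL s = (1 + qh) $ s"

abbreviation "Y s \<equiv> shift fan_KL s oo U"
abbreviation "Y2 s \<equiv> shift2 fan_KL s oo U"

lemma fan_KL_0 [simp]: "fan_KL 0 = 1" by (simp add: fan_KL_def qh_0)

lemma Y_eq: "Y s = fps_const (fan_KL s) + U * Y (Suc s)"
  by (subst shift_eq) (simp add: fps_compose_mult_distrib fps_compose_add_distrib)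

lemma Y2_eq: "Y2 s = Y s + U * Y2 (Suc s)"
  by (subst shift2_eq) (simp add: fps_compose_mult_distrib fps_compose_add_distrib)

lemma Y_0: "Y 0 = 1 + q"
proof -
  have "shift fan_KL 0 = 1 + qh" by (rule fps_ext) (simp add: shift_def fan_KL_def)
  then show ?thesis by (simp add: fps_compose_add_distrib q_def)
qed

text \<open>The chain rule, with 1 / (1 - t x)^2 as the derivative of \<open>U\<close>.\<close>

lemma X_deriv_q: "fps_X * fps_deriv q = G * (U * (fps_deriv qh oo U))"
proof -
  have "fps_deriv U = G * G"
  proof -
    have "fps_deriv ((1 - T * fps_X) * U) = 1" by (simp add: U_eq)
    then have "(1 - T * fps_X) * fps_deriv U = 1 + T * U" by (simp add: algebra_simps)
    then have "(1 - T * fps_X) * fps_deriv U = (1 - T * fps_X) * (G * G)" using T_U G_eq by algebra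
    then show ?thesis using one_TX_nz by simp
  qed
  then have "fps_deriv q = (fps_deriv qh oo U) * (G * G)" by (simp add: q_def fps_compose_deriv)
  then show ?thesis unfolding U_def by (simp add: ac_simps)
qed

lemma Y2_1: "G * (U * Y2 1) = fps_X * fps_deriv q"
proof -
  have "fps_X * shift2 fan_KL 1 = fps_X * fps_deriv qh"
  proof (rule fps_ext)
    fix n show "(fps_X * shift2 fan_KL 1) $ n = (fps_X * fps_deriv qh) $ n"
      by (cases n) (simp_all add: shift2_def fan_KL_def qh_def)
  qed
  then have "shift2 fan_KL 1 = fps_deriv qh" by simp
  then show ?thesis by (simp add: X_deriv_q)
qed

text \<open>Weighted counts of the ways to turn a row of blocks into runs separated by hub vertices, where
  \<open>s\<close> blocks of the current run have been read: \<open>KT s m i\<close> for \<open>m\<close> further blocks followed by \<open>i\<close>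
  blocks not allowed to join the hub, and \<open>KV f k m\<close> when no block joins the hub.\<close>

fun KN :: "nat \<Rightarrow> nat \<Rightarrow> int poly" where
  "KN s 0 = fan_KL s"
| "KN s (Suc i) = KN (Suc s) i + (if s > 0 then t * KN s i else 0)"

fun KT :: "nat \<Rightarrow> nat \<Rightarrow> nat \<Rightarrow> int poly" where
  "KT s 0 i = KN s i"
| "KT s (Suc m) i = t * fan_KL s * KT 0 m i + KT (Suc s) m i + (if s > 0 then t * KT s m i else 0)"

fun KV :: "(nat \<Rightarrow> int poly) \<Rightarrow> nat \<Rightarrow> nat \<Rightarrow> int poly" where
  "KV f k 0 = f k"
| "KV f k (Suc m) = KV f (Suc k) m + t * KV f k m"

text \<open>\<open>KV f k m\<close> is the binomial transform, the sum of (m choose j) t^(m - j) f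
  (k + j). On generating functions this is composition with \<open>U\<close> followed by the factor
  \<open>G\<close>.\<close>

lemma KV_series: "KV f k m = (G * (shift f k oo U)) $ m"
proof (induction m arbitrary: k)
  case 0 then show ?case by (simp add: G_def shift_def)
next
  case (Suc m)
  let ?F = "\<lambda>k. G * (shift f k oo U)"
  have s: "shift f k oo U = fps_const (f k) + U * (shift f (Suc k) oo U)"
    by (subst shift_eq) (simp add: fps_compose_mult_distrib fps_compose_add_distrib)
  have "(1 - T * fps_X) * ?F k = (1 - T * fps_X) * G * (fps_const (f k) + U * (shift f (Suc k) oo U))"
    by (simp add: s ac_simps)
  also have "\<dots> = fps_const (f k) + fps_X * ?F (Suc k)" using G_eq unfolding U_def by algebra
  finally have "?F k = fps_const (f k) + fps_X * (?F (Suc k) + T * ?F k)" by algebra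
  then have "?F k $ Suc m = (fps_const (f k) + fps_X * (?F (Suc k) + T * ?F k)) $ Suc m" by simp
  then show ?case using Suc by simp
qed

lemma KT_series_aux:
  fixes F :: "nat \<Rightarrow> int poly fps"
  assumes "\<And>s. F s = N s + fps_X * (T * fps_const (fan_KL s) * F 0 + F (Suc s) + (if s > 0 then T * F s else 0))"
  shows "F s $ 0 = N s $ 0"
    "F s $ Suc m = N s $ Suc m + t * fan_KL s * F 0 $ m + F (Suc s) $ m + (if s > 0 then t * F s $ m else 0)"
proof -
  show "F s $ 0 = N s $ 0" by (subst assms) simp
  have "F s $ Suc m = (N s + fps_X * (T * fps_const (fan_KL s) * F 0 + F (Suc s) + (if s > 0 then T * F s else 0))) $ Suc m"
    using assms[of s] by simp
  then show "F s $ Suc m = N s $ Suc m + t * fan_KL s * F 0 $ m + F (Suc s) $ m + (if s > 0 then t * F s $ m else 0)"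
    by (simp add: mult.assoc)
qed

text \<open>The series of \<open>KT s m 0\<close> over \<open>m\<close> is guessed as
  \<open>F s\<close> and checked against the recursion, which determines it. The case
  \<open>s = 0\<close> has its own formula because the first block of a run has nothing to merge
  with.\<close>

lemma KT_eq_q: "KT 0 m 0 = q $ Suc m"
proof -
  define F where "F s = (if s = 0 then (1 + q) * (1 + T * q) else G * ((1 + T * q) * Y s))" for s
  have F: "F s = fps_const (fan_KL s) + fps_X * (T * fps_const (fan_KL s) * F 0 + F (Suc s) + (if s > 0 then T * F s else 0))" for s
  proof (cases "s = 0")
    case True
    have "U * Y 1 = q" using Y_eq[of 0] Y_0 by simp
    have "1 + fps_X * (T * ((1 + q) * (1 + T * q)) + G * ((1 + T * q) * Y 1)) =
        1 + T * (fps_X * (1 + q) * (1 + T * q)) + (1 + T * q) * (U * Y 1)" unfolding U_def by algebra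
    also have "\<dots> = (1 + q) * (1 + T * q)" unfolding \<open>U * Y 1 = q\<close> q_eq[symmetric] by algebra
    finally have "(1 + q) * (1 + T * q) = 1 + fps_X * (T * ((1 + q) * (1 + T * q)) + G * ((1 + T * q) * Y 1))" ..
    then show ?thesis using True by (simp add: F_def)
  next
    case False
    have "G * ((1 + T * q) * Y s) = fps_const (fan_KL s) + fps_X * (T * fps_const (fan_KL s) * ((1 + q) * (1 + T * q)) +
       G * ((1 + T * q) * Y (Suc s)) + T * (G * ((1 + T * q) * Y s)))"
      using Y_eq[of s] q_eq G_eq unfolding U_def by algebra
    then show ?thesis using False by (simp add: F_def)
  qed
  have "F s $ m = KT s m 0" for s
  proof (induction m arbitrary: s)
    case 0 then show ?case using KT_series_aux(1)[OF F] by simp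
  next
    case (Suc m) then show ?case using KT_series_aux(2)[OF F, of s m] by simp
  qed
  then have "KT 0 m 0 = ((1 + q) * (1 + T * q)) $ m" by (simp add: F_def flip: \<open>\<And>s. F s $ m = KT s m 0\<close>)
  also have "\<dots> = (fps_X * ((1 + q) * (1 + T * q))) $ Suc m" by simp
  also have "fps_X * ((1 + q) * (1 + T * q)) = q" using q_eq by (simp add: mult.assoc)
  finally show ?thesis .
qed

lemma KN_series: "KN s m = (if s = 0 then 1 + q else G * Y s) $ m"
proof (induction m arbitrary: s)
  case 0
  then show ?case by (simp add: G_def shift_def)
next
  case (Suc m)
  define N where "N s = (if s = 0 then 1 + q else G * Y s)" for s
  have "N s = fps_const (fan_KL s) + fps_X * (N (Suc s) + (if s > 0 then T * N s else 0))"
  proof (cases "s = 0")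
    case True
    have "U * Y 1 = q" using Y_eq[of 0] Y_0 by simp
    then show ?thesis using True by (simp add: N_def U_def mult.assoc)
  next
    case False
    have "G * Y s = fps_const (fan_KL s) + fps_X * (G * Y (Suc s) + T * (G * Y s))"
      using Y_eq[of s] G_eq unfolding U_def by algebra
    then show ?thesis using False by (simp add: N_def)
  qed
  then have "N s $ Suc m = (fps_const (fan_KL s) + fps_X * (N (Suc s) + (if s > 0 then T * N s else 0))) $ Suc m"
    by simp
  then show ?case using Suc[of s] Suc[of "Suc s"] by (simp add: N_def)
qed

text \<open>The row is split at every place into a free part and a part barred from the hub. The
  guess \<open>F\<close> adds two cases: the split falls into the current run, counted by
  \<open>Y2\<close>, or the run ends earlier at a hub vertex, after which \<open>J0\<close> starts
  afresh.\<close>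

lemma sum_KT_series:
  "(\<Sum>i\<le>L. KT 0 (L - i) i) = ((1 + q + fps_X * fps_deriv q) * (1 + T * q)) $ L"
proof -
  define J0 where "J0 = (1 + q + fps_X * fps_deriv q) * (1 + T * q)"
  define N where "N s = (if s = 0 then 1 + q else G * Y s)" for s
  define F where "F s = (if s = 0 then J0 else G * (G * Y2 s) + U * (T * J0 * Y s))" for s
  have J0: "J0 = 1 + q + fps_X * fps_deriv q + fps_X * (T * ((1 + q) * J0))"
    unfolding J0_def using q_eq by algebra
  have F: "F s = N s + fps_X * (T * fps_const (fan_KL s) * F 0 + F (Suc s) + (if s > 0 then T * F s else 0))" for s
  proof (cases "s = 0")
    case True
    have "U * Y 1 = q" using Y_eq[of 0] Y_0 by simp
    have "1 + q + fps_X * (T * J0 + (G * (G * Y2 1) + U * (T * J0 * Y 1))) =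
        1 + q + fps_X * T * J0 + G * (U * Y2 1) + fps_X * T * J0 * (U * Y 1)" unfolding U_def by algebra
    also have "\<dots> = 1 + q + fps_X * fps_deriv q + fps_X * (T * ((1 + q) * J0))"
      unfolding Y2_1 \<open>U * Y 1 = q\<close> by algebra
    finally have "J0 = 1 + q + fps_X * (T * J0 + (G * (G * Y2 1) + U * (T * J0 * Y 1)))"
      using J0 by simp
    then show ?thesis using True by (simp add: F_def N_def)
  next
    case False
    have "G * (G * Y2 s) + U * (T * J0 * Y s) = G * Y s + fps_X * (T * fps_const (fan_KL s) * J0 +
       (G * (G * Y2 (Suc s)) + U * (T * J0 * Y (Suc s))) + T * (G * (G * Y2 s) + U * (T * J0 * Y s)))"
      using Y_eq[of s] Y2_eq[of s] G_eq unfolding U_def by algebra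
    then show ?thesis using False by (simp add: F_def N_def)
  qed
  have "F s $ L = (\<Sum>i\<le>L. KT s (L - i) i)" for s
  proof (induction L arbitrary: s)
    case 0
    have "N s $ 0 = fan_KL s" using KN_series[of s 0] by (simp add: N_def)
    then show ?case using KT_series_aux(1)[OF F] by simp
  next
    case (Suc L)
    have "(\<Sum>i\<le>Suc L. KT s (Suc L - i) i) = (\<Sum>i\<le>L. KT s (Suc (L - i)) i) + KN s (Suc L)"
      by (simp add: Suc_diff_le)
    also have "\<dots> = t * fan_KL s * F 0 $ L + F (Suc s) $ L + (if s > 0 then t * F s $ L else 0) + N s $ Suc L"
      unfolding Suc KN_series by (simp add: sum.distrib sum_distrib_left N_def)
    finally show ?case using KT_series_aux(2)[OF F, of s L] by simp
  qed
  from this[of 0] show ?thesis by (simp add: F_def J0_def)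
qed

definition whirl_KL :: "nat \<Rightarrow> int poly" where "whirl_KL m = whirl_series $ m"
definition defect_KL :: "nat \<Rightarrow> int poly" where "defect_KL m = defect_series $ m"

lemma KV_whirl: "KV whirl_KL 0 m = (G * (whirl_series oo U)) $ m"
proof -
  have "shift whirl_KL 0 = whirl_series" by (rule fps_ext) (simp add: shift_def whirl_KL_def)
  then show ?thesis by (simp add: KV_series)
qed

text \<open>\<open>G\<close> is 1 + t x evaluated at \<open>U\<close>, so the denominator of the
  defect series cancels. The summand t^(m - 1) is matched later by the rim.\<close>

lemma KV_defect: "m > 0 \<Longrightarrow> KV defect_KL 0 m = (T * (q * q)) $ m + t ^ (m - 1)"
proof -
  assume m: "m > 0"
  have "shift defect_KL 0 = defect_series" by (rule fps_ext) (simp add: shift_def defect_KL_def)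
  then have "KV defect_KL 0 m = (G * (defect_series oo U)) $ m" by (simp add: KV_series)
  also have "G * (defect_series oo U) = ((1 + T * fps_X) * defect_series) oo U"
    by (simp add: fps_compose_mult_distrib fps_compose_add_distrib T_U[symmetric])
  also have "\<dots> = T * (q * q) + U"
    unfolding defect_series_eq by (simp add: fps_compose_mult_distrib fps_compose_add_distrib q_def)
  finally show ?thesis using m U_nth_Suc[of "m - 1"] by simp
qed

text \<open>Words without hub contribute V with V (1 + q) = x q', those with hub t x
  \<open>J0\<close>. Their sum plus 1 satisfies the defining equation of \<open>\<beta>\<close>; the
  1 affects only degree 0, hence \<open>m > 0\<close>.\<close>

lemma whirl_sum_eq: "m > 0 \<Longrightarrow> KV whirl_KL 0 m + t * (\<Sum>j<m. KT 0 (m - 1 - j) j) = \<beta> $ m"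
proof -
  assume m: "m > 0"
  define J0 where "J0 = (1 + q + fps_X * fps_deriv q) * (1 + T * q)"
  define V where "V = G * (whirl_series oo U)"
  have V: "V * (1 + q) = fps_X * fps_deriv q"
  proof -
    have "(whirl_series * (1 + qh)) oo U = (fps_X * fps_deriv qh) oo U" by (simp add: whirl_series)
    then have "(whirl_series oo U) * (1 + q) = U * (fps_deriv qh oo U)"
      by (simp add: fps_compose_mult_distrib fps_compose_add_distrib q_def)
    then show ?thesis unfolding V_def X_deriv_q by algebra
  qed
  have d: "fps_deriv q = (1 + q) * (1 + T * q) + fps_X * fps_deriv q * (1 + T * q) + fps_X * (1 + q) * (T * fps_deriv q)"
  proof -
    have "fps_deriv q = fps_deriv (fps_X * (1 + q) * (1 + T * q))" using q_eq by simp
    then show ?thesis by (simp add: algebra_simps)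
  qed
  have nz: "1 + q \<noteq> 0" "1 + T * q \<noteq> 0"
  proof -
    have "(1 + q) $ 0 \<noteq> 0" "(1 + T * q) $ 0 \<noteq> 0" by simp_all
    then show "1 + q \<noteq> 0" "1 + T * q \<noteq> 0" by (metis fps_zero_nth)+
  qed
  have "(1 + T * q) * ((1 + q) * (V + T * (fps_X * J0) + 1)) = (1 + T * q) * ((1 + q) * \<beta>)"
    using V d \<beta>' q_eq unfolding J0_def by algebra
  then have "V + T * (fps_X * J0) + 1 = \<beta>" using nz by simp
  then have "\<beta> $ m = (V + T * (fps_X * J0) + 1) $ m" by simp
  also have "\<dots> = V $ m + t * J0 $ (m - 1)" using m by (cases m) auto
  also have "J0 $ (m - 1) = (\<Sum>j\<le>m - 1. KT 0 (m - 1 - j) j)" unfolding J0_def sum_KT_series ..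
  also have "{..m - 1} = {..<m}" using m by auto
  finally show ?thesis by (simp add: KV_whirl V_def)
qed

lemma fan_KL_degree: "m > 0 \<Longrightarrow> 2 * degree (fan_KL m) < m"
  using half_degree_qh unfolding half_degree_def fan_KL_def by (cases "qh $ m = 0") (auto simp: Suc_le_eq)

lemma whirl_KL_degree: "m > 0 \<Longrightarrow> 2 * degree (whirl_KL m) < m"
  using half_degree_whirl unfolding half_degree_def whirl_KL_def
  by (cases "whirl_series $ m = 0") (auto simp: Suc_le_eq)

lemma defect_KL_degree: "m > 0 \<Longrightarrow> 2 * degree (defect_KL m) < m"
  using half_degree_defect unfolding half_degree_def defect_KL_def
  by (cases "defect_series $ m = 0") (auto simp: Suc_le_eq)

lemma whirl_KL_0 [simp]: "whirl_KL 0 = 0"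
  using half_degree_whirl unfolding half_degree_def whirl_KL_def by fastforce

lemma defect_KL_0 [simp]: "defect_KL 0 = 0"
  using half_degree_defect unfolding half_degree_def defect_KL_def by fastforce

lemma whirl_KL_1: "whirl_KL (Suc 0) = 1"
proof -
  have "(whirl_series * (1 + qh)) $ Suc 0 = (fps_X * fps_deriv qh) $ Suc 0" by (simp add: whirl_series)
  then show ?thesis using whirl_KL_0 by (simp add: fps_mult_nth whirl_KL_def qh_def)
qed

lemma defect_KL_1: "defect_KL (Suc 0) = 1"
proof -
  have "((1 + T * fps_X) * defect_series) $ Suc 0 = (T * (qh * qh) + fps_X) $ Suc 0"
    by (simp only: defect_series_eq)
  then show ?thesis using defect_KL_0 by (simp add: fps_mult_nth defect_KL_def qh_def)
qed

section \<open>Palindromicity of the coefficients\<close>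

lemma palindromic_1: "palindromic 0 1"
  by (auto simp: palindromic_def coeff_reverse_at intro!: poly_eqI)

lemma palindromic_t: "palindromic 2 t"
  by (auto simp: palindromic_def coeff_reverse_at coeff_pCons split: nat.splits intro!: poly_eqI)

lemma palindromic_1t: "palindromic 1 (1 + t)"
  by (auto simp: palindromic_def coeff_reverse_at coeff_pCons split: nat.splits intro!: poly_eqI)

lemma palindromic_q: "palindromic n (q $ Suc n)"
proof (induction n rule: less_induct)
  case (less n)
  show ?case
  proof (cases n)
    case 0 then show ?thesis by (simp add: palindromic_1)
  next
    case (Suc k)
    have "palindromic n ((1 + t) * q $ Suc k)"
      using palindromic_mult[OF palindromic_1t less[of k]] Suc by simp
    moreover have "palindromic n (t * (\<Sum>i\<le>n. q $ i * q $ (n - i)))"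
      unfolding sum_distrib_left
    proof (rule palindromic_sum)
      fix i assume "i \<in> {..n}"
      show "palindromic n (t * (q $ i * q $ (n - i)))"
      proof (cases "i = 0 \<or> i = n")
        case False
        with \<open>i \<in> {..n}\<close> have "i = Suc (i - 1)" "n - i = Suc (n - i - 1)" "i - 1 < n" "n - i - 1 < n"
          "n = 2 + ((i - 1) + (n - i - 1))" by auto
        then obtain j l where j: "i = Suc j" "n - i = Suc l" "j < n" "l < n" "n = 2 + (j + l)" by blast
        have "palindromic (2 + (j + l)) (t * (q $ Suc j * q $ Suc l))"
          by (intro palindromic_mult palindromic_t less j)
        then show ?thesis using j by metis
      qed auto
    qed
    ultimately have "palindromic n ((1 + t) * q $ n + t * (\<Sum>i\<le>n. q $ i * q $ (n - i)))"
      unfolding Suc by (rule palindromic_add)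
    moreover have "q $ Suc n = (1 + t) * q $ n + t * (\<Sum>i\<le>n. q $ i * q $ (n - i))"
      by (subst q_Suc) (simp only: Suc nat.simps if_False add_0)
    ultimately show ?thesis by (simp only:)
  qed
qed

text \<open>The coefficients of t q^2 are what remains of \<open>q_Suc\<close> after the palindromic
  linear terms are subtracted.\<close>

lemma palindromic_Tqq: "palindromic n ((T * (q * q)) $ n)"
proof -
  have "palindromic n (q $ Suc n - (if n = 0 then 1 else 0) - (1 + t) * q $ n)"
  proof (cases n)
    case (Suc k)
    then show ?thesis using palindromic_q[of n] palindromic_mult[OF palindromic_1t palindromic_q[of k]]
      by (auto intro: palindromic_diff)
  qed simp
  then show ?thesis by (simp add: q_Suc[of n] fps_sq_nth)
qed

text \<open>Since q starts with x, the coefficient of x^(n + 1) in \<beta> q = x q' can be solved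
  for the n-th coefficient of \<beta>.\<close>

lemma palindromic_\<beta>: "palindromic n (\<beta> $ n)"
proof (induction n rule: less_induct)
  case (less n)
  have "(\<beta> * q) $ Suc n = of_nat (Suc n) * q $ Suc n" by (simp add: \<beta>_q)
  moreover have "(\<beta> * q) $ Suc n = \<beta> $ n + (\<Sum>i<n. \<beta> $ i * q $ (Suc n - i))"
  proof -
    have "{0..Suc n} = insert (Suc n) (insert n {..<n})" by auto
    then show ?thesis by (simp add: fps_mult_nth)
  qed
  ultimately have "\<beta> $ n = of_nat (Suc n) * q $ Suc n - (\<Sum>i<n. \<beta> $ i * q $ (Suc n - i))" by simp
  moreover have "palindromic n (of_nat (Suc n) * q $ Suc n)"
  proof -
    have "palindromic 0 (of_nat (Suc n))"
      by (auto simp: palindromic_def coeff_reverse_at of_nat_poly coeff_pCons split: nat.splits intro!: poly_eqI)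
    from palindromic_mult[OF this palindromic_q[of n]] show ?thesis by simp
  qed
  moreover have "palindromic n (\<Sum>i<n. \<beta> $ i * q $ (Suc n - i))"
  proof (rule palindromic_sum)
    fix i assume i: "i \<in> {..<n}"
    then have "palindromic (i + (n - i)) (\<beta> $ i * q $ Suc (n - i))"
      using less palindromic_q by (intro palindromic_mult) auto
    then show "palindromic n (\<beta> $ i * q $ (Suc n - i))" using i by (simp add: Suc_diff_le)
  qed
  ultimately show ?case by (simp add: palindromic_diff)
qed

section \<open>Sums over words\<close>

text \<open>Throughout, \<open>c\<close> is the letter preceding the word; a cyclic word is preceded by its last letter.\<close>

fun lvalid :: "letter \<Rightarrow> letter list \<Rightarrow> bool" where
  "lvalid c [] \<longleftrightarrow> True"
| "lvalid c (x # xs) \<longleftrightarrow> (x = J \<longrightarrow> c \<noteq> H) \<and> lvalid x xs"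

text \<open>\<open>c\<close> precedes the larger word: whether a \<open>J\<close> may grow into
  \<open>H\<close> depends on the predecessor there, so the recursion passes on
  \<open>y\<close>.\<close>

fun lle :: "letter \<Rightarrow> letter list \<Rightarrow> letter list \<Rightarrow> bool" where
  "lle c [] [] \<longleftrightarrow> True"
| "lle c (x # xs) (y # ys) \<longleftrightarrow>
    (x = H \<longrightarrow> y = H) \<and> (x = J \<longrightarrow> y = J \<or> y = H \<and> c = H) \<and> lle y xs ys"
| "lle c _ _ \<longleftrightarrow> False"

text \<open>For \<open>lle c x y\<close> this is \<open>t\<close> to the rank difference of the flats of \<open>y\<close> and \<open>x\<close>.\<close>

fun weight :: "letter list \<Rightarrow> letter list \<Rightarrow> int poly" where
  "weight (x # xs) (y # ys) = (if x = B \<and> y \<noteq> B then t else 1) * weight xs ys"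
| "weight _ _ = 1"

text \<open>A run is a maximal factor without \<open>H\<close>. Contracting the flat turns a run with \<open>m\<close> blocks into a
  fan, up to parallel edges; \<open>s\<close> is the number of blocks of the current run read so far.\<close>

fun run_val :: "nat \<Rightarrow> letter list \<Rightarrow> int poly" where
  "run_val s [] = fan_KL s"
| "run_val s (H # w) = fan_KL s * run_val 0 w"
| "run_val s (B # w) = run_val (Suc s) w"
| "run_val s (J # w) = run_val s w"

text \<open>The part \<open>u\<close> is barred from the hub because a cyclic word will be cut at
  its first hub vertex, with the letters before that vertex moved to the end.\<close>

definition up :: "letter \<Rightarrow> letter list \<Rightarrow> letter list \<Rightarrow> letter list set" where
  "up c v u = {y. lvalid c y \<and> lle c (v @ u) y \<and> H \<notin> set (drop (length v) y)}"

fun TN :: "nat \<Rightarrow> letter list \<Rightarrow> int poly" where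
  "TN s [] = fan_KL s"
| "TN s (H # u) = 0"
| "TN s (B # u) = TN (Suc s) u + (if s > 0 then t * TN s u else 0)"
| "TN s (J # u) = TN s u"

text \<open>Performs the sum over \<open>up\<close> letter by letter. A \<open>J\<close> leaves all
  data unchanged: after \<open>H\<close> it must become \<open>H\<close>, where the empty run
  contributes \<open>fan_KL 0 = 1\<close>, and otherwise it continues its block.\<close>

fun TT :: "nat \<Rightarrow> letter list \<Rightarrow> letter list \<Rightarrow> int poly" where
  "TT s [] u = TN s u"
| "TT s (H # v) u = fan_KL s * TT 0 v u"
| "TT s (B # v) u = t * fan_KL s * TT 0 v u + TT (Suc s) v u + (if s > 0 then t * TT s v u else 0)"
| "TT s (J # v) u = TT s v u"

lemma UNIV_letter: "UNIV = {H, B, J}"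
  using letter.exhaust by blast

lemma finite_letters: "finite (A :: letter set)"
proof (rule finite_subset)
  show "A \<subseteq> {H, B, J}" using UNIV_letter by blast
qed simp

lemma lle_length: "lle c w w' \<Longrightarrow> length w' = length w"
  by (induction c w w' rule: lle.induct) auto

lemma finite_lle: "finite {y. P y \<and> lle (f y) w y}"
proof (rule finite_subset)
  show "{y. P y \<and> lle (f y) w y} \<subseteq> {y. set y \<subseteq> UNIV \<and> length y = length w}"
    using lle_length by auto
  show "finite {y. set y \<subseteq> (UNIV :: letter set) \<and> length y = length w}"
    by (rule finite_lists_length_eq) (rule finite_letters)
qed

lemma finite_up: "finite (up c v u)"
  by (rule finite_subset[OF _ finite_lle[of "\<lambda>_. True" "\<lambda>_. c" "v @ u"]]) (auto simp: up_def)

lemma sum_Cons: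
  assumes "S = (\<Union>y\<in>C. (#) y ` A y)" "\<And>y. finite (A y)"
  shows "(\<Sum>z\<in>S. f z) = (\<Sum>y\<in>C. \<Sum>ys\<in>A y. f ((y :: letter) # ys))"
proof -
  have "(\<Sum>z\<in>S. f z) = (\<Sum>y\<in>C. \<Sum>z\<in>(#) y ` A y. f z)"
    unfolding assms(1) by (rule sum.UNION_disjoint) (use assms(2) finite_letters in auto)
  also have "\<dots> = (\<Sum>y\<in>C. \<Sum>ys\<in>A y. f (y # ys))"
  proof (rule sum.cong[OF refl])
    fix y
    have "inj_on ((#) y) (A y)" by simp
    from sum.reindex[OF this] show "(\<Sum>z\<in>(#) y ` A y. f z) = (\<Sum>ys\<in>A y. f (y # ys))" by simp
  qed
  finally show ?thesis .
qed

definition choices :: "letter \<Rightarrow> letter \<Rightarrow> letter set" where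
  "choices c x = {y. (x = H \<longrightarrow> y = H) \<and> (x = J \<longrightarrow> y = J \<or> y = H \<and> c = H) \<and> (y = J \<longrightarrow> c \<noteq> H)}"

lemma choices_simps:
  "choices c H = {H}"
  "choices c B = (if c = H then {H, B} else {H, B, J})"
  "choices c J = (if c = H then {H} else {J})"
  unfolding choices_def using letter.exhaust by auto

lemma up_Cons: "up c (x # v) u = (\<Union>y\<in>choices c x. (#) y ` up y v u)"
proof (intro set_eqI iffI)
  fix z assume z: "z \<in> up c (x # v) u"
  then obtain y ys where "z = y # ys" by (cases z) (auto simp: up_def)
  then show "z \<in> (\<Union>y\<in>choices c x. (#) y ` up y v u)"
    using z by (auto simp: up_def choices_def)
qed (auto simp: up_def choices_def)

lemma up_Nil_Cons: "up c [] (x # u) = (\<Union>y\<in>choices c x - {H}. (#) y ` up y [] u)"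
proof (intro set_eqI iffI)
  fix z assume z: "z \<in> up c [] (x # u)"
  then obtain y ys where "z = y # ys" by (cases z) (auto simp: up_def)
  then show "z \<in> (\<Union>y\<in>choices c x - {H}. (#) y ` up y [] u)"
    using z by (auto simp: up_def choices_def)
qed (auto simp: up_def choices_def)

text \<open>The current run is empty exactly after a hub letter, and only then can no block be
  merged. In that case a leading \<open>J\<close> must be excluded: it would have to become
  \<open>H\<close>, which is barred here.\<close>

lemma sum_up_TN:
  assumes "s = 0 \<longleftrightarrow> c = H" "s = 0 \<Longrightarrow> u = [] \<or> hd u \<noteq> J"
  shows "(\<Sum>y\<in>up c [] u. weight u y * run_val s y) = TN s u"
  using assms
proof (induction u arbitrary: s c)
  case Nil
  have "up c [] [] = {[]}"
  proof (intro set_eqI iffI)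
    fix y assume "y \<in> up c [] []" then show "y \<in> {[]}" by (cases y) (auto simp: up_def)
  qed (simp add: up_def)
  then show ?case by simp
next
  case (Cons x u)
  note eq = sum_Cons[OF up_Nil_Cons finite_up]
  show ?case
  proof (cases x)
    case H then show ?thesis by (simp add: eq choices_simps)
  next
    case B
    have "(\<Sum>y\<in>up B [] u. weight u y * run_val (Suc s) y) = TN (Suc s) u" by (rule Cons.IH) auto
    moreover have "(\<Sum>y\<in>up J [] u. weight u y * run_val s y) = TN s u" if "s > 0"
      by (rule Cons.IH) (use that in auto)
    ultimately show ?thesis using B Cons.prems
      by (auto simp: eq choices_simps insert_Diff_if sum_distrib_left[symmetric] mult.assoc)
  next
    case J
    then have "s > 0" using Cons.prems(2) by auto
    then have "(\<Sum>y\<in>up J [] u. weight u y * run_val s y) = TN s u" by (intro Cons.IH) auto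
    then show ?thesis using J Cons.prems \<open>s > 0\<close> by (simp add: eq choices_simps)
  qed
qed

lemma sum_up_TT:
  assumes "s = 0 \<longleftrightarrow> c = H" "u = [] \<or> hd u \<noteq> J"
  shows "(\<Sum>y\<in>up c v u. weight (v @ u) y * run_val s y) = TT s v u"
  using assms(1)
proof (induction v arbitrary: s c)
  case Nil
  then show ?case using sum_up_TN[of s c u] assms(2) by simp
next
  case (Cons x v)
  note eq = sum_Cons[OF up_Cons finite_up]
  have 0: "(\<Sum>y\<in>up H v u. weight (v @ u) y * run_val 0 y) = TT 0 v u" by (rule Cons.IH) simp
  have H: "(\<Sum>y\<in>up H v u. weight (v @ u) y * (fan_KL s * run_val 0 y)) = fan_KL s * TT 0 v u"
    unfolding 0[symmetric] sum_distrib_left by (intro sum.cong refl) (simp add: ac_simps)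
  have tH: "(\<Sum>y\<in>up H v u. t * weight (v @ u) y * (fan_KL s * run_val 0 y)) = t * fan_KL s * TT 0 v u"
    unfolding 0[symmetric] sum_distrib_left by (intro sum.cong refl) (simp add: ac_simps)
  have J: "(\<Sum>y\<in>up J v u. weight (v @ u) y * run_val s y) = TT s v u" if "s > 0"
    by (rule Cons.IH) (use that in auto)
  have tJ: "(\<Sum>y\<in>up J v u. t * weight (v @ u) y * run_val s y) = t * TT s v u" if "s > 0"
    unfolding J[OF that, symmetric] sum_distrib_left by (intro sum.cong refl) (simp add: ac_simps)
  have B: "(\<Sum>y\<in>up B v u. weight (v @ u) y * run_val (Suc s) y) = TT (Suc s) v u" by (rule Cons.IH) auto
  show ?case
  proof (cases x)
    case H': H then show ?thesis using H by (simp add: eq choices_simps)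
  next
    case B': B
    show ?thesis
    proof (cases "s = 0")
      case True
      then have "c = H" using Cons.prems by simp
      then show ?thesis using True B' B tH by (simp add: eq choices_simps)
    next
      case False
      then have "c \<noteq> H" using Cons.prems by simp
      then show ?thesis using False B' B tH tJ by (simp add: eq choices_simps)
    qed
  next
    case J': J
    show ?thesis
    proof (cases "s = 0")
      case True
      then have "c = H" using Cons.prems by simp
      then show ?thesis using True J' 0 by (simp add: eq choices_simps)
    next
      case False
      then have "c \<noteq> H" using Cons.prems by simp
      then show ?thesis using False J' J by (simp add: eq choices_simps)
    qed
  qed
qed

lemma TN_count: "H \<notin> set u \<Longrightarrow> TN s u = KN s (count_list u B)"
proof (induction u arbitrary: s)
  case (Cons x u) then show ?case by (cases x) auto
qed simp

lemma TT_count: "H \<notin> set v \<Longrightarrow> H \<notin> set u \<Longrightarrow> TT s v u = KT s (count_list v B) (count_list u B)"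
proof (induction v arbitrary: s)
  case (Cons x v) then show ?case by (cases x) auto
qed (simp add: TN_count)

lemma TT_append_H: "TT s (a @ H # b) u = TT s a [] * TT 0 b u"
proof (induction a arbitrary: s)
  case (Cons x a) then show ?case by (cases x) (auto simp: algebra_simps)
qed simp

lemma run_val_append_H: "run_val s (a @ H # b) = run_val s a * run_val 0 b"
proof (induction a arbitrary: s)
  case (Cons x a) then show ?case by (cases x) (auto simp: algebra_simps)
qed simp

lemma palindromic_TT: "palindromic (count_list w B) (TT 0 w [])"
proof (induction w rule: length_induct)
  case (1 w)
  show ?case
  proof (cases "H \<in> set w")
    case False then show ?thesis by (simp add: TT_count KT_eq_q palindromic_q)
  next
    case True
    then obtain a b where ab: "w = a @ H # b" by (meson split_list)
    then have "palindromic (count_list a B) (TT 0 a [])" "palindromic (count_list b B) (TT 0 b [])"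
      using 1 by auto
    from palindromic_mult[OF this] show ?thesis using ab by (simp add: TT_append_H)
  qed
qed

lemma run_val_degree:
  "(s + count_list w B = 0 \<longrightarrow> run_val s w = 1) \<and>
   (s + count_list w B > 0 \<longrightarrow> 2 * degree (run_val s w) < s + count_list w B)"
proof (induction w arbitrary: s)
  case Nil then show ?case using fan_KL_degree[of s] by (cases "s = 0") auto
next
  case (Cons x w)
  show ?case
  proof (cases x)
    case H
    have d: "degree (fan_KL s * run_val 0 w) \<le> degree (fan_KL s) + degree (run_val 0 w)"
      by (rule degree_mult_le)
    show ?thesis
    proof (cases "s = 0")
      case True then show ?thesis using Cons[of 0] H by simp
    next
      case False
      then have "2 * degree (fan_KL s) < s" by (simp add: fan_KL_degree)
      moreover have "2 * degree (run_val 0 w) \<le> count_list w B"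
        using Cons[of 0] by (cases "count_list w B = 0") auto
      ultimately show ?thesis using d H False by simp
    qed
  qed (use Cons[of s] Cons[of "Suc s"] in auto)
qed

lemma lvalid_append: "lvalid c (a @ b) \<longleftrightarrow> lvalid c a \<and> lvalid (last (c # a)) b"
  by (induction a arbitrary: c) auto

lemma lle_append:
  "length a = length a' \<Longrightarrow> lle c (a @ b) (a' @ b') \<longleftrightarrow> lle c a a' \<and> lle (last (c # a')) b b'"
  by (induction a a' arbitrary: c rule: list_induct2) auto

lemma weight_append:
  "length a = length a' \<Longrightarrow> weight (a @ b) (a' @ b') = weight a a' * weight b b'"
  by (induction a a' rule: list_induct2) (auto simp: mult.assoc)

lemma weight_monom:
  "lle c x y \<Longrightarrow> count_list y B \<le> count_list x B \<and> weight x y = monom 1 (count_list x B - count_list y B)"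
proof (induction c x y rule: lle.induct)
  case (2 c x xs y ys)
  then have IH: "count_list ys B \<le> count_list xs B" "weight xs ys = monom 1 (count_list xs B - count_list ys B)"
    by auto
  have t: "t = monom 1 1" by (simp add: monom_altdef)
  show ?case using 2(2) IH by (cases x) (auto simp: t mult_monom Suc_diff_le)
qed auto

text \<open>The cyclic word is cut open at its first hub vertex.\<close>

definition hub_val :: "letter list \<Rightarrow> int poly" where
  "hub_val w = run_val 0 (tl (dropWhile (\<lambda>x. x \<noteq> H) w) @ takeWhile (\<lambda>x. x \<noteq> H) w)"

lemma while_split:
  assumes "H \<notin> set a"
  shows "takeWhile (\<lambda>x. x \<noteq> H) (a @ H # b) = a" "dropWhile (\<lambda>x. x \<noteq> H) (a @ H # b) = H # b"
  using assms by (induction a) auto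

text \<open>Any hub vertex may serve for the cut, because the values of the pieces multiply and
  commute. This yields invariance under rotation.\<close>

lemma hub_val_split: "hub_val (u @ H # v) = run_val 0 (v @ u)"
proof (cases "H \<in> set u")
  case False
  then show ?thesis by (simp add: hub_val_def while_split)
next
  case True
  then obtain a b where u: "u = a @ H # b" "H \<notin> set a" by (meson split_list_first)
  then have a: "takeWhile (\<lambda>x. x \<noteq> H) (u @ H # v) = a" "dropWhile (\<lambda>x. x \<noteq> H) (u @ H # v) = H # b @ H # v"
    by (simp_all add: while_split)
  have "run_val 0 ((b @ H # v) @ a) = run_val 0 b * run_val 0 (v @ a)" by (simp add: run_val_append_H)
  also have "\<dots> = run_val 0 ((v @ a) @ H # b)" by (subst run_val_append_H) simp
  finally show ?thesis using a u by (simp add: hub_val_def)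
qed

definition cup :: "letter list \<Rightarrow> letter list set" where
  "cup w = {w'. (lvalid (last w') w' \<and> H \<in> set w') \<and> lle (last w') w w'}"

definition hub_sum :: "letter list \<Rightarrow> int poly" where
  "hub_sum w = (\<Sum>w'\<in>cup w. weight w w' * hub_val w')"

lemma finite_cup: "finite (cup w)"
  unfolding cup_def by (rule finite_lle)

lemma hub_val_rotate: "H \<in> set (a @ b) \<Longrightarrow> hub_val (a @ b) = hub_val (b @ a)"
proof -
  have *: "hub_val (a @ b) = hub_val (b @ a)" if "H \<in> set a" for a b
  proof -
    obtain x y where a: "a = x @ H # y" using \<open>H \<in> set a\<close> by (meson split_list)
    then show ?thesis using hub_val_split[of x "y @ b"] hub_val_split[of "b @ x" y] by simp
  qed
  show "H \<in> set (a @ b) \<Longrightarrow> ?thesis" using *[of a b] *[of b a] by auto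
qed

lemma cup_rotate:
  assumes "a \<noteq> []" "b \<noteq> []" "length a = length a'" "length b = length b'"
  shows "a' @ b' \<in> cup (a @ b) \<longleftrightarrow> b' @ a' \<in> cup (b @ a)"
proof -
  have ne: "a' \<noteq> []" "b' \<noteq> []" using assms by auto
  show ?thesis using ne assms(3,4) by (auto simp: cup_def lvalid_append lle_append)
qed

text \<open>Rotating both words together preserves order, weight and value, so \<open>w\<close> may
  be cut where convenient: at a hub vertex if there is one, otherwise before a block.\<close>

lemma hub_sum_rotate: "hub_sum (a @ b) = hub_sum (b @ a)"
proof (cases "a = [] \<or> b = []")
  case False
  then have ne: "a \<noteq> []" "b \<noteq> []" by auto
  have split: "\<exists>a' b'. w' = a' @ b' \<and> length a' = length a \<and> length b' = length b"
    if "w' \<in> cup (a @ b)" for w' a b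
    using that lle_length[of "last w'" "a @ b" w']
    by (intro exI[of _ "take (length a) w'"] exI[of _ "drop (length a) w'"]) (auto simp: cup_def)
  show ?thesis unfolding hub_sum_def
  proof (rule sum.reindex_bij_witness[of _ "\<lambda>y. drop (length b) y @ take (length b) y"
        "\<lambda>y. drop (length a) y @ take (length a) y"])
    fix w' assume w': "w' \<in> cup (a @ b)"
    then obtain a' b' where ab: "w' = a' @ b'" "length a = length a'" "length b = length b'"
      using split by metis
    show "drop (length b) (drop (length a) w' @ take (length a) w') @
        take (length b) (drop (length a) w' @ take (length a) w') = w'" using ab by simp
    show "drop (length a) w' @ take (length a) w' \<in> cup (b @ a)"
      using cup_rotate[OF ne ab(2,3)] w' ab by simp
    have "H \<in> set (a' @ b')" using w' ab by (auto simp: cup_def)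
    from hub_val_rotate[OF this]
    show "weight (b @ a) (drop (length a) w' @ take (length a) w') * hub_val (drop (length a) w' @ take (length a) w') =
        weight (a @ b) w' * hub_val w'" using ab by (simp add: weight_append)
  next
    fix w' assume w': "w' \<in> cup (b @ a)"
    then obtain b' a' where ab: "w' = b' @ a'" "length b = length b'" "length a = length a'"
      using split by metis
    show "drop (length a) (drop (length b) w' @ take (length b) w') @
        take (length a) (drop (length b) w' @ take (length b) w') = w'" using ab by simp
    show "drop (length b) w' @ take (length b) w' \<in> cup (a @ b)"
      using cup_rotate[OF ne(2,1) ab(2,3)] w' ab by simp
  qed
qed auto

lemma hub_sum_H: "hub_sum (H # r) = TT 0 r []"
proof -
  have "cup (H # r) = (#) H ` up H r []"
  proof (intro set_eqI iffI)
    fix z assume z: "z \<in> cup (H # r)"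
    then obtain y ys where "z = y # ys" by (cases z) (auto simp: cup_def)
    then show "z \<in> (#) H ` up H r []" using z lle_length[of H r ys] by (auto simp: cup_def up_def)
  next
    fix z assume "z \<in> (#) H ` up H r []"
    then show "z \<in> cup (H # r)" by (auto simp: cup_def up_def)
  qed
  then have "hub_sum (H # r) = (\<Sum>y\<in>up H r []. weight (H # r) (H # y) * hub_val (H # y))"
    by (simp add: hub_sum_def sum.reindex)
  also have "\<dots> = (\<Sum>y\<in>up H r []. weight (r @ []) y * run_val 0 y)"
    using hub_val_split[of "[]"] by (intro sum.cong refl) simp
  also have "\<dots> = TT 0 r []" by (rule sum_up_TT) auto
  finally show ?thesis .
qed

lemma hub_sum_palindromic: "H \<in> set w \<Longrightarrow> palindromic (count_list w B) (hub_sum w)"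
proof -
  assume "H \<in> set w"
  then obtain a b where w: "w = a @ H # b" by (meson split_list)
  then have "hub_sum w = TT 0 (b @ a) []"
    using hub_sum_rotate[of a "H # b"] hub_sum_H[of "b @ a"] by simp
  then show ?thesis using palindromic_TT[of "b @ a"] w by (simp add: add.commute)
qed

text \<open>The words above \<open>w\<close> are sorted by their first \<open>H\<close> and cut
  there. In \<open>w\<close> this position carries \<open>B\<close>, for a \<open>J\<close> grows
  into \<open>H\<close> only after an earlier \<open>H\<close>. The leading \<open>B\<close> of
  \<open>w\<close> rules out the wrap-around case and supplies the hypothesis on \<open>u\<close> in
  \<open>sum_up_TT\<close>.\<close>

lemma hub_sum_first:
  assumes w: "w = B # r" "H \<notin> set r" and i: "i < length w"
  shows "(\<Sum>w' | w' \<in> cup w \<and> length (takeWhile (\<lambda>x. x \<noteq> H) w') = i. weight w w' * hub_val w') =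
    (if w ! i = B then t * TT 0 (drop (Suc i) w) (take i w) else 0)"
proof -
  define u v x where "u = take i w" and "v = drop (Suc i) w" and "x = w ! i"
  have wuv: "w = u @ x # v" using i by (simp add: u_def v_def x_def id_take_nth_drop[symmetric])
  have lu: "length u = i" using i by (simp add: u_def)
  have hd: "u = [] \<or> hd u = B" using w by (cases i) (auto simp: u_def)
  have Hu: "H \<notin> set u" using w by (auto simp: u_def dest: in_set_takeD)
  have "H \<notin> set w" using w by simp
  then have xH: "x \<noteq> H" using nth_mem[OF i] unfolding x_def by metis
  let ?S = "{w'. w' \<in> cup w \<and> length (takeWhile (\<lambda>x. x \<noteq> H) w') = i}"
  have S: "w' \<in> ?S \<longleftrightarrow> (\<exists>u' v'. w' = u' @ H # v' \<and> length u' = i \<and> H \<notin> set u' \<and>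
      lvalid (last (H # v')) u' \<and> lvalid H v' \<and> lle (last (H # v')) u u' \<and> lle H v v' \<and>
      (x = J \<longrightarrow> last (last (H # v') # u') = H))" for w'
  proof
    assume w': "w' \<in> ?S"
    define u' where "u' = takeWhile (\<lambda>x. x \<noteq> H) w'"
    have "H \<in> set w'" using w' by (auto simp: cup_def)
    then obtain a b where ab: "w' = a @ H # b" "H \<notin> set a" by (meson split_list_first)
    then have "u' = a" unfolding u'_def by (simp add: while_split)
    then have "length a = i" using w' by (simp add: u'_def)
    then show "\<exists>u' v'. w' = u' @ H # v' \<and> length u' = i \<and> H \<notin> set u' \<and>
      lvalid (last (H # v')) u' \<and> lvalid H v' \<and> lle (last (H # v')) u u' \<and> lle H v v' \<and>
      (x = J \<longrightarrow> last (last (H # v') # u') = H)"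
      using w' ab lu unfolding wuv
      by (intro exI[of _ a] exI[of _ b]) (auto simp: cup_def lvalid_append lle_append)
  next
    assume "\<exists>u' v'. w' = u' @ H # v' \<and> length u' = i \<and> H \<notin> set u' \<and>
      lvalid (last (H # v')) u' \<and> lvalid H v' \<and> lle (last (H # v')) u u' \<and> lle H v v' \<and>
      (x = J \<longrightarrow> last (last (H # v') # u') = H)"
    then show "w' \<in> ?S"
    proof (elim exE conjE)
      fix u' v' assume a: "w' = u' @ H # v'" "length u' = i" "H \<notin> set u'"
        "lvalid (last (H # v')) u'" "lvalid H v'" "lle (last (H # v')) u u'" "lle H v v'"
        "x = J \<longrightarrow> last (last (H # v') # u') = H"
      have "takeWhile (\<lambda>x. x \<noteq> H) w' = u'" using a by (simp add: while_split)
      moreover have "w' \<in> cup w" using a lu xH unfolding wuv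
        by (auto simp: cup_def lvalid_append lle_append)
      ultimately show ?thesis using a by simp
    qed
  qed
  show ?thesis
  proof (cases "x = B")
    case False
    then have "x = J" using xH by (cases x) auto
    then have "i \<noteq> 0" using w by (cases i) (auto simp: x_def)
    have e: "?S = {}"
    proof (rule ccontr)
      assume "?S \<noteq> {}"
      then obtain w' where "w' \<in> ?S" by blast
      then obtain u' v' where a: "length u' = i" "H \<notin> set u'" "last (last (H # v') # u') = H"
        using S[of w'] \<open>x = J\<close> by blast
      then have "u' \<noteq> []" using \<open>i \<noteq> 0\<close> by auto
      then have "last u' = H" using a by simp
      then show False using a(2) \<open>u' \<noteq> []\<close> last_in_set by metis
    qed
    show ?thesis unfolding e using False by (simp add: x_def)
  next
    case True
    have "(\<Sum>w'\<in>?S. weight w w' * hub_val w') = (\<Sum>y\<in>up H v u. t * (weight (v @ u) y * run_val 0 y))"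
    proof (rule sum.reindex_bij_witness[of _ "\<lambda>y. drop (length v) y @ H # take (length v) y"
        "\<lambda>w'. drop (Suc i) w' @ take i w'"])
      fix w' assume "w' \<in> ?S"
      then obtain u' v' where a: "w' = u' @ H # v'" "length u' = i" "H \<notin> set u'"
        "lvalid (last (H # v')) u'" "lvalid H v'" "lle (last (H # v')) u u'" "lle H v v'"
        using S[of w'] True by blast
      have lv: "length v' = length v" using lle_length a(7) by blast
      show "drop (length v) (drop (Suc i) w' @ take i w') @ H # take (length v) (drop (Suc i) w' @ take i w') = w'"
        using a lv by simp
      show "drop (Suc i) w' @ take i w' \<in> up H v u"
        using a lv lu by (simp add: up_def lvalid_append lle_append)
      show "t * (weight (v @ u) (drop (Suc i) w' @ take i w') * run_val 0 (drop (Suc i) w' @ take i w')) =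
          weight w w' * hub_val w'"
        using a lv lu True unfolding wuv by (simp add: weight_append hub_val_split ac_simps)
    next
      fix y assume y: "y \<in> up H v u"
      define v' u' where "v' = take (length v) y" and "u' = drop (length v) y"
      have y': "y = v' @ u'" by (simp add: v'_def u'_def)
      have "length y = length v + length u" using y lle_length[of H "v @ u" y] by (simp add: up_def)
      then have l: "length v' = length v" "length u' = i" using lu by (simp_all add: v'_def u'_def)
      have f: "H \<notin> set u'" "lvalid (last (H # v')) u'" "lvalid H v'" "lle (last (H # v')) u u'" "lle H v v'"
        using y l unfolding y' by (simp_all add: up_def lvalid_append lle_append)
      show "drop (Suc i) (drop (length v) y @ H # take (length v) y) @ take i (drop (length v) y @ H # take (length v) y) = y"
        using l by (simp add: y')
      have "u' @ H # v' \<in> ?S" unfolding S using f l True by blast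
      then show "drop (length v) y @ H # take (length v) y \<in> ?S" using l by (simp add: y')
    qed
    also have "\<dots> = t * TT 0 v u"
    proof -
      have "(\<Sum>y\<in>up H v u. weight (v @ u) y * run_val 0 y) = TT 0 v u"
        using hd by (intro sum_up_TT) auto
      then show ?thesis by (simp only: sum_distrib_left[symmetric])
    qed
    finally show ?thesis using True by (simp add: x_def u_def v_def)
  qed
qed

lemma sum_split_count:
  "(\<Sum>i<length w. if w ! i = B then g (count_list (take i w) B) (count_list (drop (Suc i) w) B) else 0) =
   (\<Sum>j<count_list w B. g j (count_list w B - 1 - j) :: int poly)"
proof (induction w arbitrary: g)
  case (Cons x w)
  show ?case
  proof (cases "x = B")
    case True
    then show ?thesis using Cons[of "\<lambda>a b. g (Suc a) b"]
      by (simp add: sum.lessThan_Suc_shift del: sum.lessThan_Suc cong: if_cong)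
  next
    case False
    then show ?thesis using Cons[of g]
      by (simp add: sum.lessThan_Suc_shift del: sum.lessThan_Suc cong: if_cong)
  qed
qed simp

text \<open>After rotation to a leading block, each summand depends only on the numbers of blocks
  before and after the first hub vertex.\<close>

lemma hub_sum_hubless:
  assumes "H \<notin> set w" "B \<in> set w"
  shows "hub_sum w = t * (\<Sum>j<count_list w B. KT 0 (count_list w B - 1 - j) j)"
proof -
  obtain a b where ab: "w = a @ B # b" using assms(2) by (meson split_list)
  define r where "r = b @ a"
  define w' where "w' = B # r"
  have r: "H \<notin> set r" using assms ab by (auto simp: r_def)
  have c: "count_list w B = count_list w' B" using ab by (simp add: r_def w'_def)
  have "hub_sum w = hub_sum w'" using hub_sum_rotate[of a "B # b"] ab by (simp add: r_def w'_def)
  also have "\<dots> = (\<Sum>i<length w'. \<Sum>z | z \<in> cup w' \<and> length (takeWhile (\<lambda>x. x \<noteq> H) z) = i. weight w' z * hub_val z)"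
    unfolding hub_sum_def
  proof (rule sum.group[symmetric])
    show "finite (cup w')" by (rule finite_cup)
    show "(\<lambda>z. length (takeWhile (\<lambda>x. x \<noteq> H) z)) ` cup w' \<subseteq> {..<length w'}"
    proof
      fix k assume "k \<in> (\<lambda>z. length (takeWhile (\<lambda>x. x \<noteq> H) z)) ` cup w'"
      then obtain z where z: "z \<in> cup w'" "k = length (takeWhile (\<lambda>x. x \<noteq> H) z)" by auto
      then have "H \<in> set z" and l: "length z = length w'" using lle_length by (auto simp: cup_def)
      then obtain a b where ab: "z = a @ H # b" "H \<notin> set a" by (meson split_list_first)
      then have "takeWhile (\<lambda>x. x \<noteq> H) z = a" by (simp add: while_split)
      then show "k \<in> {..<length w'}" using z(2) ab(1) l[symmetric] by simp
    qed
  qed simp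
  also have "\<dots> = (\<Sum>i<length w'. if w' ! i = B then t * TT 0 (drop (Suc i) w') (take i w') else 0)"
    by (intro sum.cong refl hub_sum_first[OF w'_def r]) simp
  also have "\<dots> = (\<Sum>i<length w'. if w' ! i = B then t * KT 0 (count_list (drop (Suc i) w') B) (count_list (take i w') B) else 0)"
  proof (intro sum.cong refl)
    fix i
    have "H \<notin> set w'" using r by (simp add: w'_def)
    then have "H \<notin> set (drop (Suc i) w')" "H \<notin> set (take i w')"
      using in_set_dropD[of H "Suc i" w'] in_set_takeD[of H i w'] by blast+
    then show "(if w' ! i = B then t * TT 0 (drop (Suc i) w') (take i w') else 0) =
      (if w' ! i = B then t * KT 0 (count_list (drop (Suc i) w') B) (count_list (take i w') B) else 0)"
      by (simp add: TT_count)
  qed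
  also have "\<dots> = (\<Sum>j<count_list w' B. t * KT 0 (count_list w' B - 1 - j) j)"
    by (rule sum_split_count[of w' "\<lambda>a b. t * KT 0 b a"])
  finally show ?thesis by (simp add: c sum_distrib_left)
qed

lemma hubless_sum:
  assumes "H \<notin> set w" "c \<noteq> H"
  shows "(\<Sum>y | H \<notin> set y \<and> lle c w y. weight w y * f (k + count_list y B)) = KV f k (count_list w B)"
  using assms
proof (induction w arbitrary: c k)
  case Nil
  have "{y. H \<notin> set y \<and> lle c [] y} = {[]}"
  proof (intro set_eqI iffI)
    fix y assume "y \<in> {y. H \<notin> set y \<and> lle c [] y}" then show "y \<in> {[]}" by (cases y) auto
  qed simp
  then show ?case by simp
next
  case (Cons x w)
  let ?C = "{y. y \<noteq> H \<and> (x = J \<longrightarrow> y = J)}"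
  have fin: "finite {ys. H \<notin> set ys \<and> lle y w ys}" for y
    by (rule finite_lle)
  have "{y. H \<notin> set y \<and> lle c (x # w) y} = (\<Union>y\<in>?C. (#) y ` {ys. H \<notin> set ys \<and> lle y w ys})"
  proof (intro set_eqI iffI)
    fix z assume z: "z \<in> {y. H \<notin> set y \<and> lle c (x # w) y}"
    then obtain y ys where "z = y # ys" by (cases z) auto
    moreover from this have "y \<in> ?C" "ys \<in> {ys. H \<notin> set ys \<and> lle y w ys}" using z Cons.prems by auto
    ultimately show "z \<in> (\<Union>y\<in>?C. (#) y ` {ys. H \<notin> set ys \<and> lle y w ys})" by blast
  qed (use Cons.prems in auto)
  note eq = sum_Cons[OF this fin]
  have J: "(\<Sum>y | H \<notin> set y \<and> lle J w y. weight w y * f (k + count_list y B)) = KV f k (count_list w B)"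
    by (rule Cons.IH) (use Cons.prems in auto)
  show ?case
  proof (cases x)
    case H then show ?thesis using Cons.prems by simp
  next
    case x: B
    have B: "(\<Sum>y | H \<notin> set y \<and> lle B w y. weight w y * f (Suc k + count_list y B)) = KV f (Suc k) (count_list w B)"
      by (rule Cons.IH) (use Cons.prems in auto)
    have C: "?C = {B, J}" using x letter.exhaust by auto
    show ?thesis unfolding eq C using x B J
      by (simp add: sum_distrib_left[symmetric] mult.assoc)
  next
    case x: J
    have C: "?C = {J}" using x by auto
    show ?thesis unfolding eq C using x J by simp
  qed
qed

section \<open>The Z-polynomials of wheels, whirls and fans\<close>

context wheel begin

lemma lvalid_iff: "lvalid c w \<longleftrightarrow> (\<forall>i<length w. w ! i = J \<longrightarrow> (c # w) ! i \<noteq> H)"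
proof (induction w arbitrary: c)
  case (Cons x w)
  have "(\<forall>i<length (x # w). (x # w) ! i = J \<longrightarrow> (c # x # w) ! i \<noteq> H) \<longleftrightarrow>
      (x = J \<longrightarrow> c \<noteq> H) \<and> (\<forall>i<length w. w ! i = J \<longrightarrow> (x # w) ! i \<noteq> H)"
    by (simp add: All_less_Suc2)
  then show ?case using Cons[of x] by simp
qed simp

lemma lle_iff: "length w = length w' \<Longrightarrow> lle c w w' \<longleftrightarrow> (\<forall>i<length w. (w ! i = H \<longrightarrow> w' ! i = H) \<and>
    (w ! i = J \<longrightarrow> w' ! i = J \<or> w' ! i = H \<and> (c # w') ! i = H))"
proof (induction w w' arbitrary: c rule: list_induct2)
  case (Cons x xs y ys)
  show ?case using Cons.IH[of y] by (simp add: All_less_Suc2)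
qed simp

lemma last_Cons_nth:
  assumes "length w = n" "i < n"
  shows "(last w # w) ! i = ltr w (i + n - 1)"
proof (cases i)
  case 0
  have "w \<noteq> []" using assms by auto
  then show ?thesis using 0 assms by (simp add: last_conv_nth ltr_def)
next
  case (Suc k)
  then have "(i + n - 1) mod n = k" using assms by simp
  then show ?thesis using Suc by (simp add: ltr_def)
qed

text \<open>Bridges the periodic indexing, where neighbours are \<open>i\<close> and
  \<open>Suc i\<close>, and the list recursions, where a letter looks back; \<open>i + n - 1\<close>
  avoids a predecessor of 0.\<close>

lemma all_pred_iff: "(\<forall>i. P (ltr w (Suc i)) (ltr w i) (ltr w' (Suc i)) (ltr w' i)) \<longleftrightarrow>
  (\<forall>i<n. P (ltr w i) (ltr w (i + n - 1)) (ltr w' i) (ltr w' (i + n - 1)))"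
proof
  assume a: "\<forall>i. P (ltr w (Suc i)) (ltr w i) (ltr w' (Suc i)) (ltr w' i)"
  show "\<forall>i<n. P (ltr w i) (ltr w (i + n - 1)) (ltr w' i) (ltr w' (i + n - 1))"
  proof (intro allI impI)
    fix i
    from a[rule_format, of "i + n - 1"] show "P (ltr w i) (ltr w (i + n - 1)) (ltr w' i) (ltr w' (i + n - 1))"
      unfolding ltr_pred .
  qed
next
  assume a: "\<forall>i<n. P (ltr w i) (ltr w (i + n - 1)) (ltr w' i) (ltr w' (i + n - 1))"
  show "\<forall>i. P (ltr w (Suc i)) (ltr w i) (ltr w' (Suc i)) (ltr w' i)"
  proof
    fix i
    define k where "k = Suc i mod n"
    have k: "k < n" "k mod n = Suc i mod n" using n3 by (auto simp: k_def)
    have "Suc (k + n - 1) mod n = Suc i mod n" using n3 by (simp add: k_def)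
    then have "(k + n - 1) mod n = i mod n" using n3 by (subst (asm) Suc_mod_eq_iff) auto
    then have "ltr v (k + n - 1) = ltr v i" "ltr v k = ltr v (Suc i)" for v
      using ltr_cong k(2) by blast+
    then show "P (ltr w (Suc i)) (ltr w i) (ltr w' (Suc i)) (ltr w' i)" using a k(1) by metis
  qed
qed

lemma cyc_valid_iff: "cyc_valid w \<longleftrightarrow> length w = n \<and> lvalid (last w) w"
proof (cases "length w = n")
  case True
  have "lvalid (last w) w \<longleftrightarrow> (\<forall>i<n. ltr w i = J \<longrightarrow> ltr w (i + n - 1) \<noteq> H)"
    unfolding lvalid_iff using True last_Cons_nth[OF True] nth_ltr by auto
  also have "\<dots> \<longleftrightarrow> (\<forall>i. ltr w (Suc i) = J \<longrightarrow> ltr w i \<noteq> H)"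
    using all_pred_iff[of "\<lambda>a b c d. a = J \<longrightarrow> b \<noteq> H" w w] by simp
  finally show ?thesis using True by (simp add: cyc_valid_def)
qed (simp add: cyc_valid_def)

lemma cyc_le_iff:
  assumes "length w = n" "length w' = n" shows "cyc_le w w' \<longleftrightarrow> lle (last w') w w'"
proof -
  have "lle (last w') w w' \<longleftrightarrow> (\<forall>i<n. (ltr w i = H \<longrightarrow> ltr w' i = H) \<and>
      (ltr w i = J \<longrightarrow> ltr w' i = J \<or> ltr w' i = H \<and> ltr w' (i + n - 1) = H))"
    using assms lle_iff[of w w'] last_Cons_nth[OF assms(2)] nth_ltr by auto
  also have "\<dots> \<longleftrightarrow> (\<forall>i. (ltr w (Suc i) = H \<longrightarrow> ltr w' (Suc i) = H) \<and>
     (ltr w (Suc i) = J \<longrightarrow> ltr w' (Suc i) = J \<or> ltr w' (Suc i) = H \<and> ltr w' i = H))"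
    using all_pred_iff[of "\<lambda>a b c d. (a = H \<longrightarrow> c = H) \<and> (a = J \<longrightarrow> c = J \<or> c = H \<and> d = H)" w w'] by simp
  also have "\<dots> \<longleftrightarrow> cyc_le w w'"
  proof -
    have "(\<forall>i. ltr w (Suc i) = H \<longrightarrow> ltr w' (Suc i) = H) \<longleftrightarrow> (\<forall>i. ltr w i = H \<longrightarrow> ltr w' i = H)"
    proof
      assume a: "\<forall>i. ltr w (Suc i) = H \<longrightarrow> ltr w' (Suc i) = H"
      show "\<forall>i. ltr w i = H \<longrightarrow> ltr w' i = H"
      proof
        fix i from a[rule_format, of "i + n - 1"] show "ltr w i = H \<longrightarrow> ltr w' i = H" unfolding ltr_pred by blast
      qed
    qed blast
    then show ?thesis unfolding cyc_le_def by blast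
  qed
  finally show ?thesis ..
qed

text \<open>\<open>w\<close> without \<open>H\<close> and \<open>B\<close> is the rim, a flat of corank 1 of the wheel.\<close>

definition kl :: "bool \<Rightarrow> letter list \<Rightarrow> int poly" where
  "kl g w = (if H \<in> set w then hub_val w else if g then whirl_KL (count_list w B)
     else if count_list w B = 0 then 1 else whirl_KL (count_list w B) - defect_KL (count_list w B))"

lemma count_le_n: "length w = n \<Longrightarrow> count_list w B \<le> n"
  using count_le_length[of w B] by simp

lemma filter_count: "length (filter (\<lambda>x. x \<noteq> B) w) = length w - count_list w B"
proof -
  have "length (filter (\<lambda>x. x \<noteq> B) w) + count_list w B = length w"
    by (induction w) auto
  then show ?thesis by simp
qed

lemma rank_flat_word:
  assumes "w \<in> flat_words g"
  shows "rank_of (W g) (flat_of w) = (if w = replicate n J then n - 1 else n - count_list w B)"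
  using flat_of_flat_words(2)[OF assms] assms
  by (auto simp: filter_count flat_words_def cyc_valid_def)

lemma no_hub_no_block:
  "length w = n \<Longrightarrow> H \<notin> set w \<Longrightarrow> count_list w B = 0 \<Longrightarrow> w = replicate n J"
proof -
  assume w: "length w = n" "H \<notin> set w" "count_list w B = 0"
  have "set w \<subseteq> {J}"
  proof
    fix x assume "x \<in> set w"
    then have "x \<noteq> H" "x \<noteq> B" using w(2,3) unfolding count_list_0_iff by metis+
    then show "x \<in> {J}" by (cases x) auto
  qed
  then show ?thesis using w(1) by (metis replicate_eqI singletonD subsetD)
qed

lemma hub_val_degree:
  assumes "H \<in> set w"
  shows "count_list w B = 0 \<longrightarrow> hub_val w = 1" "count_list w B > 0 \<longrightarrow> 2 * degree (hub_val w) < count_list w B"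
proof -
  obtain a b where w: "w = a @ H # b" using assms by (meson split_list)
  then have "hub_val w = run_val 0 (b @ a)" "count_list w B = count_list (b @ a) B"
    by (simp_all add: hub_val_split)
  then show "count_list w B = 0 \<longrightarrow> hub_val w = 1" "count_list w B > 0 \<longrightarrow> 2 * degree (hub_val w) < count_list w B"
    using run_val_degree[of 0 "b @ a"] by simp_all
qed

text \<open>The polynomial whose palindromicity \<open>Z_poly_characterization\<close> asks for; at
  the bottom word it is the Z-polynomial.\<close>

definition upper_sum :: "bool \<Rightarrow> letter list \<Rightarrow> int poly" where
  "upper_sum g x = (\<Sum>y | y \<in> flat_words g \<and> flat_of x \<subseteq> flat_of y.
      monom 1 (rank_of (W g) (flat_of y) - rank_of (W g) (flat_of x)) * kl g y)"

lemma flat_words_length: "w \<in> flat_words g \<Longrightarrow> length w = n"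
  by (simp add: flat_words_def cyc_valid_def)

lemma finite_flat_words: "finite (flat_words g)"
proof -
  interpret M: matroid "W g" by (rule matroid_W)
  show ?thesis using flat_of_bij[of g] M.finite_flats by (simp add: bij_betw_finite)
qed

lemma cup_flat_words: "length x = n \<Longrightarrow> y \<in> cup x \<Longrightarrow> y \<in> flat_words g"
proof -
  assume "length x = n" "y \<in> cup x"
  then have "length y = n" "H \<in> set y" "lvalid (last y) y" using lle_length by (auto simp: cup_def)
  moreover have "H \<notin> set (replicate n J)" by simp
  then have "y \<noteq> replicate n J" using \<open>H \<in> set y\<close> by metis
  ultimately show ?thesis by (simp add: flat_words_def cyc_valid_iff)
qed

lemma upper_sum_split:
  assumes x: "x \<in> flat_words g" "x \<noteq> replicate n J"
  shows "upper_sum g x = hub_sum x +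
    (\<Sum>y | y \<in> flat_words g \<and> H \<notin> set y \<and> lle B x y. monom 1 (rank_of (W g) (flat_of y) - rank_of (W g) (flat_of x)) * kl g y)"
proof -
  let ?S = "{y. y \<in> flat_words g \<and> flat_of x \<subseteq> flat_of y}"
  let ?f = "\<lambda>y. monom 1 (rank_of (W g) (flat_of y) - rank_of (W g) (flat_of x)) * kl g y"
  have lx: "length x = n" using x flat_words_length by simp
  have le: "flat_of x \<subseteq> flat_of y \<longleftrightarrow> lle (last y) x y" if "y \<in> flat_words g" for y
    using flat_words_length[OF that] lx by (simp add: flat_of_subset_iff cyc_le_iff)
  have fin: "finite ?S" using finite_flat_words[of g] by simp
  have "upper_sum g x = sum ?f {y \<in> ?S. H \<in> set y} + sum ?f {y \<in> ?S. H \<notin> set y}"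
  proof -
    have "finite {y \<in> ?S. H \<in> set y}" "finite {y \<in> ?S. H \<notin> set y}"
      by (rule finite_subset[OF _ fin]; blast)+
    then have "sum ?f {y \<in> ?S. H \<in> set y} + sum ?f {y \<in> ?S. H \<notin> set y} =
        sum ?f ({y \<in> ?S. H \<in> set y} \<union> {y \<in> ?S. H \<notin> set y})"
      by (intro sum.union_disjoint[symmetric]) auto
    also have "{y \<in> ?S. H \<in> set y} \<union> {y \<in> ?S. H \<notin> set y} = ?S" by blast
    finally show ?thesis unfolding upper_sum_def ..
  qed
  also have "sum ?f {y \<in> ?S. H \<in> set y} = hub_sum x"
    unfolding hub_sum_def
  proof (rule sum.cong)
    show "{y \<in> ?S. H \<in> set y} = cup x"
    proof (intro set_eqI iffI)
      fix y assume y: "y \<in> cup x"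
      then have "y \<in> flat_words g" using cup_flat_words lx by blast
      then show "y \<in> {y \<in> ?S. H \<in> set y}" using y le by (auto simp: cup_def)
    next
      fix y assume y: "y \<in> {y \<in> ?S. H \<in> set y}"
      then have "lle (last y) x y" using le by blast
      then show "y \<in> cup x" using y by (simp add: flat_words_def cyc_valid_iff cup_def)
    qed
    fix y assume y: "y \<in> cup x"
    then have yw: "y \<in> flat_words g" using cup_flat_words lx by blast
    have "H \<in> set y" using y by (auto simp: cup_def)
    moreover from this have "y \<noteq> replicate n J" by auto
    moreover have "count_list y B \<le> count_list x B \<and> weight x y = monom 1 (count_list x B - count_list y B)"
      using y weight_monom[of "last y" x y] by (simp add: cup_def)
    moreover have "count_list x B \<le> n" using lx count_le_n by simp
    ultimately show "?f y = weight x y * hub_val y"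
      using rank_flat_word[OF yw] rank_flat_word[OF x(1)] x(2) by (simp add: kl_def)
  qed
  also have "{y \<in> ?S. H \<notin> set y} = {y. y \<in> flat_words g \<and> H \<notin> set y \<and> lle B x y}"
  proof -
    \<comment> \<open>The preceding letter matters only through being \<open>H\<close> or not, so
      the cyclic \<open>last y\<close> can be replaced by the constant \<open>B\<close>.\<close>
    have c: "lle c x y \<longleftrightarrow> lle d x y" if "c \<noteq> H" "d \<noteq> H" for c d y
      using that by (cases x; cases y) auto
    have "lle (last y) x y \<longleftrightarrow> lle B x y" if y: "y \<in> flat_words g" "H \<notin> set y" for y
    proof (rule c)
      have "y \<noteq> []" using flat_words_length[OF y(1)] n3 by auto
      then show "last y \<noteq> H" using y(2) last_in_set by metis
    qed simp
    then show ?thesis using le by auto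
  qed
  finally show ?thesis .
qed

lemma no_hub_words:
  assumes "length x = n" "H \<notin> set y" "lle B x y"
  shows "y \<in> flat_words g \<longleftrightarrow> (if g then count_list y B \<noteq> 0 else count_list y B \<noteq> 1)"
proof -
  have ly: "length y = n" using lle_length[OF assms(3)] assms(1) by simp
  then have "y \<noteq> []" using n3 by auto
  then have "last y \<noteq> H" using assms(2) last_in_set by metis
  have "lvalid c y" if "c \<noteq> H" for c using that assms(2)
    by (induction y arbitrary: c) auto
  then have "cyc_valid y" using ly \<open>last y \<noteq> H\<close> by (simp add: cyc_valid_iff)
  moreover have "y = replicate n J \<longleftrightarrow> count_list y B = 0"
    using no_hub_no_block[OF ly assms(2)] by (auto simp: count_list_0_iff)
  ultimately show ?thesis using assms(2) by (auto simp: flat_words_def)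
qed

text \<open>\<open>hubless_sum\<close> also runs over the all-\<open>J\<close> word, which is no
  flat of the whirl; \<open>whirl_KL 0 = 0\<close> removes it.\<close>

lemma no_hub_sum_True:
  assumes x: "x \<in> flat_words True" "H \<notin> set x" 
  shows "(\<Sum>y | y \<in> flat_words True \<and> H \<notin> set y \<and> lle B x y.
      monom 1 (rank_of (W True) (flat_of y) - rank_of (W True) (flat_of x)) * kl True y) = KV whirl_KL 0 (count_list x B)"
proof -
  have lx: "length x = n" using x flat_words_length by simp
  have "KV whirl_KL 0 (count_list x B) = (\<Sum>y | H \<notin> set y \<and> lle B x y. weight x y * whirl_KL (0 + count_list y B))"
    using x by (intro hubless_sum[symmetric]) auto
  also have "\<dots> = (\<Sum>y | y \<in> flat_words True \<and> H \<notin> set y \<and> lle B x y.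
      monom 1 (rank_of (W True) (flat_of y) - rank_of (W True) (flat_of x)) * kl True y)"
  proof (rule sum.mono_neutral_cong_right)
    show "finite {y. H \<notin> set y \<and> lle B x y}" by (rule finite_lle)
    show "\<forall>y\<in>{y. H \<notin> set y \<and> lle B x y} - {y. y \<in> flat_words True \<and> H \<notin> set y \<and> lle B x y}.
       weight x y * whirl_KL (0 + count_list y B) = 0"
    proof
      fix y assume "y \<in> {y. H \<notin> set y \<and> lle B x y} - {y. y \<in> flat_words True \<and> H \<notin> set y \<and> lle B x y}"
      then have "count_list y B = 0" using no_hub_words[OF lx, of y True] by auto
      then show "weight x y * whirl_KL (0 + count_list y B) = 0" by simp
    qed
    fix y assume y: "y \<in> {y. y \<in> flat_words True \<and> H \<notin> set y \<and> lle B x y}"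
    then have "y \<noteq> replicate n J" "x \<noteq> replicate n J" using x by (auto simp: flat_words_def)
    moreover have "count_list y B \<le> count_list x B \<and> weight x y = monom 1 (count_list x B - count_list y B)"
      using y weight_monom[of B x y] by simp
    moreover have "count_list x B \<le> n" using lx count_le_n by simp
    ultimately show "weight x y * whirl_KL (0 + count_list y B) =
        monom 1 (rank_of (W True) (flat_of y) - rank_of (W True) (flat_of x)) * kl True y"
      using y rank_flat_word[of y True] rank_flat_word[OF x(1)] by (simp add: kl_def)
  qed auto
  finally show ?thesis ..
qed

lemma KV_diff: "KV (\<lambda>k. f k - h k) s m = KV f s m - KV h s m"
  by (induction m arbitrary: s) (auto simp: algebra_simps smult_diff_right)

lemma replicate_J_flat_word: "replicate n J \<in> flat_words False"
proof -
  have "ltr (replicate n J) i = J" for i using n3 by (simp add: ltr_def)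
  then show ?thesis by (simp add: flat_words_def cyc_valid_def)
qed

lemma lle_replicate_J: "H \<notin> set x \<Longrightarrow> lle c x (replicate (length x) J)"
  by (induction x arbitrary: c) auto

text \<open>Words with a single block are no flats of the wheel, and there the whirl and defect
  values, both 1, cancel. The rim has value 1 but one rank less than its letters suggest, so it adds
  t^(m - 1) for m blocks. This cancels the last term of \<open>KV_defect\<close> and is the origin
  of the summand x in \<open>defect_series_eq\<close>.\<close>

lemma no_hub_sum_False:
  assumes x: "x \<in> flat_words False" "H \<notin> set x" "x \<noteq> replicate n J"
  shows "(\<Sum>y | y \<in> flat_words False \<and> H \<notin> set y \<and> lle B x y.
      monom 1 (rank_of (W False) (flat_of y) - rank_of (W False) (flat_of x)) * kl False y) =
    KV whirl_KL 0 (count_list x B) - (T * (q * q)) $ count_list x B"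
proof -
  let ?f = "\<lambda>y. monom 1 (rank_of (W False) (flat_of y) - rank_of (W False) (flat_of x)) * kl False y"
  let ?d = "\<lambda>k. whirl_KL k - defect_KL k"
  let ?S = "{y. y \<in> flat_words False \<and> H \<notin> set y \<and> lle B x y}"
  let ?R = "replicate n J"
  have lx: "length x = n" using x flat_words_length by simp
  have m: "count_list x B > 0" using no_hub_no_block[OF lx x(2)] x(3) by auto
  have m_le: "count_list x B \<le> n" using lx count_le_n by simp
  have fin: "finite {y. H \<notin> set y \<and> lle B x y}" by (rule finite_lle)
  have RS: "?R \<in> ?S" using replicate_J_flat_word lle_replicate_J[OF x(2), of B] lx n3 by simp
  have "KV ?d 0 (count_list x B) = (\<Sum>y | H \<notin> set y \<and> lle B x y. weight x y * ?d (0 + count_list y B))"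
    using x by (intro hubless_sum[symmetric]) auto
  also have "\<dots> = sum ?f (?S - {?R})"
  proof (rule sum.mono_neutral_cong_right)
    show "\<forall>y\<in>{y. H \<notin> set y \<and> lle B x y} - (?S - {?R}). weight x y * ?d (0 + count_list y B) = 0"
    proof
      fix y assume y: "y \<in> {y. H \<notin> set y \<and> lle B x y} - (?S - {?R})"
      then have "count_list y B = 1 \<or> y = ?R" using no_hub_words[OF lx, of y False] by auto
      then have "count_list y B = 1 \<or> count_list y B = 0" by (auto simp: count_list_0_iff)
      then show "weight x y * ?d (0 + count_list y B) = 0" by (auto simp: whirl_KL_1 defect_KL_1)
    qed
    fix y assume y: "y \<in> ?S - {?R}"
    then have "count_list y B \<noteq> 0" using no_hub_no_block flat_words_length by blast
    moreover have "count_list y B \<le> count_list x B \<and> weight x y = monom 1 (count_list x B - count_list y B)"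
      using y weight_monom[of B x y] by simp
    ultimately show "weight x y * ?d (0 + count_list y B) = ?f y"
      using y x(3) m_le rank_flat_word[of y False] rank_flat_word[OF x(1)] by (simp add: kl_def)
  qed (use fin in auto)
  finally have 1: "sum ?f (?S - {?R}) = KV whirl_KL 0 (count_list x B) - KV defect_KL 0 (count_list x B)"
    by (simp add: KV_diff)
  have "?f ?R = t ^ (count_list x B - 1)"
  proof -
    have c: "count_list ?R B = 0" by (simp add: count_list_0_iff)
    have "H \<notin> set ?R" by simp
    then have "kl False ?R = 1" using c by (simp add: kl_def)
    moreover have "n - 1 - (n - count_list x B) = count_list x B - 1" using m m_le by simp
    moreover have "monom 1 k = t ^ k" for k by (simp add: monom_altdef)
    ultimately show ?thesis
      using rank_flat_word[OF replicate_J_flat_word] rank_flat_word[OF x(1)] x(3) by simp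
  qed
  moreover have "sum ?f ?S = ?f ?R + sum ?f (?S - {?R})"
    using RS fin by (intro sum.remove) (auto intro: finite_subset)
  ultimately show ?thesis using 1 KV_defect[OF m] by simp
qed

definition Z_value :: "bool \<Rightarrow> nat \<Rightarrow> int poly" where
  "Z_value g m = (if g then \<beta> $ m else \<beta> $ m - (T * (q * q)) $ m)"

lemma upper_sum_hubless:
  assumes x: "x \<in> flat_words g" "H \<notin> set x" "x \<noteq> replicate n J"
  shows "upper_sum g x = Z_value g (count_list x B)"
proof -
  have lx: "length x = n" using x flat_words_length by simp
  have m: "count_list x B > 0" using no_hub_no_block[OF lx x(2)] x(3) by auto
  then have "B \<in> set x" by (metis count_list_0_iff not_gr0)
  then have h: "hub_sum x = \<beta> $ count_list x B - KV whirl_KL 0 (count_list x B)"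
    using hub_sum_hubless[OF x(2)] whirl_sum_eq[OF m] by simp
  show ?thesis
  proof (cases g)
    case True
    then show ?thesis using upper_sum_split[OF x(1,3)] no_hub_sum_True[of x] x h by (simp add: Z_value_def)
  next
    case False
    then show ?thesis using upper_sum_split[OF x(1,3)] no_hub_sum_False[of x] x h by (simp add: Z_value_def)
  qed
qed

lemma upper_sum_hub:
  assumes x: "x \<in> flat_words g" "H \<in> set x"
  shows "upper_sum g x = hub_sum x"
proof -
  have "x \<noteq> replicate n J" using x(2) by auto
  moreover have "H \<in> set y" if "lle c x y" for c y using that x(2)
    by (induction c x y rule: lle.induct) auto
  then have e: "{y. y \<in> flat_words g \<and> H \<notin> set y \<and> lle B x y} = {}" by blast
  ultimately show ?thesis using upper_sum_split[OF x(1)] unfolding e by simp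
qed

lemma palindromic_Z_value: "palindromic m (Z_value g m)"
  unfolding Z_value_def using palindromic_\<beta> palindromic_Tqq by (auto intro: palindromic_diff)

text \<open>Above the all-\<open>J\<close> word, an \<open>H\<close> forces its predecessor to be
  \<open>H\<close> as well; going around, only the rim and the whole ground set remain.\<close>

lemma upper_sum_rim:
  assumes "x \<in> flat_words g" "x = replicate n J"
  shows "upper_sum g x = 1 + t"
proof -
  have g: "\<not> g" using assms by (auto simp: flat_words_def)
  let ?H = "replicate n H"
  have HJ: "?H \<noteq> x" using assms n3 by (cases n) auto
  have up: "if c = H then y = replicate k H else y = replicate k J"
    if "lvalid c y" "lle c (replicate k J) y" for c k y
    using that
  proof (induction k arbitrary: c y)
    case 0 then show ?case by (cases y) auto
  next
    case (Suc k)
    then obtain y0 ys where y: "y = y0 # ys" by (cases y) auto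
    then show ?case using Suc.prems Suc.IH[of y0 ys] by (auto split: if_splits)
  qed
  have leH: "lle H (replicate k J) (replicate k H)" for k by (induction k) auto
  have cH: "count_list ?H B = 0" "count_list x B = 0" using assms by (auto simp: count_list_0_iff)
  have Hw: "?H \<in> flat_words g" using n3 by (auto simp: flat_words_def cyc_valid_def ltr_def)
  have "{y. y \<in> flat_words g \<and> flat_of x \<subseteq> flat_of y} = {x, ?H}"
  proof (intro set_eqI iffI)
    fix y assume y: "y \<in> {y. y \<in> flat_words g \<and> flat_of x \<subseteq> flat_of y}"
    then have l: "length y = n" by (auto dest: flat_words_length)
    then have "lvalid (last y) y" "lle (last y) (replicate n J) y"
      using y assms(2) by (auto simp: flat_words_def cyc_valid_iff flat_of_subset_iff cyc_le_iff)
    from up[OF this] show "y \<in> {x, ?H}" using assms(2) by (auto split: if_splits)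
  next
    fix y assume "y \<in> {x, ?H}"
    moreover have "flat_of x \<subseteq> flat_of ?H"
      using leH[of n] assms(2) n3 by (simp add: flat_of_subset_iff cyc_le_iff)
    ultimately show "y \<in> {y. y \<in> flat_words g \<and> flat_of x \<subseteq> flat_of y}" using Hw assms(1) by auto
  qed
  then have "upper_sum g x = kl g x + monom 1 (n - (n - 1)) * kl g ?H"
    using HJ rank_flat_word[OF assms(1)] rank_flat_word[OF Hw] cH assms(2) by (simp add: upper_sum_def)
  moreover have "kl g x = 1" using g assms(2) cH by (simp add: kl_def)
  moreover have "kl g ?H = 1" using hub_val_degree(1)[of ?H] cH n3 by (simp add: kl_def)
  moreover have "monom 1 (n - (n - 1)) = t" using n3 by (simp add: monom_altdef)
  ultimately show ?thesis by simp
qed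

lemma bottom_word: "replicate n B \<in> flat_words g" "flat_of (replicate n B) = {}"
proof -
  have b: "ltr (replicate n B) i = B" for i using n3 by (simp add: ltr_def)
  have "count_list (replicate k B) B = k" for k by (induction k) auto
  moreover have "replicate n B \<noteq> replicate n J" using n3 by simp
  ultimately show "replicate n B \<in> flat_words g" using b n3 by (simp add: flat_words_def cyc_valid_def)
  show "flat_of (replicate n B) = {}" by (simp add: flat_of_def b)
qed

lemma Z_poly_W: "Z_poly (W g) = Z_value g n"
proof -
  interpret M: matroid "W g" by (rule matroid_W)
  have eq: "Z_poly (W g) = (\<Sum>y\<in>flat_words g. monom 1 (rank_of (W g) (flat_of y)) * kl g y)"
  proof (rule M.Z_poly_characterization[OF loopless_W flat_of_bij])
    fix x assume x: "x \<in> flat_words g"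
    have lx: "length x = n" using x by (rule flat_words_length)
    note c = count_le_n[OF lx]
    show "kl g x = 1" if "rank_of (W g) (flat_of x) = rk (W g)"
    proof -
      have xJ: "x \<noteq> replicate n J" "count_list x B = 0"
        using that c n3 unfolding rank_flat_word[OF x] rk_W by (auto split: if_splits)
      then have "H \<in> set x" using no_hub_no_block[OF lx] by blast
      then show ?thesis using hub_val_degree(1) xJ by (simp add: kl_def)
    qed
    show "2 * degree (kl g x) < rk (W g) - rank_of (W g) (flat_of x)"
      if "rank_of (W g) (flat_of x) < rk (W g)"
    proof (cases "x = replicate n J")
      case True
      then have "kl g x = 1" using x by (auto simp: kl_def flat_words_def count_list_0_iff)
      then show ?thesis using that by simp
    next
      case False
      then have r: "rk (W g) - rank_of (W g) (flat_of x) = count_list x B" "count_list x B > 0"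
        using that c unfolding rank_flat_word[OF x] rk_W by auto
      show ?thesis unfolding r(1)
        using hub_val_degree(2)[of x] whirl_KL_degree[OF r(2)] defect_KL_degree[OF r(2)] r(2)
          degree_diff_le_max[of "whirl_KL (count_list x B)" "defect_KL (count_list x B)"]
        by (auto simp: kl_def)
    qed
    show "palindromic (rk (W g) - rank_of (W g) (flat_of x))
      (\<Sum>y | y \<in> flat_words g \<and> flat_of x \<subseteq> flat_of y.
          monom 1 (rank_of (W g) (flat_of y) - rank_of (W g) (flat_of x)) * kl g y)"
      unfolding upper_sum_def[symmetric]
    proof (cases "x = replicate n J")
      case True
      then show "palindromic (rk (W g) - rank_of (W g) (flat_of x)) (upper_sum g x)"
        using upper_sum_rim[OF x True] palindromic_1t n3 unfolding rank_flat_word[OF x] rk_W by simp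
    next
      case False
      then have "rk (W g) - rank_of (W g) (flat_of x) = count_list x B"
        using c unfolding rank_flat_word[OF x] rk_W by auto
      then show "palindromic (rk (W g) - rank_of (W g) (flat_of x)) (upper_sum g x)"
        using upper_sum_hub[OF x] upper_sum_hubless[OF x _ False] hub_sum_palindromic[of x] palindromic_Z_value
        by (cases "H \<in> set x") auto
    qed
  qed
  have "rank_of (W g) {} = 0" by simp
  then have "Z_poly (W g) = upper_sum g (replicate n B)"
    unfolding eq upper_sum_def bottom_word(2) by simp
  also have "\<dots> = Z_value g (count_list (replicate n B) B)"
    using n3 by (intro upper_sum_hubless bottom_word(1)) (auto simp: replicate_eq_replicate)
  also have "count_list (replicate k B) B = k" for k by (induction k) auto
  finally show ?thesis .
qed

end

lemma Z_graph_wheel: "n \<ge> 3 \<Longrightarrow> Z_graph (wheel_graph n) = \<beta> $ n - (T * (q * q)) $ n"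
proof -
  assume "n \<ge> 3"
  then interpret wheel n by unfold_locales
  show ?thesis using Z_poly_W[of False] by (simp add: Z_graph_def graphic_wheel Z_value_def)
qed

lemma Z_poly_whirl: "n \<ge> 3 \<Longrightarrow> Z_poly (whirl_matroid n) = \<beta> $ n"
proof -
  assume "n \<ge> 3"
  then interpret wheel n by unfold_locales
  show ?thesis using Z_poly_W[of True] by (simp add: whirl_eq Z_value_def)
qed

lemma lle_replicate_H: "lle H u (replicate (length u) H)"
  by (induction u) auto

text \<open>The fan on \<open>k\<close> path vertices is the restriction of the whirl of rank \<open>k + 2\<close> to a flat.\<close>

locale fan_in_whirl = wheel +
  fixes k :: nat
  assumes k: "k + 2 = n" "k \<ge> 1"
begin

text \<open>Two extra rim vertices, because \<open>n \<ge> 3\<close> must hold already for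
  \<open>k = 1\<close>.\<close>

definition fan_word :: "letter list" where "fan_word = replicate k H @ [B, B]"

lemma ltr_fan_word: "ltr fan_word i = (if i mod n < k then H else B)"
proof -
  have "i mod n < k + 2" using n3 k by (metis mod_less_divisor zero_less_numeral less_le_trans)
  then show ?thesis by (auto simp: ltr_def fan_word_def nth_append nth_Cons')
qed

lemma edges_fan: "edges (fan_graph k) = flat_of fan_word"
proof (intro set_eqI iffI)
  fix x assume "x \<in> edges (fan_graph k)"
  then consider i where "x = {i, i + 1}" "1 \<le> i" "i < k" | i where "x = {0, i}" "1 \<le> i" "i \<le> k"
    by (auto simp: fan_graph_def)
  then show "x \<in> flat_of fan_word"
  proof cases
    case 1
    then have "x = rm (i - 1)" using k by (simp add: rimedge_def)
    moreover have "rm (i - 1) \<in> flat_of fan_word" using 1 k by (simp add: ltr_fan_word)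
    ultimately show ?thesis by metis
  next
    case 2
    then have "x = sp (i - 1)" using k by (simp add: spoke_def)
    moreover have "sp (i - 1) \<in> flat_of fan_word" using 2 k by (simp add: ltr_fan_word)
    ultimately show ?thesis by metis
  qed
next
  fix x assume x: "x \<in> flat_of fan_word"
  then have "x \<in> E" using flat_of_E by blast
  then show "x \<in> edges (fan_graph k)"
  proof (cases rule: E_cases)
    case (1 i)
    then have "i < k" using x by (simp add: ltr_fan_word split: if_splits)
    then have "x = {0, Suc i}" "1 \<le> Suc i" "Suc i \<le> k" using 1 k by (auto simp: spoke_def)
    then show ?thesis unfolding fan_graph_def by auto
  next
    case (2 i)
    then have "i < k" "Suc i mod n < k" using x by (auto simp: ltr_fan_word split: if_splits)
    then have "Suc i < k" using k by simp
    then have "x = {Suc i, Suc i + 1}" "1 \<le> Suc i" "Suc i < k" using 2 k by (auto simp: rimedge_def)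
    then show ?thesis unfolding fan_graph_def by auto
  qed
qed

lemma graphic_fan: "graphic_matroid (fan_graph k) = localization (W True) (flat_of fan_word)"
proof -
  have "rm k \<notin> flat_of fan_word" using k by (simp add: ltr_fan_word)
  then have nr: "\<not> rim n \<subseteq> flat_of fan_word" unfolding rim_eq by blast
  have "X \<subseteq> flat_of fan_word \<and> forest X \<longleftrightarrow> indep True X \<and> X \<subseteq> flat_of fan_word" for X
    using forest_iff[of X] nr flat_of_E[of fan_word] unfolding indep_def by blast
  then show ?thesis by (simp add: graphic_matroid_def localization_def edges_fan)
qed

text \<open>The first path vertex has no predecessor to be joined to; an imagined \<open>H\<close>
  in front expresses this, since it forbids a leading \<open>J\<close>.\<close>

definition fan_words :: "letter list set" where
  "fan_words = {u. length u = k \<and> lvalid H u}"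

lemma fan_word_length: "length fan_word = n"
  using k by (simp add: fan_word_def)

lemma fan_words_below:
  "w \<in> flat_words True \<and> flat_of w \<subseteq> flat_of fan_word \<longleftrightarrow> (\<exists>u \<in> fan_words. w = u @ [B, B])"
proof
  assume w: "w \<in> flat_words True \<and> flat_of w \<subseteq> flat_of fan_word"
  then have l: "length w = n" by (auto dest: flat_words_length)
  define u v where "u = take k w" and "v = drop k w"
  have wuv: "w = u @ v" and lu: "length u = k" using l k by (simp_all add: u_def v_def)
  have "length v = Suc (Suc 0)" using l k by (simp add: v_def)
  then obtain a b where v: "v = [a, b]" by (auto simp: length_Suc_conv)
  have "lle B (u @ [a, b]) (replicate k H @ [B, B])"
    using w l fan_word_length cyc_le_iff[of w fan_word]
    unfolding flat_of_subset_iff wuv v by (simp add: fan_word_def)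
  then have le: "lle B u (replicate k H)" "lle (last (B # replicate k H)) [a, b] [B, B]"
    using lu by (auto simp: lle_append)
  then have ab: "a = B" "b = B" by (cases a; cases b; auto)+
  have "lvalid B u" using w unfolding wuv v ab by (auto simp: flat_words_def cyc_valid_iff lvalid_append)
  obtain x xs where u: "u = x # xs" using lu k by (cases u) auto
  obtain k' where "k = Suc k'" using k by (cases k) auto
  then have "x \<noteq> J" using le(1) u by auto
  then have "lvalid H u" using \<open>lvalid B u\<close> u by simp
  then show "\<exists>u \<in> fan_words. w = u @ [B, B]" using lu wuv v ab by (auto simp: fan_words_def)
next
  assume "\<exists>u \<in> fan_words. w = u @ [B, B]"
  then obtain u where u: "length u = k" "lvalid H u" and w: "w = u @ [B, B]" by (auto simp: fan_words_def)
  obtain x xs where x: "u = x # xs" using u k by (cases u) auto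
  then have v: "lvalid B u" "x \<noteq> J" using u by auto
  have "w \<noteq> replicate n J"
  proof
    assume "w = replicate n J"
    moreover have "B \<in> set w" using w by simp
    ultimately have "B \<in> set (replicate n J)" by metis
    then show False by simp
  qed
  then have "w \<in> flat_words True"
    using u v w k by (simp add: flat_words_def cyc_valid_iff lvalid_append)
  moreover have "lle B u (replicate k H)"
    using lle_replicate_H[of xs] x v u by (cases k) auto
  then have "lle B w fan_word" using u w by (simp add: lle_append fan_word_def)
  then have "flat_of w \<subseteq> flat_of fan_word"
    using u w k fan_word_length by (simp add: flat_of_subset_iff cyc_le_iff fan_word_def)
  ultimately show "w \<in> flat_words True \<and> flat_of w \<subseteq> flat_of fan_word" by blast
qed

lemma fan_words_subset_iff:
  assumes "u \<in> fan_words" "u' \<in> fan_words"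
  shows "flat_of (u @ [B, B]) \<subseteq> flat_of (u' @ [B, B]) \<longleftrightarrow> lle H u u'"
proof -
  have l: "length u = k" "length u' = k" "lvalid H u" using assms by (auto simp: fan_words_def)
  then have "flat_of (u @ [B, B]) \<subseteq> flat_of (u' @ [B, B]) \<longleftrightarrow> lle B u u'"
    using k by (simp add: flat_of_subset_iff cyc_le_iff lle_append)
  also have "\<dots> \<longleftrightarrow> lle H u u'" using l by (cases u; cases u') auto
  finally show ?thesis .
qed

lemma Z_poly_fan: "Z_poly (graphic_matroid (fan_graph k)) = q $ Suc k"
proof -
  let ?M = "localization (W True) (flat_of fan_word)"
  let ?\<Phi> = "\<lambda>u. flat_of (u @ [B, B])"
  interpret W: matroid "W True" by (rule matroid_W)
  have top: "replicate k H \<in> fan_words"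
  proof -
    have "lvalid H (replicate j H)" for j by (induction j) auto
    then show ?thesis by (simp add: fan_words_def)
  qed
  have FW: "fan_word \<in> flat_words True" using fan_words_below[of fan_word] top by (auto simp: fan_word_def)
  then have F: "flat_of fan_word \<in> flats (W True)" by (rule flat_of_flat_words)
  have Fg: "flat_of fan_word \<subseteq> ground (W True)" using F by (rule W.flat_ground)
  interpret M: matroid ?M by (rule W.matroid_localization[OF Fg])
  have ll: "loopless ?M" using W.loopless_localization[OF loopless_W Fg] .
  have wd: "u @ [B, B] \<in> flat_words True" "?\<Phi> u \<subseteq> flat_of fan_word" if "u \<in> fan_words" for u
    using fan_words_below that by blast+
  have rank: "rank_of ?M (?\<Phi> u) = k - count_list u B" if "u \<in> fan_words" for u
  proof -
    have "u @ [B, B] \<noteq> replicate n J"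
    proof
      assume "u @ [B, B] = replicate n J"
      moreover have "B \<in> set (u @ [B, B])" by simp
      ultimately have "B \<in> set (replicate n J)" by metis
      then show False by simp
    qed
    then show ?thesis using rank_flat_word[OF wd(1)[OF that]] k
      by (simp add: W.rank_localization[OF wd(2)[OF that]])
  qed
  have rk: "rk ?M = k"
  proof -
    have "count_list (replicate j H) B = 0" for j by (induction j) auto
    then show ?thesis using rank[OF top] unfolding rk_def by (simp add: fan_word_def)
  qed
  have count: "count_list u B \<le> k" if "u \<in> fan_words" for u
    using that count_le_length[of u B] by (simp add: fan_words_def)
  have bij: "bij_betw ?\<Phi> fan_words (flats ?M)"
  proof (rule bij_betw_imageI)
    show "inj_on ?\<Phi> fan_words"
    proof (rule inj_onI)
      fix u u' assume u: "u \<in> fan_words" "u' \<in> fan_words" "?\<Phi> u = ?\<Phi> u'"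
      then have "u @ [B, B] = u' @ [B, B]"
        using flat_of_bij[of True] wd(1) unfolding bij_betw_def by (metis inj_onD)
      then show "u = u'" by simp
    qed
    have "flats ?M = flat_of ` {w. w \<in> flat_words True \<and> flat_of w \<subseteq> flat_of fan_word}"
      unfolding W.flats_localization[OF F] bij_betw_imp_surj_on[OF flat_of_bij[of True], symmetric] by blast
    also have "{w. w \<in> flat_words True \<and> flat_of w \<subseteq> flat_of fan_word} = (\<lambda>u. u @ [B, B]) ` fan_words"
      using fan_words_below by auto
    finally show "?\<Phi> ` fan_words = flats ?M" by (simp add: image_image)
  qed
  have fan_sum: "(\<Sum>y | y \<in> fan_words \<and> ?\<Phi> x \<subseteq> ?\<Phi> y. monom 1 (rank_of ?M (?\<Phi> y) - rank_of ?M (?\<Phi> x)) * run_val 0 y) =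
      TT 0 x []" if x: "x \<in> fan_words" for x
  proof -
    have "{y. y \<in> fan_words \<and> ?\<Phi> x \<subseteq> ?\<Phi> y} = up H x []"
    proof (intro set_eqI iffI)
      fix y assume y: "y \<in> {y. y \<in> fan_words \<and> ?\<Phi> x \<subseteq> ?\<Phi> y}"
      then show "y \<in> up H x []" using fan_words_subset_iff[OF x] x by (auto simp: up_def fan_words_def)
    next
      fix y assume y: "y \<in> up H x []"
      then have "y \<in> fan_words" using x lle_length[of H x y] by (auto simp: up_def fan_words_def)
      then show "y \<in> {y. y \<in> fan_words \<and> ?\<Phi> x \<subseteq> ?\<Phi> y}"
        using fan_words_subset_iff[OF x] y by (auto simp: up_def)
    qed
    moreover have "monom 1 (rank_of ?M (?\<Phi> y) - rank_of ?M (?\<Phi> x)) = weight (x @ []) y" if y: "y \<in> up H x []" for y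
    proof -
      have yf: "y \<in> fan_words" using calculation y by blast
      have "count_list y B \<le> count_list x B \<and> weight x y = monom 1 (count_list x B - count_list y B)"
        using y by (intro weight_monom[of H]) (simp add: up_def)
      then show ?thesis using rank[OF x] rank[OF yf] count[OF x] by simp
    qed
    moreover have "(\<Sum>y\<in>up H x []. weight (x @ []) y * run_val 0 y) = TT 0 x []" by (rule sum_up_TT) auto
    ultimately show ?thesis by simp
  qed
  have "Z_poly ?M = (\<Sum>y\<in>fan_words. monom 1 (rank_of ?M (?\<Phi> y)) * run_val 0 y)"
  proof (rule M.Z_poly_characterization[OF ll bij])
    fix x assume x: "x \<in> fan_words"
    note c = count[OF x]
    show "run_val 0 x = 1" if "rank_of ?M (?\<Phi> x) = rk ?M"
      using that c run_val_degree[of 0 x] k(2) unfolding rank[OF x] rk by auto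
    show "2 * degree (run_val 0 x) < rk ?M - rank_of ?M (?\<Phi> x)" if "rank_of ?M (?\<Phi> x) < rk ?M"
      using that c run_val_degree[of 0 x] unfolding rank[OF x] rk by auto
    show "palindromic (rk ?M - rank_of ?M (?\<Phi> x))
      (\<Sum>y | y \<in> fan_words \<and> ?\<Phi> x \<subseteq> ?\<Phi> y. monom 1 (rank_of ?M (?\<Phi> y) - rank_of ?M (?\<Phi> x)) * run_val 0 y)"
      unfolding fan_sum[OF x] using palindromic_TT[of x] c unfolding rank[OF x] rk by simp
  qed
  also have "\<dots> = q $ Suc k"
  proof -
    let ?b = "replicate k B"
    have cb: "count_list (replicate j B) B = j" "lvalid B (replicate j B)" for j by (induction j) auto
    have "lvalid H ?b" using cb(2)[of "k - 1"] k(2) by (cases k) auto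
    then have b: "?b \<in> fan_words" by (simp add: fan_words_def)
    have "ltr (?b @ [B, B]) i = B" for i
    proof -
      have "?b @ [B, B] = replicate n B" unfolding k(1)[symmetric] replicate_add by (simp add: numeral_2_eq_2)
      then show ?thesis using n3 by (simp add: ltr_def)
    qed
    then have "?\<Phi> ?b = {}" by (simp add: flat_of_def)
    moreover have "rank_of ?M (?\<Phi> ?b) = 0" using rank[OF b] cb by simp
    ultimately have "(\<Sum>y\<in>fan_words. monom 1 (rank_of ?M (?\<Phi> y)) * run_val 0 y) = TT 0 ?b []"
      using fan_sum[OF b] by simp
    also have "\<dots> = q $ Suc k" using cb by (simp add: TT_count KT_eq_q)
    finally show ?thesis .
  qed
  finally show ?thesis by (simp add: graphic_fan)
qed

end

lemma Z_graph_fan: "n \<ge> 1 \<Longrightarrow> Z_graph (fan_graph n) = q $ Suc n"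
proof -
  assume "n \<ge> 1"
  then interpret fan_in_whirl "n + 2" n by unfold_locales auto
  show ?thesis by (simp add: Z_graph_def Z_poly_fan)
qed

section \<open>Real zeros\<close>

text \<open>The series with q = x \<phi>(q), as in Lagrange inversion.\<close>

definition \<phi> :: "int poly fps" where "\<phi> = (1 + fps_X) * (1 + T * fps_X)"

lemma q_power_Suc:
  "(q ^ Suc k) $ Suc n = (q ^ k) $ n + (1 + t) * (q ^ Suc k) $ n + t * (q ^ Suc (Suc k)) $ n"
proof -
  have "q ^ Suc k = q * q ^ k" by simp
  also have "\<dots> = (fps_X * (1 + q) * (1 + T * q)) * q ^ k" by (subst (1) q_eq) (rule refl)
  also have "\<dots> = fps_X * (q ^ k + (1 + T) * q ^ Suc k + T * q ^ Suc (Suc k))"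
    by (simp add: algebra_simps)
  finally have "(q ^ Suc k) $ Suc n = (fps_X * (q ^ k + (1 + T) * q ^ Suc k + T * q ^ Suc (Suc k))) $ Suc n"
    by metis
  then show ?thesis by (simp only: fps_X_mult_nth fps_add_nth distrib_right mult_1_left fps_mult_left_const_nth) simp
qed

text \<open>The linear algebra behind the induction in \<open>lagrange_q\<close>: \<open>c0\<close>,
  \<open>c1\<close>, \<open>c2\<close> are coefficients of x^j \<phi>^n for consecutive j,
  \<open>d1\<close>, \<open>d2\<close>, \<open>d3\<close> belong to the derivative of \<phi>^n, and
  the last hypothesis is the differential equation of \<phi>^n.\<close>

lemma lagrange_step:
  fixes N K c0 c1 c2 d1 d2 d3 \<tau> :: "'a::comm_ring_1"
  assumes "N * c0 = K * c0 + d1" "N * c1 = (K + 1) * c1 + d2" "N * c2 = (K + 2) * c2 + d3"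
    "d1 + (1 + \<tau>) * d2 + \<tau> * d3 = N * ((1 + \<tau>) * c1 + 2 * \<tau> * c2)"
  shows "(N + 1) * (K * c0 + (1 + \<tau>) * ((K + 1) * c1) + \<tau> * ((K + 2) * c2)) =
    N * ((K + 1) * (c0 + (1 + \<tau>) * c1 + \<tau> * c2))"
proof -
  have "(N + 1) * (K * c0 + (1 + \<tau>) * ((K + 1) * c1) + \<tau> * ((K + 2) * c2)) -
      N * ((K + 1) * (c0 + (1 + \<tau>) * c1 + \<tau> * c2)) =
    - (N * c0 - (K * c0 + d1)) - (1 + \<tau>) * (N * c1 - ((K + 1) * c1 + d2)) - \<tau> * (N * c2 - ((K + 2) * c2 + d3))
    - ((d1 + (1 + \<tau>) * d2 + \<tau> * d3) - N * ((1 + \<tau>) * c1 + 2 * \<tau> * c2))"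
    by (simp add: algebra_simps)
  also have "\<dots> = 0" using assms by simp
  finally show ?thesis by simp
qed

lemma X_deriv_X_power: "fps_X * fps_deriv (fps_X ^ k) = of_nat k * (fps_X ^ k :: 'a::comm_ring_1 fps)"
  by (induction k) (simp_all add: algebra_simps)

lemma mult_deriv_power:
  fixes f :: "'a::comm_ring_1 fps"
  shows "f * fps_deriv (f ^ n) = of_nat n * (fps_deriv f * f ^ n)"
proof (induction n)
  case (Suc n)
  have "f * fps_deriv (f ^ Suc n) = fps_deriv f * f ^ Suc n + f * (f * fps_deriv (f ^ n))"
    by (simp add: algebra_simps)
  then show ?case unfolding Suc.IH by (simp add: algebra_simps)
qed simp

lemma X_power_deriv_nth:
  fixes \<Psi> :: "int poly fps"
  shows "of_nat n * (fps_X ^ k * \<Psi>) $ n = of_nat k * (fps_X ^ k * \<Psi>) $ n + (fps_X ^ Suc k * fps_deriv \<Psi>) $ n"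
proof -
  have "fps_X * fps_deriv (fps_X ^ k * \<Psi>) = of_nat k * (fps_X ^ k * \<Psi>) + fps_X ^ Suc k * fps_deriv \<Psi>"
  proof -
    have "fps_X * fps_deriv (fps_X ^ k * \<Psi>) = (fps_X * fps_deriv (fps_X ^ k)) * \<Psi> + fps_X ^ Suc k * fps_deriv \<Psi>"
      by (simp add: algebra_simps)
    then show ?thesis unfolding X_deriv_X_power by (simp add: mult.assoc)
  qed
  moreover have "(fps_X * fps_deriv f) $ n = of_nat n * f $ n" for f :: "int poly fps"
    by (cases n) auto
  ultimately have "of_nat n * (fps_X ^ k * \<Psi>) $ n = (of_nat k * (fps_X ^ k * \<Psi>) + fps_X ^ Suc k * fps_deriv \<Psi>) $ n"
    by metis
  also have "of_nat k * (fps_X ^ k * \<Psi>) = fps_const (of_nat k) * (fps_X ^ k * \<Psi>)"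
    by (simp add: fps_of_nat)
  finally show ?thesis by (simp only: fps_add_nth fps_mult_left_const_nth)
qed

text \<open>Lagrange inversion without residues: q = x \<phi>(q) expresses a coefficient of q^k
  through three consecutive powers one degree lower, and the right-hand side obeys the same
  relation. The induction therefore treats all exponents \<open>k\<close> at once.\<close>

lemma lagrange_q: "of_nat n * (q ^ k) $ n = of_nat k * (fps_X ^ k * \<phi> ^ n) $ n"
proof (induction n arbitrary: k)
  case 0 then show ?case by (cases k) auto
next
  case (Suc n)
  show ?case
  proof (cases k)
    case 0 then show ?thesis by simp
  next
    case k: (Suc k')
    have R: "(fps_X ^ k * \<phi> ^ Suc n) $ Suc n = (fps_X ^ k' * (\<phi> * \<phi> ^ n)) $ n"
      by (simp add: k mult.assoc)
    show ?thesis
    \<comment> \<open>The general step multiplies the claim by \<open>n\<close> and cancels it, so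
      this case is done by hand.\<close>
    proof (cases "n = 0")
      case True
      have "(q ^ k) $ Suc n = (if k' = 0 then 1 else 0)" unfolding k True by (subst q_power_Suc) simp
      moreover have "(fps_X ^ k * \<phi> ^ Suc n) $ Suc n = (if k' = 0 then 1 else 0)"
        unfolding R unfolding True by (cases k') (auto simp: \<phi>_def)
      ultimately show ?thesis using True by (simp only: k) simp
    next
      case False
      define \<Psi> where "\<Psi> = \<phi> ^ n"
      define c where "c j = (fps_X ^ (k' + j) * \<Psi>) $ n" for j
      define d where "d j = (fps_X ^ (k' + j) * fps_deriv \<Psi>) $ n" for j
      have c: "of_nat n * c j = of_nat (k' + j) * c j + d (Suc j)" for j
        unfolding c_def d_def using X_power_deriv_nth[of n "k' + j" \<Psi>] by simp
      have ode: "\<phi> * fps_deriv \<Psi> = of_nat n * ((1 + T + 2 * T * fps_X) * \<Psi>)"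
      proof -
        have "fps_deriv \<phi> = 1 + T + 2 * T * fps_X" by (simp add: \<phi>_def algebra_simps)
        then show ?thesis unfolding \<Psi>_def by (simp only: mult_deriv_power)
      qed
      have "fps_X ^ Suc k' * (\<phi> * fps_deriv \<Psi>) = fps_X ^ (k' + 1) * fps_deriv \<Psi> +
          (1 + T) * (fps_X ^ (k' + 2) * fps_deriv \<Psi>) + T * (fps_X ^ (k' + 3) * fps_deriv \<Psi>)"
        by (simp add: \<phi>_def algebra_simps power_add eval_nat_numeral)
      moreover have "fps_X ^ Suc k' * (of_nat n * ((1 + T + 2 * T * fps_X) * \<Psi>)) =
          fps_const (of_nat n) * ((1 + T) * (fps_X ^ (k' + 1) * \<Psi>) + (2 * T) * (fps_X ^ (k' + 2) * \<Psi>))"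
        by (simp add: algebra_simps power_add eval_nat_numeral fps_of_nat)
      ultimately have "fps_X ^ (k' + 1) * fps_deriv \<Psi> +
          fps_const (1 + t) * (fps_X ^ (k' + 2) * fps_deriv \<Psi>) + T * (fps_X ^ (k' + 3) * fps_deriv \<Psi>) =
          fps_const (of_nat n) * (fps_const (1 + t) * (fps_X ^ (k' + 1) * \<Psi>) + fps_const (2 * t) * (fps_X ^ (k' + 2) * \<Psi>))"
        using ode by (simp only: fps_const_add[symmetric] fps_const_mult[symmetric] fps_const_1_eq_1 numeral_fps_const)
      then have "(fps_X ^ (k' + 1) * fps_deriv \<Psi> +
          fps_const (1 + t) * (fps_X ^ (k' + 2) * fps_deriv \<Psi>) + T * (fps_X ^ (k' + 3) * fps_deriv \<Psi>)) $ n =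
          (fps_const (of_nat n) * (fps_const (1 + t) * (fps_X ^ (k' + 1) * \<Psi>) + fps_const (2 * t) * (fps_X ^ (k' + 2) * \<Psi>))) $ n"
        by metis
      then have D: "d 1 + (1 + t) * d 2 + t * d 3 = of_nat n * ((1 + t) * c 1 + 2 * t * c 2)"
        by (simp only: fps_add_nth fps_mult_left_const_nth c_def d_def)
      have S1: "(of_nat n + 1) * (of_nat k' * c 0 + (1 + t) * ((of_nat k' + 1) * c 1) + t * ((of_nat k' + 2) * c 2)) =
          of_nat n * ((of_nat k' + 1) * (c 0 + (1 + t) * c 1 + t * c 2))"
        by (rule lagrange_step[OF _ _ _ D]) (use c[of 0] c[of 1] c[of 2] in \<open>simp_all add: eval_nat_numeral\<close>)
      have S2: "of_nat n * (q ^ k) $ Suc n = of_nat k' * c 0 + (1 + t) * ((of_nat k' + 1) * c 1) + t * ((of_nat k' + 2) * c 2)"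
      proof -
        have "of_nat n * (q ^ k) $ Suc n = of_nat n * (q ^ k') $ n + (1 + t) * (of_nat n * (q ^ Suc k') $ n) +
            t * (of_nat n * (q ^ Suc (Suc k')) $ n)"
          unfolding k q_power_Suc by (simp only: distrib_left mult.left_commute)
        also have "\<dots> = of_nat k' * c 0 + (1 + t) * (of_nat (Suc k') * c 1) + t * (of_nat (Suc (Suc k')) * c 2)"
          unfolding Suc.IH c_def \<Psi>_def by (simp only: add_0_right Suc_eq_plus1[symmetric] add_2_eq_Suc')
        finally show ?thesis by (simp only: of_nat_Suc ac_simps one_add_one[symmetric])
      qed
      have S3: "(fps_X ^ k * \<phi> ^ Suc n) $ Suc n = c 0 + (1 + t) * c 1 + t * c 2"
      proof -
        have "fps_X ^ k' * (\<phi> * \<phi> ^ n) = fps_X ^ (k' + 0) * \<Psi> + fps_const (1 + t) * (fps_X ^ (k' + 1) * \<Psi>) + T * (fps_X ^ (k' + 2) * \<Psi>)"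
          unfolding \<Psi>_def \<phi>_def fps_const_add[symmetric] fps_const_1_eq_1
          by (simp add: algebra_simps power_add eval_nat_numeral)
        then show ?thesis unfolding R c_def by (simp only: fps_add_nth fps_mult_left_const_nth)
      qed
      have "of_nat n * (of_nat (Suc n) * (q ^ k) $ Suc n) = (of_nat n + 1) * (of_nat n * (q ^ k) $ Suc n)"
        by (simp only: of_nat_Suc ac_simps)
      also have "\<dots> = of_nat n * ((of_nat k' + 1) * (fps_X ^ k * \<phi> ^ Suc n) $ Suc n)"
        unfolding S2 S3 by (rule S1)
      finally have "of_nat n * (of_nat (Suc n) * (q ^ k) $ Suc n) =
          of_nat n * (of_nat k * (fps_X ^ k * \<phi> ^ Suc n) $ Suc n)"
        by (simp only: k of_nat_Suc add.commute)
      then show ?thesis using False by (simp only: mult_cancel_left of_nat_eq_0_iff simp_thms)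
    qed
  qed
qed

text \<open>Differentiating q = x \<phi>(q) gives \<beta> (1 - t q^2) = \<phi>(q). This rids 2
  \<beta> of products and leaves a linear relation between coefficients of \<beta> and q.\<close>

lemma \<beta>_q_relation: "of_nat 2 * \<beta> $ n = of_nat (n + 2) * q $ Suc n - of_nat n * ((1 + t) * q $ n)"
proof -
  define P where "P = (1 + q) * (1 + T * q)"
  have q: "q = fps_X * P" using q_eq by (simp add: P_def mult.assoc)
  have q': "fps_deriv q = \<beta> * P" using \<beta>' by (simp add: P_def)
  have 1: "\<beta> * (1 - T * (q * q)) = P"
  proof -
    have "fps_deriv q = P + fps_X * fps_deriv P" by (subst (1) q) simp
    moreover have "fps_deriv P = (1 + T + 2 * (T * q)) * fps_deriv q"
      by (simp add: P_def algebra_simps)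
    ultimately have "\<beta> * P = P + fps_X * ((1 + T + 2 * (T * q)) * (\<beta> * P))" using q' by simp
    also have "\<dots> = P + (1 + T + 2 * (T * q)) * (\<beta> * (fps_X * P))" by (simp add: ac_simps)
    also have "\<dots> = P + (1 + T + 2 * (T * q)) * (\<beta> * q)" by (simp add: q[symmetric])
    finally have "\<beta> * P - (1 + T + 2 * (T * q)) * (\<beta> * q) = P" by (simp add: algebra_simps)
    then show ?thesis by (simp add: P_def algebra_simps)
  qed
  have "q + fps_X * fps_deriv q - (1 + T) * (fps_X * (fps_X * fps_deriv q)) =
      fps_X * (P + \<beta> * P - (1 + T) * (\<beta> * (fps_X * P)))"
    unfolding q' by (subst (1) q) (simp add: algebra_simps)
  also have "P + \<beta> * P - (1 + T) * (\<beta> * (fps_X * P)) = 2 * \<beta>"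
  proof -
    have "P + \<beta> * P - (1 + T) * (\<beta> * (fps_X * P)) = \<beta> * (1 - T * (q * q)) + \<beta> * P - (1 + T) * (\<beta> * q)"
      unfolding 1 q[symmetric] ..
    also have "\<dots> = 2 * \<beta>" by (simp add: P_def algebra_simps)
    finally show ?thesis .
  qed
  finally have "(q + fps_X * fps_deriv q - fps_const (1 + t) * (fps_X * (fps_X * fps_deriv q))) $ Suc n =
      (fps_X * (fps_const 2 * \<beta>)) $ Suc n" by (simp add: numeral_fps_const fps_const_add[symmetric] del: fps_const_add)
  then have "q $ Suc n + of_nat (Suc n) * q $ Suc n - (1 + t) * (of_nat n * q $ n) = 2 * \<beta> $ n"
    by (cases n) (simp_all only: fps_add_nth fps_sub_nth fps_mult_left_const_nth fps_X_mult_nth fps_deriv_nth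
        Suc_eq_plus1[symmetric] nat.simps simp_thms if_False if_True diff_Suc_1 diff_Suc_Suc of_nat_0 mult_zero_left mult_zero_right)
  then show ?thesis by (simp add: algebra_simps)
qed

lemma F_Suc: "(\<phi> ^ Suc n) $ m = (\<phi> ^ n) $ m + (1 + t) * (fps_X * \<phi> ^ n) $ m + t * (fps_X ^ 2 * \<phi> ^ n) $ m"
proof -
  have "\<phi> ^ Suc n = \<phi> ^ n + fps_const (1 + t) * (fps_X * \<phi> ^ n) + T * (fps_X ^ 2 * \<phi> ^ n)"
    unfolding fps_const_add[symmetric] fps_const_1_eq_1
    by (simp add: \<phi>_def algebra_simps power2_eq_square)
  then show ?thesis by (simp only: fps_add_nth fps_mult_left_const_nth)
qed

text \<open>The second form of Lagrange inversion, for x q' / q, deduced from the first with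
  exponents 1 and 2 and from \<phi>^(n + 1) = \<phi> \<phi>^n.\<close>

lemma \<beta>_nth: "\<beta> $ n = (\<phi> ^ n) $ n"
proof -
  have 1: "of_nat (Suc n) * q $ Suc n = (\<phi> ^ Suc n) $ n" using lagrange_q[of "Suc n" 1] by simp
  have 2: "of_nat n * q $ n = (fps_X * \<phi> ^ n) $ n" using lagrange_q[of n 1] by simp
  have 3: "of_nat n * (q ^ 2) $ n = 2 * (fps_X ^ 2 * \<phi> ^ n) $ n" using lagrange_q[of n 2] by simp
  have qq: "n > 0 \<Longrightarrow> q $ Suc n = (1 + t) * q $ n + t * (q ^ 2) $ n"
    using q_power_Suc[of 0 n] by (simp add: power2_eq_square)
  have "2 * (\<phi> ^ n) $ n = 2 * ((\<phi> ^ Suc n) $ n) - (1 + t) * (2 * (fps_X * \<phi> ^ n) $ n) - t * (2 * (fps_X ^ 2 * \<phi> ^ n) $ n)"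
    unfolding F_Suc by (simp add: algebra_simps)
  also have "\<dots> = of_nat 2 * (of_nat (Suc n) * q $ Suc n) - (1 + t) * (2 * (of_nat n * q $ n)) - t * (of_nat n * (q ^ 2) $ n)"
    unfolding 1 2 3 by simp
  also have "\<dots> = of_nat 2 * \<beta> $ n"
  proof (cases "n = 0")
    case True then show ?thesis unfolding \<beta>_q_relation by simp
  next
    case False
    then have "t * (q ^ 2) $ n = q $ Suc n - (1 + t) * q $ n" using qq by simp
    then have e: "t * (of_nat n * (q ^ 2) $ n) = of_nat n * (q $ Suc n - (1 + t) * q $ n)"
      by (metis mult.left_commute)
    show ?thesis unfolding e \<beta>_q_relation by (simp add: algebra_simps)
  qed
  finally show ?thesis by simp
qed

lemma binomial_series_nth: "((1 + fps_const c * fps_X) ^ n) $ k = of_nat (n choose k) * (c :: int poly) ^ k"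
proof (induction n arbitrary: k)
  case (Suc n)
  have "(1 + fps_const c * fps_X) ^ Suc n = (1 + fps_const c * fps_X) ^ n + fps_X * (fps_const c * (1 + fps_const c * fps_X) ^ n)"
    by (simp add: algebra_simps)
  then have "((1 + fps_const c * fps_X) ^ Suc n) $ k = ((1 + fps_const c * fps_X) ^ n + fps_X * (fps_const c * (1 + fps_const c * fps_X) ^ n)) $ k"
    by metis
  then show ?case using Suc by (cases k) (simp_all add: algebra_simps)
qed (cases k; simp)

lemma coeff_F: "coeff ((\<phi> ^ n) $ m) i = (if i \<le> m then int (n choose i) * int (n choose (m - i)) else 0)"
proof -
  have t: "t ^ j = monom 1 j" for j by (simp add: monom_altdef)
  have "(\<phi> ^ n) $ m = ((1 + fps_const t * fps_X) ^ n * (1 + fps_const 1 * fps_X) ^ n) $ m"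
    by (simp add: \<phi>_def power_mult_distrib mult.commute)
  also have "\<dots> = (\<Sum>j=0..m. (of_nat (n choose j) * t ^ j) * (of_nat (n choose (m - j)) * 1 ^ (m - j)))"
    unfolding fps_mult_nth binomial_series_nth ..
  also have "\<dots> = (\<Sum>j=0..m. monom (int (n choose j) * int (n choose (m - j))) j)"
    by (intro sum.cong refl) (simp add: t of_nat_poly smult_monom mult.commute)
  also have "coeff \<dots> i = (\<Sum>j=0..m. if j = i then int (n choose i) * int (n choose (m - i)) else 0)"
    by (simp add: coeff_sum)
  also have "\<dots> = (if i \<le> m then int (n choose i) * int (n choose (m - i)) else 0)" by simp
  finally show ?thesis .
qed


section \<open>Logarithmic derivatives in the upper half-plane\<close>

definition only_real :: "complex poly \<Rightarrow> bool" where
  "only_real f \<longleftrightarrow> (\<forall>z. poly f z = 0 \<longrightarrow> z \<in> \<real>)"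

lemma Im_real_div:
  assumes "Im z > 0" "r > 0" shows "Im (of_real r / (z - of_real a)) < 0"
proof -
  have "Im (of_real r / (z - of_real a)) = - (r * Im z) / (cmod (z - of_real a))\<^sup>2"
    by (simp add: Im_divide cmod_power2)
  moreover have "cmod (z - of_real a) > 0" using assms by (auto simp: complex_eq_iff)
  ultimately show ?thesis using assms by simp
qed

text \<open>The factor \<open>(z - 1)^2\<close> is the Jacobian of \<open>z \<mapsto> (1 + z) / (1 - z)\<close>: in that coordinate this is
  the Gauss--Lucas estimate \<open>Im (g' / g) \<le> 0\<close>.\<close>

lemma Im_log_deriv_le:
  assumes "only_real f" "Im z > 0"
  shows "Im ((z - 1)\<^sup>2 * (poly (pderiv f) z / poly f z) - of_nat (degree f) * (z - 1)) \<le> 0"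
  using assms(1)
proof (induction "degree f" arbitrary: f rule: less_induct)
  case less
  show ?case
  proof (cases "degree f = 0")
    case True
    then obtain c where "f = [:c:]" by (meson degree_eq_zeroE)
    then show ?thesis by simp
  next
    case False
    then have "\<not> constant (poly f)" by (simp add: constant_degree)
    then obtain a where a: "poly f a = 0" using fundamental_theorem_of_algebra by blast
    then obtain r where r: "a = of_real r" using less.prems unfolding only_real_def by (meson Reals_cases)
    obtain g where g: "f = [:- a, 1:] * g" using a by (auto simp: poly_eq_0_iff_dvd dvd_def)
    have "f \<noteq> 0" using False by auto
    then have "g \<noteq> 0" using g by auto
    then have d: "degree f = Suc (degree g)" unfolding g by (subst degree_mult_eq) auto
    have og: "only_real g" using less.prems unfolding only_real_def g by simp
    have nz: "poly g z \<noteq> 0" using og assms(2) unfolding only_real_def by (auto simp: complex_is_Real_iff)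
    have za: "z - a \<noteq> 0" using assms(2) r by auto
    have "poly (pderiv f) z / poly f z = 1 / (z - a) + poly (pderiv g) z / poly g z"
      unfolding g pderiv_mult using nz za by (simp add: pderiv_pCons divide_simps) (simp add: algebra_simps)
    then have "(z - 1)\<^sup>2 * (poly (pderiv f) z / poly f z) - of_nat (degree f) * (z - 1) =
        ((z - 1)\<^sup>2 / (z - a) - (z - 1)) +
        ((z - 1)\<^sup>2 * (poly (pderiv g) z / poly g z) - of_nat (degree g) * (z - 1))"
      using za by (simp add: d algebra_simps add_divide_distrib)
    \<comment> \<open>Up to a real constant each zero contributes a nonnegative multiple of 1 / (z -
      r), hence a nonpositive imaginary part.\<close>
    moreover have "(z - 1)\<^sup>2 / (z - a) - (z - 1) = of_real ((r - 1)\<^sup>2) / (z - of_real r) + of_real (r - 1)"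
      using za unfolding r by (simp add: field_simps power2_eq_square)
    moreover have "Im (of_real ((r - 1)\<^sup>2) / (z - of_real r)) \<le> 0"
      using Im_real_div[OF assms(2), of "(r - 1)\<^sup>2" r] by (cases "r = 1") auto
    ultimately show ?thesis using less.hyps[of g] og d by simp
  qed
qed

lemma only_realI:
  assumes "\<And>z. Im z > 0 \<Longrightarrow> poly f z \<noteq> 0" "\<And>i. coeff f i \<in> \<real>"
  shows "only_real f"
  unfolding only_real_def
proof (intro allI impI)
  fix z assume z: "poly f z = 0"
  have "poly f (cnj z) = cnj (poly f z)" using assms(2) by (simp add: poly_cnj_real)
  then have "poly f (cnj z) = 0" using z by simp
  then have "\<not> Im z > 0" "\<not> Im (cnj z) > 0" using z assms(1) by blast+
  then show "z \<in> \<real>" by (simp add: complex_is_Real_iff)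
qed

text \<open>Up to the substitution \<open>z = (x - 1) / (x + 1)\<close> these are the \<open>m\<close>-th derivatives of
  \<open>(x^2 - 1)^n\<close>.\<close>

definition legendre :: "nat \<Rightarrow> nat \<Rightarrow> complex poly" where
  "legendre n m = (\<Sum>i\<le>m. monom (of_nat ((n choose i) * (n choose (m - i)))) i)"

lemma coeff_legendre: "coeff (legendre n m) i = (if i \<le> m then of_nat ((n choose i) * (n choose (m - i))) else 0)"
proof -
  have "coeff (legendre n m) i = (\<Sum>j\<le>m. if j = i then of_nat ((n choose i) * (n choose (m - i))) else 0)"
    by (simp add: legendre_def coeff_sum)
  then show ?thesis by simp
qed

lemma degree_legendre: "m \<le> n \<Longrightarrow> degree (legendre n m) = m"
  by (intro antisym degree_le le_degree) (auto simp: coeff_legendre)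

lemma choose_Suc_mult: "of_nat (Suc k) * of_nat (n choose Suc k) = (of_nat n - of_nat k) * (of_nat (n choose k) :: complex)"
proof (cases "k \<le> n")
  case True
  have "Suc k * (n choose Suc k) = (n - k) * (n choose k)"
    by (simp only: binomial_absorb_comp binomial_absorption)
  then show ?thesis using True by (metis of_nat_diff of_nat_mult)
qed (simp add: binomial_eq_0)

text \<open>Differentiation, transported to the coordinate z. On coefficients it is the absorption
  identity for either binomial, with m + 1 split into m + 1 - i and i.\<close>

lemma legendre_Suc:
  assumes "m < n"
  shows "smult (of_nat (Suc m)) (legendre n (Suc m)) =
    [:of_nat n - of_nat m, of_nat n:] * legendre n m + [:0, 1, -1:] * pderiv (legendre n m)"
proof (rule poly_eqI)
  fix i
  let ?s = "\<lambda>i. coeff (legendre n m) i"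
  let ?b = "\<lambda>k. of_nat (n choose k) :: complex"
  have e: "[:0, 1, -1:] * pderiv (legendre n m) = pCons 0 (pderiv (legendre n m)) - pCons 0 (pCons 0 (pderiv (legendre n m)))"
    by simp
  have e': "[:of_nat n - of_nat m, of_nat n:] * legendre n m = smult (of_nat n - of_nat m) (legendre n m) + pCons 0 (smult (of_nat n) (legendre n m))"
    by simp
  have rhs: "coeff ([:of_nat n - of_nat m, of_nat n:] * legendre n m + [:0, 1, -1:] * pderiv (legendre n m)) i =
     (of_nat n - of_nat m + of_nat i) * ?s i + (if i = 0 then 0 else (of_nat n - of_nat (i - 1)) * ?s (i - 1))"
    unfolding e e' by (cases i; cases "i - 1") (auto simp: coeff_pCons coeff_pderiv algebra_simps split: nat.splits)
  show "coeff (smult (of_nat (Suc m)) (legendre n (Suc m))) i =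
    coeff ([:of_nat n - of_nat m, of_nat n:] * legendre n m + [:0, 1, -1:] * pderiv (legendre n m)) i"
  proof (cases "i \<le> Suc m")
    case False then show ?thesis unfolding rhs by (auto simp: coeff_legendre)
  next
    case True
    have 1: "(of_nat n - of_nat m + of_nat i) * ?s i = of_nat (Suc m - i) * (?b i * ?b (Suc m - i))"
    proof (cases "i \<le> m")
      case i: True
      then have "of_nat n - of_nat m + of_nat i = (of_nat n - of_nat (m - i) :: complex)" by (simp add: of_nat_diff)
      then have "(of_nat n - of_nat m + of_nat i) * ?s i = ?b i * ((of_nat n - of_nat (m - i)) * ?b (m - i))"
        using i by (simp add: coeff_legendre)
      also have "\<dots> = ?b i * (of_nat (Suc (m - i)) * ?b (Suc (m - i)))" unfolding choose_Suc_mult ..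
      finally show ?thesis using i by (simp only: Suc_diff_le ac_simps)
    qed (use True in \<open>simp add: coeff_legendre le_Suc_eq\<close>)
    have 2: "(if i = 0 then 0 else (of_nat n - of_nat (i - 1)) * ?s (i - 1)) = of_nat i * (?b i * ?b (Suc m - i))"
    proof (cases i)
      case (Suc j)
      then have "(of_nat n - of_nat j) * ?s j = (of_nat n - of_nat j) * ?b j * ?b (m - j)"
        using True by (simp add: coeff_legendre)
      also have "\<dots> = of_nat (Suc j) * ?b (Suc j) * ?b (m - j)" unfolding choose_Suc_mult ..
      finally show ?thesis using Suc by (simp add: mult.assoc)
    qed simp
    have 3: "of_nat (Suc m) = of_nat (Suc m - i) + (of_nat i :: complex)"
      using True by (simp add: of_nat_diff del: of_nat_Suc)
    show ?thesis unfolding rhs 1 2 using True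
      by (simp only: coeff_smult coeff_legendre if_True 3 distrib_right of_nat_mult)
  qed
qed

text \<open>At a zero of the next polynomial in the upper half-plane, \<open>legendre_Suc\<close>
  fixes the logarithmic derivative of the previous one. The quantity in
  \<open>Im_log_deriv_le\<close> becomes (n - m) (z - 1 / z), which has positive imaginary
  part.\<close>

lemma only_real_legendre: "m \<le> n \<Longrightarrow> only_real (legendre n m)"
proof (induction m)
  case 0
  have "legendre n 0 = 1" by (simp add: legendre_def)
  then show ?case by (simp add: only_real_def)
next
  case (Suc m)
  then have m: "m < n" and IH: "only_real (legendre n m)" by auto
  show ?case
  proof (rule only_realI)
    fix z :: complex assume z: "Im z > 0"
    let ?f = "legendre n m"
    have nz: "poly ?f z \<noteq> 0" using IH z unfolding only_real_def by (auto simp: complex_is_Real_iff)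
    have z0: "z \<noteq> 0" "z \<noteq> 1" using z by auto
    show "poly (legendre n (Suc m)) z \<noteq> 0"
    proof
      assume "poly (legendre n (Suc m)) z = 0"
      then have "poly (smult (of_nat (Suc m)) (legendre n (Suc m))) z = 0" by simp
      then have "(of_nat n - of_nat m + z * of_nat n) * poly ?f z + (z * (1 - z)) * poly (pderiv ?f) z = 0"
        unfolding legendre_Suc[OF m] by (simp add: algebra_simps)
      then have "z * (z - 1) * poly (pderiv ?f) z = (of_nat n - of_nat m + z * of_nat n) * poly ?f z"
        by (simp add: algebra_simps)
      then have r: "poly (pderiv ?f) z / poly ?f z = (of_nat n - of_nat m + z * of_nat n) / (z * (z - 1))"
        using nz z0 by (simp add: field_simps)
      have "(z - 1)\<^sup>2 * (poly (pderiv ?f) z / poly ?f z) - of_nat (degree ?f) * (z - 1) =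
          of_real (real n - real m) * (z - 1 / z)"
        unfolding r using z0 m by (simp add: degree_legendre field_simps power2_eq_square)
      moreover have "Im (of_real (real n - real m) * (z - 1 / z)) > 0"
        using m z Im_real_div[OF z, of 1 0] by simp
      ultimately show False using Im_log_deriv_le[OF IH z] by simp
    qed
  next
    show "coeff (legendre n (Suc m)) i \<in> \<real>" for i by (simp add: coeff_legendre)
  qed
qed

section \<open>Real zeros for fans, whirls and wheels\<close>

lemma only_real_zeros_iff: "only_real_zeros p \<longleftrightarrow> only_real (map_poly of_int p)"
  by (simp add: only_real_zeros_def only_real_def)

lemma only_real_smult: "c \<noteq> 0 \<Longrightarrow> only_real (smult c f) \<longleftrightarrow> only_real f"
  by (simp add: only_real_def)

lemma coeff_of_nat_mult: "coeff (of_nat k * p) i = of_nat k * coeff p i"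
  by (simp add: of_nat_poly)

lemma only_real_fan: "only_real_zeros (q $ Suc n)"
proof -
  have e: "of_nat (Suc n) * q $ Suc n = (\<phi> ^ Suc n) $ n" using lagrange_q[of "Suc n" 1] by simp
  have c: "int (Suc n) * coeff (q $ Suc n) i = coeff ((\<phi> ^ Suc n) $ n) i" for i
    unfolding e[symmetric] coeff_of_nat_mult by simp
  have "smult (of_nat (Suc n)) (map_poly of_int (q $ Suc n)) = legendre (Suc n) n"
  proof (rule poly_eqI)
    fix i
    have "coeff (smult (of_nat (Suc n)) (map_poly of_int (q $ Suc n)) :: complex poly) i = of_int (int (Suc n) * coeff (q $ Suc n) i)"
      by (simp add: coeff_map_poly)
    then show "coeff (smult (of_nat (Suc n)) (map_poly of_int (q $ Suc n))) i = coeff (legendre (Suc n) n) i"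
      unfolding c coeff_F coeff_legendre by simp
  qed
  then have "only_real (smult (of_nat (Suc n)) (map_poly of_int (q $ Suc n)))"
    using only_real_legendre[of n "Suc n"] by simp
  then show ?thesis unfolding only_real_zeros_iff only_real_smult[OF of_nat_neq_0] .
qed

lemma map_poly_\<beta>: "map_poly of_int (\<beta> $ n) = legendre n n"
  by (rule poly_eqI) (simp add: coeff_map_poly \<beta>_nth coeff_F coeff_legendre)

lemma only_real_whirl: "only_real_zeros (\<beta> $ n)"
  unfolding only_real_zeros_iff map_poly_\<beta> by (rule only_real_legendre) simp


text \<open>\<open>x\<close>, \<open>C\<close>, \<open>y\<close> stand for n choose k - 1, k and k +
  1. Expressing the neighbours by \<open>C\<close> makes both sides rational multiples of
  C^2.\<close>

lemma binomial_neighbours: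
  fixes n k x C y :: "'a::field"
  assumes x: "(n - k + 1) * x = k * C" and y: "(k + 1) * y = (n - k) * C"
    and nz: "n - k + 1 \<noteq> 0" "k + 1 \<noteq> 0"
  shows "(n + 1) * (n + 2) * (n * C\<^sup>2 - 2 * x * y) =
    n\<^sup>2 * (n + 1) * C\<^sup>2 + 2 * (n * C\<^sup>2 + (n - k + 1) * x\<^sup>2 + (k + 1) * y\<^sup>2)"
proof -
  have "x = k * C / (n - k + 1)" "y = (n - k) * C / (k + 1)"
    using x y nz by (simp_all add: field_simps)
  then show ?thesis using nz by (simp add: divide_simps power2_eq_square) algebra
qed

text \<open>Lagrange inversion with exponent 2 makes (2 / n) (n choose k - 1) (n choose k + 1) the
  coefficients of the correction t q^2.\<close>

lemma wheel_coeff: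
  "int n * coeff (\<beta> $ n - (T * (q * q)) $ n) k =
    int n * int (n choose k)^2 - 2 * (if k = 0 then 0 else int (n choose (k - 1))) * int (n choose Suc k)"
proof -
  have F: "of_nat n * (q * q) $ n = 2 * (fps_X ^ 2 * \<phi> ^ n) $ n"
    using lagrange_q[of n 2] by (simp add: power2_eq_square)
  have "int n * coeff ((T * (q * q)) $ n) k = (if k = 0 then 0 else int n * coeff ((q * q) $ n) (k - 1))"
    by (cases k) simp_all
  also have "\<dots> = (if k = 0 then 0 else 2 * coeff ((fps_X ^ 2 * \<phi> ^ n) $ n) (k - 1))"
  proof -
    have "int n * coeff ((q * q) $ n) i = 2 * coeff ((fps_X ^ 2 * \<phi> ^ n) $ n) i" for i
    proof -
      have "coeff (of_nat n * (q * q) $ n) i = coeff (of_nat 2 * (fps_X ^ 2 * \<phi> ^ n) $ n) i" using F by simp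
      then show ?thesis unfolding coeff_of_nat_mult by simp
    qed
    then show ?thesis by simp
  qed
  also have "\<dots> = 2 * (if k = 0 then 0 else int (n choose (k - 1))) * int (n choose Suc k)"
  proof (cases "k = 0 \<or> n < 2")
    case True
    then show ?thesis by (auto simp: fps_X_power_mult_nth binomial_eq_0)
  next
    case False
    have "n choose (n - 2 - (k - 1)) = n choose Suc k" if "k - 1 \<le> n - 2"
    proof -
      have "Suc k \<le> n" "n - 2 - (k - 1) = n - Suc k" using that False by auto
      then show ?thesis using binomial_symmetric[of "Suc k" n] by simp
    qed
    moreover have "n choose Suc k = 0" if "\<not> k - 1 \<le> n - 2" using that False by (simp add: binomial_eq_0)
    ultimately show ?thesis using False by (auto simp: fps_X_power_mult_nth coeff_F)
  qed
  finally have "int n * coeff ((T * (q * q)) $ n) k = 2 * (if k = 0 then 0 else int (n choose (k - 1))) * int (n choose Suc k)" .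
  moreover have "coeff (\<beta> $ n) k = int (n choose k)^2"
    by (auto simp: \<beta>_nth coeff_F power2_eq_square binomial_symmetric[symmetric] binomial_eq_0)
  ultimately show ?thesis by (simp add: right_diff_distrib)
qed

text \<open>In the coordinate \<open>x = (1 + z) / (1 - z)\<close> the right-hand side is a combination
  \<open>\<alpha> A + \<gamma> x A'\<close> with \<open>\<alpha>, \<gamma> > 0\<close> of the Legendre polynomial \<open>A\<close>.\<close>

lemma wheel_operator:
  assumes "n > 0"
  defines "L \<equiv> legendre n n"
  shows "smult (of_nat (n * (n + 1) * (n + 2))) (map_poly of_int (\<beta> $ n - (T * (q * q)) $ n)) =
    smult (of_nat (n\<^sup>2 * (n + 1))) L + [:2 * of_nat n, 2 * of_nat n:] * L + [:2, 0, -2:] * pderiv L"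
proof (rule poly_eqI)
  fix k
  let ?n = "of_nat n :: complex" and ?k = "of_nat k :: complex"
  let ?p = "\<beta> $ n - (T * (q * q)) $ n"
  define C where "C = (of_nat (n choose k) :: complex)"
  define x where "x = (if k = 0 then 0 else of_nat (n choose (k - 1)) :: complex)"
  define y where "y = (of_nat (n choose Suc k) :: complex)"
  have L: "coeff L j = of_nat (n choose j)^2" for j
    by (auto simp: L_def coeff_legendre power2_eq_square binomial_symmetric[symmetric] binomial_eq_0)
  have xr: "(?n - ?k + 1) * x = ?k * C"
  proof (cases k)
    case (Suc j)
    then show ?thesis using choose_Suc_mult[of j n] by (simp add: x_def C_def)
  qed (simp add: x_def)
  have yr: "(?k + 1) * y = (?n - ?k) * C" using choose_Suc_mult[of k n] by (simp add: y_def C_def add.commute)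
  have "of_int (int n * coeff ?p k) = ?n * C\<^sup>2 - 2 * x * y"
    unfolding wheel_coeff by (simp add: C_def x_def y_def)
  then have cp: "?n * of_int (coeff ?p k) = ?n * C\<^sup>2 - 2 * x * y" by (simp only: of_int_mult of_int_of_nat_eq)
  have lhs: "coeff (smult (of_nat (n * (n + 1) * (n + 2))) (map_poly of_int ?p)) k =
      (?n + 1) * (?n + 2) * (?n * C\<^sup>2 - 2 * x * y)"
    unfolding cp[symmetric] by (simp only: coeff_smult coeff_map_poly of_int_0 of_nat_mult of_nat_add of_nat_1 of_nat_numeral ac_simps)
  have e: "[:2 * ?n, 2 * ?n:] * L = smult (2 * ?n) L + pCons 0 (smult (2 * ?n) L)"
    "[:2, 0, -2:] * pderiv L = smult 2 (pderiv L) - pCons 0 (pCons 0 (smult 2 (pderiv L)))" by simp_all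
  have xk: "(if k = 0 then 0 else f (coeff L (k - 1))) = f (x\<^sup>2)" if "f 0 = (0::complex)" for f
    using that by (simp add: x_def L)
  have "coeff (smult (of_nat (n\<^sup>2 * (n + 1))) L + [:2 * ?n, 2 * ?n:] * L + [:2, 0, -2:] * pderiv L) k =
     ?n\<^sup>2 * (?n + 1) * C\<^sup>2 + 2 * (?n * C\<^sup>2 + (?n - ?k + 1) * x\<^sup>2 + (?k + 1) * y\<^sup>2)"
    unfolding e C_def x_def y_def
    by (cases k; cases "k - 1") (auto simp: coeff_pCons coeff_pderiv L algebra_simps power2_eq_square split: nat.splits)
  also have "\<dots> = (?n + 1) * (?n + 2) * (?n * C\<^sup>2 - 2 * x * y)"
  \<comment> \<open>The only index at which the denominator n - k + 1 vanishes; there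
    \<open>C\<close> and \<open>y\<close> are 0.\<close>
  proof (cases "k = n + 1")
    case True
    then show ?thesis using yr by (simp add: C_def x_def y_def binomial_eq_0)
  next
    case False
    have "?n - ?k + 1 \<noteq> 0" using False by (metis add.commute add_diff_eq diff_add_cancel eq_iff_diff_eq_0 of_nat_1 of_nat_add of_nat_eq_iff)
    moreover have "?k + 1 \<noteq> 0" by (metis of_nat_Suc of_nat_eq_0_iff nat.distinct(2) add.commute)
    ultimately show ?thesis using binomial_neighbours[OF xr yr] by simp
  qed
  finally show "coeff (smult (of_nat (n * (n + 1) * (n + 2))) (map_poly of_int ?p)) k =
     coeff (smult (of_nat (n\<^sup>2 * (n + 1))) L + [:2 * ?n, 2 * ?n:] * L + [:2, 0, -2:] * pderiv L) k"
    unfolding lhs ..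
qed

text \<open>At a zero in the upper half-plane \<open>wheel_operator\<close> fixes the logarithmic
  derivative of the Legendre polynomial. The quantity in \<open>Im_log_deriv_le\<close> becomes a -
  2 a / (z + 1) with a > 0, which has positive imaginary part.\<close>

lemma only_real_wheel:
  assumes "n > 0" shows "only_real_zeros (\<beta> $ n - (T * (q * q)) $ n)"
  unfolding only_real_zeros_iff
proof (rule only_realI)
  let ?p = "\<beta> $ n - (T * (q * q)) $ n"
  show "coeff (map_poly of_int ?p) i \<in> \<real>" for i by (simp add: coeff_map_poly)
  fix z :: complex assume z: "Im z > 0"
  let ?L = "legendre n n"
  have L: "only_real ?L" by (rule only_real_legendre) simp
  have nz: "poly ?L z \<noteq> 0" using L z unfolding only_real_def by (auto simp: complex_is_Real_iff)
  have z0: "z - 1 \<noteq> 0" "z + 1 \<noteq> 0" using z by (auto simp: complex_eq_iff)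
  \<comment> \<open>The first coefficient of \<open>wheel_operator\<close> after halving the
    identity.\<close>
  define a where "a = real (n\<^sup>2 * (n + 1)) / 2"
  have a2: "(of_nat (n\<^sup>2 * (n + 1)) :: complex) = 2 * of_real a" by (simp add: a_def)
  have a: "a > 0" using assms by (simp add: a_def add_pos_nonneg)
  show "poly (map_poly of_int ?p) z \<noteq> 0"
  proof
    assume "poly (map_poly of_int ?p) z = 0"
    then have "poly (smult (of_nat (n * (n + 1) * (n + 2))) (map_poly of_int ?p)) z = 0" by simp
    then have "(2 * of_real a + 2 * of_nat n * (1 + z)) * poly ?L z + 2 * (1 - z\<^sup>2) * poly (pderiv ?L) z = 0"
      unfolding wheel_operator[OF assms] a2 by (simp add: algebra_simps power2_eq_square)
    then have "2 * ((z - 1) * (z + 1) * poly (pderiv ?L) z) = 2 * ((of_real a + of_nat n * (1 + z)) * poly ?L z)"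
      by (simp add: algebra_simps power2_eq_square)
    then have "(z - 1) * (z + 1) * poly (pderiv ?L) z = (of_real a + of_nat n * (1 + z)) * poly ?L z"
      by (simp only: mult_cancel_left) simp
    then have "poly (pderiv ?L) z * ((z - 1) * (z + 1)) = (of_real a + of_nat n * (1 + z)) * poly ?L z"
      by (simp only: mult.commute)
    moreover have "(z - 1) * (z + 1) \<noteq> 0" using z0 by simp
    ultimately have r: "poly (pderiv ?L) z / poly ?L z = (of_real a + of_nat n * (1 + z)) / ((z - 1) * (z + 1))"
      using frac_eq_eq[OF nz] by blast
    have "(z - 1)\<^sup>2 * (poly (pderiv ?L) z / poly ?L z) - of_nat (degree ?L) * (z - 1) =
        of_real a - of_real (2 * a) / (z - of_real (- 1))"
      unfolding r using z0 by (simp add: degree_legendre divide_simps power2_eq_square) (simp add: algebra_simps)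
    moreover have "Im (of_real a - of_real (2 * a) / (z - of_real (- 1))) > 0"
      using Im_real_div[OF z, of "2 * a" "-1"] a by simp
    ultimately show False using Im_log_deriv_le[OF L z] by simp
  qed
qed

theorem theorem1p7:
  shows "(\<forall>n::nat. n \<ge> 1 \<longrightarrow> only_real_zeros (Z_graph (fan_graph n)))
    \<and> (\<forall>n::nat. n \<ge> 3 \<longrightarrow> only_real_zeros (Z_graph (wheel_graph n)))
    \<and> (\<forall>n::nat. n \<ge> 3 \<longrightarrow> only_real_zeros (Z_poly (whirl_matroid n)))"
  using only_real_fan only_real_wheel only_real_whirl
  by (auto simp: Z_graph_fan Z_graph_wheel Z_poly_whirl)

end
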